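(* (Adams' criterion) Let $p>1$, assume that $X$ supports a $(p,p)$-Poincar\'e inequality for $N^{1,p}_0$, and let $E\subset X$ be a bounded measurable set with $C_p(X\setminus E)>0$. Let $f\in D^p(E)$ and $\psi:E\to[-\infty,\infty]$. Then $\mathcal{K}_{\psi,f}\ne\varnothing$ if and only if $$\int_0^\infty t^{p-1}\,\mathrm{cap}_p(\{x\in E:\psi(x)-f(x)>t\},E)\,dt<\infty .$$
   Context: $1\le p<\infty$ and $X=(X,d,\mu)$ is a metric space with a Borel regular measure $\mu$ (defined on the completion of the Borel $\sigma$-algebra) such that $0<\mu(B)<\infty$ for all balls $B$ (balls are nonempty and open). Curves are nonconstant, compact and rectifiable, parameterized by arc length as $\gamma:[0,l_\gamma]\to X$. A property holds for $p$-almost every curve if the family $\Gamma$ of curves for which it fails has zero $p$-modulus, i.e. there is a nonnegative Borel $\rho\in L^p(X)$ with $\int_\gamma\rho\,ds=\infty$ for every $\gamma\in\Gamma$. A nonnegative Borel function $g$ is an upper gradient of $u:X\to[-\infty,\infty]$ if $|u(\gamma(0))-u(\gamma(l_\gamma))|\le\int_\gamma g\,ds$ for all curves $\gamma$ (the left-hand side is $\infty$ whenever both terms are infinite); a nonnegative measurable $g$ is a $p$-weak upper gradient if this holds for $p$-almost every curve. If $u$ has an upper gradient in $L^p_{\rm loc}(X)$ (local: each point has a ball on which the property holds), its minimal $p$-weak upper gradient $g_u\in L^p_{\rm loc}(X)$ is the (a.e. unique) $p$-weak upper gradient satisfying $g_u\le g$ a.e. for every $p$-weak upper gradient $g\in L^p_{\rm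 loc}(X)$ of $u$. $N^{1,p}(X)$ is the set of everywhere defined measurable $u:X\to[-\infty,\infty]$ having an upper gradient in $L^p_{\rm loc}(X)$ with $\|u\|_{N^{1,p}(X)}=(\int_X|u|^p\,d\mu+\int_X g_u^p\,d\mu)^{1/p}<\infty$. $D^p(X)$ is the set of everywhere defined measurable functions having an upper gradient in $L^p(X)$. For measurable $E\subset X$, $N^{1,p}(E)$ and $D^p(E)$ are defined by regarding $E$ as a metric space on its own (with $d$, $\mu$ restricted to $E$, and only curves in $E$). The capacity of $A\subset X$ is $C_p(A)=\inf\|u\|_{N^{1,p}(X)}^p$ over all $u\in N^{1,p}(X)$ with $u=1$ on $A$; q.e. means outside a set of $C_p$-capacity zero (always with respect to $X$). For $E\subset X$, $N^{1,p}_0(E)=\{h|_E: h\in N^{1,p}(X),\ h=0 \text{ on } X\setminus E\}$; functions in $N^{1,p}_0(E)$ are regarded as extended by $0$ outside $E$ when needed. $\mathcal{K}_{\psi,f}=\{v\in D^p(E): v-f\in N^{1,p}_0(E)\text{ and }v\ge\psi\text{ q.e. in }E\}$ (the admissible class of the single obstacle problem). For a nonempty bounded $E\subset X$ and $A\subset E$, the variational capacity is $\mathrm{cap}_p(A,E)=\inf\int_X g_u^p\,d\mu$ over all $u\in N^{1,p}_0(E)$ (extended by $0$ outside $E$) such that $u\ge1$ on $A$ (infimum of the empty set is $\infty$). $X$ supports a $(p,p)$-Poincar\'e inequality for $N^{1,p}_0$ if for every bounded $E\subset X$ with $C_p(X\setminus E)>0$ there is $C_E>0$ such that $\int_X|u|^p\,d\mu\le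 C_E\int_X g_u^p\,d\mu$ for all $u\in N^{1,p}_0(E)$ (extended by $0$ outside $E$). *)

theory Defs
  imports "HOL-Analysis.Analysis"
begin

text \<open>
  A metric measure space is represented by a measure \<open>M\<close> on a type of class
  \<^class>\<open>metric_space\<close>; its underlying set is \<open>space M\<close>, with the metric inherited from the
  type.  A measurable subset \<open>E\<close>, regarded as a metric measure space on its own, is then
  \<open>restrict_space M E\<close>, and every notion below that takes \<open>M\<close> as a parameter only looks at points,
  curves and Borel sets of \<open>space M\<close>.  Functions on \<open>space M\<close> are represented by functions on
  the whole type, whose values outside \<open>space M\<close> play no role.
\<close>

text \<open>
  The standing assumptions on the ambient space.  Borel regularity (each measurable set lies in a
  Borel set of the same measure) is a consequence of \<open>M\<close> being a completed Borel measure.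
\<close>
definition metric_measure_space :: "'a::metric_space measure \<Rightarrow> bool" where
  "metric_measure_space M \<longleftrightarrow>
     (\<exists>N. sets N = sets borel \<and> M = completion N) \<and>
     (\<forall>x r. r > 0 \<longrightarrow> 0 < emeasure M (ball x r) \<and> emeasure M (ball x r) < \<infinity>)"

text \<open>Only used with exponents \<open>q > 0\<close>.\<close>
definition epow :: "ennreal \<Rightarrow> real \<Rightarrow> ennreal" where
  "epow x q = (if x = \<infinity> then \<infinity> else ennreal (enn2real x powr q))"

definition Lp_integral :: "real \<Rightarrow> 'a measure \<Rightarrow> ('a \<Rightarrow> ennreal) \<Rightarrow> ennreal" where
  "Lp_integral p M g = (\<integral>\<^sup>+x. epow (g x) p \<partial>M)"

definition in_Lp_loc :: "real \<Rightarrow> 'a::metric_space measure \<Rightarrow> ('a \<Rightarrow> ennreal) \<Rightarrow> bool" where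
  "in_Lp_loc p M g \<longleftrightarrow>
     (\<forall>x\<in>space M. \<exists>r>0. (\<integral>\<^sup>+y. epow (g y) p * indicator (ball x r) y \<partial>M) < \<infinity>)"

definition curve_length :: "(real \<Rightarrow> 'a::metric_space) \<Rightarrow> real \<Rightarrow> real \<Rightarrow> ennreal" where
  "curve_length \<gamma> a b =
     (SUP ts \<in> {ts. sorted ts \<and> set ts \<subseteq> {a..b}}.
        \<Sum>i<length ts - 1. ennreal (dist (\<gamma> (ts ! i)) (\<gamma> (ts ! Suc i))))"

text \<open>
  A nonconstant compact rectifiable curve, parameterized by arc length, is a pair \<open>(l, \<gamma>)\<close> of its
  length \<open>l > 0\<close> and its parameterization \<open>\<gamma>\<close> on \<open>{0..l}\<close>.  Continuity follows from the
  arc length condition, which makes \<open>\<gamma>\<close> 1-Lipschitz on \<open>{0..l}\<close>.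
\<close>
definition curves :: "'a::metric_space measure \<Rightarrow> (real \<times> (real \<Rightarrow> 'a)) set" where
  "curves M = {(l, \<gamma>). l > 0 \<and> \<gamma> ` {0..l} \<subseteq> space M \<and>
     (\<forall>s t. 0 \<le> s \<and> s \<le> t \<and> t \<le> l \<longrightarrow> curve_length \<gamma> s t = ennreal (t - s))}"

definition curve_integral :: "real \<times> (real \<Rightarrow> 'a) \<Rightarrow> ('a \<Rightarrow> ennreal) \<Rightarrow> ennreal" where
  "curve_integral c g = (\<integral>\<^sup>+t. g (snd c t) \<partial>lebesgue_on {0..fst c})"

definition zero_modulus ::
  "real \<Rightarrow> 'a::metric_space measure \<Rightarrow> (real \<times> (real \<Rightarrow> 'a)) set \<Rightarrow> bool" where
  "zero_modulus p M \<Gamma> \<longleftrightarrow>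
     (\<exists>\<rho>\<in>borel_measurable (restrict_space borel (space M)).
        Lp_integral p M \<rho> < \<infinity> \<and> (\<forall>c\<in>\<Gamma>. curve_integral c \<rho> = \<infinity>))"

text \<open>The oscillation between the endpoints is \<open>\<infinity>\<close> whenever both values are infinite.\<close>
definition endpoint_gap :: "('a \<Rightarrow> ereal) \<Rightarrow> real \<times> (real \<Rightarrow> 'a) \<Rightarrow> ennreal" where
  "endpoint_gap u c =
     (let a = u (snd c 0); b = u (snd c (fst c))
      in if \<bar>a\<bar> = \<infinity> \<and> \<bar>b\<bar> = \<infinity> then \<infinity> else e2ennreal \<bar>a - b\<bar>)"

definition upper_gradient ::
  "'a::metric_space measure \<Rightarrow> ('a \<Rightarrow> ereal) \<Rightarrow> ('a \<Rightarrow> ennreal) \<Rightarrow> bool" where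
  "upper_gradient M u g \<longleftrightarrow>
     g \<in> borel_measurable (restrict_space borel (space M)) \<and>
     (\<forall>c\<in>curves M. endpoint_gap u c \<le> curve_integral c g)"

text \<open>
  Here \<open>g\<close> is only \<open>M\<close>-measurable, so \<open>g \<circ> \<gamma>\<close> may fail to be Lebesgue measurable.  The inequality
  for almost every curve includes that the curve integral is defined for almost every curve.
\<close>
definition weak_upper_gradient ::
  "real \<Rightarrow> 'a::metric_space measure \<Rightarrow> ('a \<Rightarrow> ereal) \<Rightarrow> ('a \<Rightarrow> ennreal) \<Rightarrow> bool" where
  "weak_upper_gradient p M u g \<longleftrightarrow>
     g \<in> borel_measurable M \<and>
     zero_modulus p M {c \<in> curves M.
       \<not> ((\<lambda>t. g (snd c t)) \<in> borel_measurable (lebesgue_on {0..fst c}) \<and>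
          endpoint_gap u c \<le> curve_integral c g)}"

definition minimal_weak_upper_gradient ::
  "real \<Rightarrow> 'a::metric_space measure \<Rightarrow> ('a \<Rightarrow> ereal) \<Rightarrow> ('a \<Rightarrow> ennreal) \<Rightarrow> bool" where
  "minimal_weak_upper_gradient p M u g \<longleftrightarrow>
     weak_upper_gradient p M u g \<and> in_Lp_loc p M g \<and>
     (\<forall>g'. weak_upper_gradient p M u g' \<and> in_Lp_loc p M g' \<longrightarrow> (AE x in M. g x \<le> g' x))"

text \<open>
  A representative of the minimal \<open>p\<close>-weak upper gradient, which is unique up to null sets.
  Only meaningful when \<open>u\<close> has an upper gradient in \<open>L\<^sup>p\<^sub>l\<^sub>o\<^sub>c\<close>.
\<close>
definition min_grad ::
  "real \<Rightarrow> 'a::metric_space measure \<Rightarrow> ('a \<Rightarrow> ereal) \<Rightarrow> 'a \<Rightarrow> ennreal" where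
  "min_grad p M u = (SOME g. minimal_weak_upper_gradient p M u g)"

definition grad_energy :: "real \<Rightarrow> 'a::metric_space measure \<Rightarrow> ('a \<Rightarrow> ereal) \<Rightarrow> ennreal" where
  "grad_energy p M u = Lp_integral p M (min_grad p M u)"

definition newtonian_norm :: "real \<Rightarrow> 'a::metric_space measure \<Rightarrow> ('a \<Rightarrow> ereal) \<Rightarrow> ennreal" where
  "newtonian_norm p M u =
     epow (Lp_integral p M (\<lambda>x. e2ennreal \<bar>u x\<bar>) + grad_energy p M u) (1 / p)"

definition newtonian :: "real \<Rightarrow> 'a::metric_space measure \<Rightarrow> ('a \<Rightarrow> ereal) set" where
  "newtonian p M = {u \<in> borel_measurable M.
     (\<exists>g. upper_gradient M u g \<and> in_Lp_loc p M g) \<and> newtonian_norm p M u < \<infinity>}"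

definition dirichlet :: "real \<Rightarrow> 'a::metric_space measure \<Rightarrow> ('a \<Rightarrow> ereal) set" where
  "dirichlet p M = {u \<in> borel_measurable M.
     \<exists>g. upper_gradient M u g \<and> Lp_integral p M g < \<infinity>}"

definition sobolev_capacity :: "real \<Rightarrow> 'a::metric_space measure \<Rightarrow> 'a set \<Rightarrow> ennreal" where
  "sobolev_capacity p M A =
     (INF u \<in> {u \<in> newtonian p M. \<forall>x\<in>A. u x = 1}. epow (newtonian_norm p M u) p)"

definition newtonian_zero ::
  "real \<Rightarrow> 'a::metric_space measure \<Rightarrow> 'a set \<Rightarrow> ('a \<Rightarrow> ereal) set" where
  "newtonian_zero p M E =
     {u. \<exists>h\<in>newtonian p M. (\<forall>x\<in>space M - E. h x = 0) \<and> (\<forall>x\<in>E. u x = h x)}"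

definition zero_extension :: "'a set \<Rightarrow> ('a \<Rightarrow> ereal) \<Rightarrow> 'a \<Rightarrow> ereal" where
  "zero_extension E u = (\<lambda>x. if x \<in> E then u x else 0)"

definition variational_capacity ::
  "real \<Rightarrow> 'a::metric_space measure \<Rightarrow> 'a set \<Rightarrow> 'a set \<Rightarrow> ennreal" where
  "variational_capacity p M A E =
     (INF u \<in> {u \<in> newtonian_zero p M E. \<forall>x\<in>A. u x \<ge> 1}. grad_energy p M (zero_extension E u))"

definition poincare_zero :: "real \<Rightarrow> 'a::metric_space measure \<Rightarrow> bool" where
  "poincare_zero p M \<longleftrightarrow>
     (\<forall>E. E \<subseteq> space M \<and> bounded E \<and> sobolev_capacity p M (space M - E) > 0 \<longrightarrow>
       (\<exists>C::real. C > 0 \<and> (\<forall>u\<in>newtonian_zero p M E.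
          Lp_integral p M (\<lambda>x. e2ennreal \<bar>zero_extension E u x\<bar>)
            \<le> ennreal C * grad_energy p M (zero_extension E u))))"

text \<open>
  Difference of extended reals, with the convention that \<open>\<infinity> - \<infinity>\<close> and \<open>-\<infinity> - (-\<infinity>)\<close> are \<open>0\<close>
  (in \<^typ>\<open>ereal\<close> they are \<open>\<infinity>\<close>).  Functions in \<^const>\<open>dirichlet\<close> may take infinite values, even on
  sets of positive measure that almost no curve meets.
\<close>
definition ediff :: "ereal \<Rightarrow> ereal \<Rightarrow> ereal" where
  "ediff a b = (if a = b then 0 else a - b)"

definition obstacle_class ::
  "real \<Rightarrow> 'a::metric_space measure \<Rightarrow> 'a set \<Rightarrow> ('a \<Rightarrow> ereal) \<Rightarrow> ('a \<Rightarrow> ereal) \<Rightarrow> ('a \<Rightarrow> ereal) set" where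
  "obstacle_class p M E \<psi> f =
     {v \<in> dirichlet p (restrict_space M E).
        (\<lambda>x. ediff (v x) (f x)) \<in> newtonian_zero p M E \<and>
        sobolev_capacity p M {x \<in> E. \<not> v x \<ge> \<psi> x} = 0}"

end

theory Submission
  imports Defs
begin

text \<open>
  Along almost every curve a function with a \<open>p\<close>-integrable weak upper gradient \<open>g\<close> is continuous
  with increments bounded by the integral of \<open>g\<close>.  This gives the localization of gradients of
  truncations to level sets without differentiating along curves, and pointwise minima of weak
  upper gradients are handled by approximating a measurable set of parameters by finite unions of
  intervals.

  If \<open>v\<close> is admissible, then \<open>{\<psi> - f > t}\<close> lies in \<open>{v - f > t}\<close> up to a set of capacity zero.
  Testing the capacity at the levels \<open>2\<^sup>j\<close> with the truncations of \<open>v - f\<close> between \<open>2\<^sup>j\<^sup>-\<^sup>1\<close> and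
  \<open>2\<^sup>j\<close>, whose gradients live on disjoint sets, bounds the integral by the energy of \<open>v - f\<close>
  (Maz'ya's capacitary inequality).  Conversely, for almost optimal test functions \<open>u\<^sub>j\<close> at the level
  \<open>2\<^sup>j\<^sup>+\<^sup>1\<close>, the function \<open>f + sup\<^sub>j 2\<^sup>j\<^sup>+\<^sup>3 \<bar>u\<^sub>j\<bar>\<close> is admissible: its energy is bounded by the
  sum, and the Poincare inequality bounds its norm.
\<close>

section \<open>Powers of extended nonnegative reals\<close>

text \<open>The increments of a function are compared with an integral on all subintervals of a
  curve at once. This is possible for almost every curve because a family is null as soon as each of
  its members has a subcurve in a given null family. Four obstacles shape the rest.
  \<open>min_grad\<close> is a choice, so a minimal gradient must be constructed before energies
  mean anything. Gradients are only locally p-integrable, so finiteness of their integrals along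
  almost every curve needs a countable cover; separability of the space is not assumed and is
  derived from balls having positive finite measure. Countably many conditions or scales must be
  merged into one p-integrable function; pointwise l^p norms do this, since their p-th powers
  integrate additively. Finally \<open>f\<close> may be infinite on a set of positive measure, where
  \<open>f + s\<close> minus \<open>f\<close> need not be \<open>s\<close>; it is shown that almost
  no curve meets such points while \<open>s\<close> is nonzero.\<close>

lemma epow_ennreal: "0 \<le> x \<Longrightarrow> epow (ennreal x) q = ennreal (x powr q)"
  by (simp add: epow_def)

lemma epow_top [simp]: "epow \<infinity> q = \<infinity>" "epow top q = top"
  by (simp_all add: epow_def)

lemma epow_0 [simp]: "epow 0 q = 0"
  by (simp add: epow_def)

lemma epow_one [simp]: "epow 1 q = 1"
  by (simp add: epow_def)

lemma epow_1 [simp]: "epow x 1 = x"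
  by (cases x) (simp_all add: epow_ennreal)

lemma epow_mono: "q \<ge> 0 \<Longrightarrow> x \<le> y \<Longrightarrow> epow x q \<le> epow y q"
  by (cases x; cases y) (auto simp: epow_ennreal top_unique intro: ennreal_leI powr_mono2)

lemma epow_epow: "epow (epow x q) r = epow x (q * r)"
  by (cases x) (simp_all add: epow_ennreal powr_powr)

lemma epow_eq_0_iff: "epow x q = 0 \<longleftrightarrow> x = 0"
  by (cases x) (auto simp: epow_ennreal)

lemma epow_mult: "epow (x * y) q = epow x q * epow y q"
proof (cases "x = 0 \<or> y = 0")
  case True
  then show ?thesis by auto
next
  case False
  then show ?thesis
    by (cases x; cases y)
      (auto simp: epow_ennreal powr_mult ennreal_mult_top ennreal_top_mult
        epow_eq_0_iff simp flip: ennreal_mult)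
qed

lemma epow_less_top_iff: "epow x q < \<infinity> \<longleftrightarrow> x < \<infinity>"
  by (cases x) (auto simp: epow_ennreal)

text \<open>From \<open>x + y \<le> 2 * max x y\<close>. The constant is crude, but only its
  finiteness matters in \<open>Lp_integral_add_finite\<close>.\<close>

lemma epow_add_le:
  assumes "q > 0"
  shows "epow (x + y) q \<le> ennreal (2 powr q) * (epow x q + epow y q)"
proof -
  have "x + y \<le> ennreal 2 * max x y"
    by (metis add_mono ennreal_numeral max.cobounded1 max.cobounded2 mult_2 zero_le_numeral)
  then have "epow (x + y) q \<le> epow (ennreal 2 * max x y) q"
    using assms by (intro epow_mono) auto
  also have "\<dots> = ennreal (2 powr q) * epow (max x y) q"
    by (simp only: epow_mult) (simp add: epow_ennreal del: ennreal_numeral)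
  also have "\<dots> \<le> ennreal (2 powr q) * (epow x q + epow y q)"
    by (intro mult_left_mono) (auto simp: max_def add_increasing add_increasing2)
  finally show ?thesis .
qed

lemma borel_measurable_epow [measurable]:
  assumes [measurable]: "g \<in> borel_measurable M"
  shows "(\<lambda>x. epow (g x) q) \<in> borel_measurable M"
proof -
  have "Measurable.pred M (\<lambda>x. g x = \<infinity>)"
    by simp
  moreover have "(\<lambda>x. enn2real (g x) powr q) \<in> borel_measurable M"
    by (intro powr_real_measurable) measurable
  ultimately show ?thesis
    unfolding epow_def by (intro measurable_If) (simp_all add: pred_def)
qed

text \<open>The pointwise l^p norm of the sequence. It dominates every member, hence the supremum,
  and its p-th power integrates to the sum of the p-th power integrals. It serves as a common
  witness for countably many null curve families and as a gradient of a supremum.\<close>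

definition lp_sum :: "real \<Rightarrow> (nat \<Rightarrow> 'a \<Rightarrow> ennreal) \<Rightarrow> 'a \<Rightarrow> ennreal" where
  "lp_sum p g x = epow (\<Sum>n. epow (g n x) p) (1 / p)"

lemma lp_sum_ge:
  assumes "p > 0"
  shows "g n x \<le> lp_sum p g x"
proof -
  have "g n x = epow (epow (g n x) p) (1 / p)"
    using assms by (simp add: epow_epow)
  also have "\<dots> \<le> lp_sum p g x"
    unfolding lp_sum_def using assms
    by (intro epow_mono order_trans[OF _ sum_le_suminf[of _ "{n}"]]) auto
  finally show ?thesis .
qed

lemma borel_measurable_lp_sum [measurable (raw)]:
  "(\<And>n. g n \<in> borel_measurable M) \<Longrightarrow> lp_sum p g \<in> borel_measurable M"
  unfolding lp_sum_def[abs_def] by measurable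

lemma Lp_integral_lp_sum:
  assumes "p > 0" "\<And>n. g n \<in> borel_measurable M"
  shows "Lp_integral p M (lp_sum p g) = (\<Sum>n. Lp_integral p M (g n))"
proof -
  have "epow (lp_sum p g x) p = (\<Sum>n. epow (g n x) p)" for x
    using assms(1) by (simp add: lp_sum_def epow_epow)
  then show ?thesis
    using assms(2) by (simp add: Lp_integral_def nn_integral_suminf)
qed

lemma Lp_integral_mono:
  assumes "p > 0" "\<And>x. x \<in> space M \<Longrightarrow> g x \<le> h x"
  shows "Lp_integral p M g \<le> Lp_integral p M h"
  unfolding Lp_integral_def using assms by (intro nn_integral_mono epow_mono) auto

lemma Lp_integral_mono_AE:
  assumes "p > 0" "AE x in M. g x \<le> h x"
  shows "Lp_integral p M g \<le> Lp_integral p M h"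
  unfolding Lp_integral_def using assms
  by (intro nn_integral_mono_AE) (auto elim!: eventually_mono intro: epow_mono)

lemma Lp_integral_cmult:
  assumes "g \<in> borel_measurable M"
  shows "Lp_integral p M (\<lambda>x. c * g x) = epow c p * Lp_integral p M g"
  unfolding Lp_integral_def epow_mult using assms by (simp add: nn_integral_cmult)

lemma Lp_integral_add_finite:
  assumes "p > 0" "g \<in> borel_measurable M" "h \<in> borel_measurable M"
    "Lp_integral p M g < \<infinity>" "Lp_integral p M h < \<infinity>"
  shows "Lp_integral p M (\<lambda>x. g x + h x) < \<infinity>"
proof -
  have "Lp_integral p M (\<lambda>x. g x + h x) \<le>
      (\<integral>\<^sup>+x. ennreal (2 powr p) * (epow (g x) p + epow (h x) p) \<partial>M)"
    unfolding Lp_integral_def using assms(1) by (intro nn_integral_mono epow_add_le)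
  also have "\<dots> = ennreal (2 powr p) * (Lp_integral p M g + Lp_integral p M h)"
    unfolding Lp_integral_def using assms(2,3) by (simp add: nn_integral_cmult nn_integral_add)
  also have "\<dots> < \<infinity>"
    using assms(4,5) by (simp add: ennreal_mult_less_top)
  finally show ?thesis .
qed

text \<open>Take \<open>c n powr p = (1/2)^n / (1 + a n)\<close>, where the 1 guards against
  \<open>a n = 0\<close>. Such factors make functions with unrelated norms summable before they are
  joined by \<open>lp_sum\<close>.\<close>

lemma scaling_factors:
  assumes "p > 0" "\<And>n::nat. a n < (\<infinity>::ennreal)"
  obtains c :: "nat \<Rightarrow> real" where "\<And>n. c n > 0" "(\<Sum>n. epow (ennreal (c n)) p * a n) < \<infinity>"
proof -
  have "\<exists>c::real. c > 0 \<and> epow (ennreal c) p * a n \<le> ennreal ((1/2)^n)" for n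
  proof -
    define r where "r = (1/2)^n / (1 + enn2real (a n))"
    have r: "r > 0" by (simp add: r_def add_pos_nonneg)
    have "epow (ennreal (r powr (1 / p))) p * a n = ennreal (r * enn2real (a n))"
      using assms r by (simp add: epow_ennreal powr_powr ennreal_mult less_top[symmetric])
    also have "\<dots> \<le> ennreal ((1/2)^n)"
      by (intro ennreal_leI) (simp add: r_def field_simps add_pos_nonneg)
    finally show ?thesis using r by (intro exI[of _ "r powr (1 / p)"]) auto
  qed
  then obtain c :: "nat \<Rightarrow> real" where c: "\<And>n. c n > 0" "\<And>n. epow (ennreal (c n)) p * a n \<le> ennreal ((1/2)^n)"
    by metis
  have "(\<Sum>n. epow (ennreal (c n)) p * a n) \<le> (\<Sum>n. ennreal ((1/2)^n))"
    by (intro suminf_le c) auto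
  also have "\<dots> < \<infinity>"
    by (subst suminf_ennreal2) (auto intro: summable_geometric)
  finally show ?thesis using c(1) that by blast
qed

section \<open>Functions of one variable controlled by an integral\<close>

text \<open>Absolute continuity of \<open>w\<close> in integral form, with \<open>G\<close> in the
  role of a bound for the derivative. Testing every subinterval allows bounds to be cut and
  recombined, and integrability of \<open>G\<close> gives continuity.\<close>

definition controlled :: "(real \<Rightarrow> real) \<Rightarrow> (real \<Rightarrow> ennreal) \<Rightarrow> real \<Rightarrow> bool" where
  "controlled w G l \<longleftrightarrow>
     G \<in> borel_measurable lebesgue \<and> (\<integral>\<^sup>+r. G r \<partial>lebesgue) < \<infinity> \<and>
     (\<forall>s t. 0 \<le> s \<and> s \<le> t \<and> t \<le> l \<longrightarrow>
        ennreal \<bar>w s - w t\<bar> \<le> (\<integral>\<^sup>+r. G r * indicator {s..t} r \<partial>lebesgue))"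

lemma AE_lebesgue_neq: "AE r in lebesgue. r \<noteq> (a::real)"
  by (intro AE_completion AE_lborel_singleton)

lemma borel_measurable_lebesgue_times_indicator:
  fixes G :: "'a::euclidean_space \<Rightarrow> ennreal"
  assumes "G \<in> borel_measurable lebesgue" "A \<in> sets borel"
  shows "(\<lambda>r. G r * indicator A r) \<in> borel_measurable lebesgue"
  using assms by (intro borel_measurable_times_ennreal borel_measurable_indicator) auto

text \<open>Absolute continuity of the integral: the integrands over the shrinking intervals tend to
  0 everywhere except at the limit parameter, and \<open>G\<close> dominates them.\<close>

lemma controlled_continuous:
  assumes "controlled w G l"
  shows "continuous_on {0..l} w"
  unfolding continuous_on_sequentially comp_def
proof (intro allI ballI impI, elim conjE)
  fix x :: "nat \<Rightarrow> real" and a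
  assume a: "a \<in> {0..l}" and x: "\<forall>n. x n \<in> {0..l}" and lim: "x \<longlonglongrightarrow> a"
  have [measurable]: "G \<in> borel_measurable lebesgue" and fin: "(\<integral>\<^sup>+r. G r \<partial>lebesgue) < \<infinity>"
    and bd: "\<And>s t. 0 \<le> s \<Longrightarrow> s \<le> t \<Longrightarrow> t \<le> l \<Longrightarrow>
        ennreal \<bar>w s - w t\<bar> \<le> (\<integral>\<^sup>+r. G r * indicator {s..t} r \<partial>lebesgue)"
    using assms by (auto simp: controlled_def)
  define F where "F n r = G r * indicator {min (x n) a..max (x n) a} r" for n r
  have "(\<lambda>n. \<integral>\<^sup>+r. F n r \<partial>lebesgue) \<longlonglongrightarrow> (\<integral>\<^sup>+(r::real). 0 \<partial>lebesgue)"
  proof (rule nn_integral_dominated_convergence[of F lebesgue "\<lambda>_. 0" G])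
    show "AE r in lebesgue. (\<lambda>n. F n r) \<longlonglongrightarrow> 0"
      using AE_lebesgue_neq[of a]
    proof eventually_elim
      case (elim r)
      have "eventually (\<lambda>n. dist (x n) a < dist r a) sequentially"
        using lim elim by (intro tendstoD) auto
      then have "eventually (\<lambda>n. F n r = 0) sequentially"
        by eventually_elim (auto simp: F_def dist_real_def indicator_def)
      then show ?case by (rule tendsto_eventually)
    qed
    show "AE r in lebesgue. F n r \<le> G r" for n
      by (auto simp: F_def indicator_def)
  qed (use fin in \<open>auto simp: F_def[abs_def] intro: borel_measurable_lebesgue_times_indicator\<close>)
  then have lim0: "(\<lambda>n. \<integral>\<^sup>+r. F n r \<partial>lebesgue) \<longlonglongrightarrow> 0" by simp
  have le: "ennreal (dist (w (x n)) (w a)) \<le> (\<integral>\<^sup>+r. F n r \<partial>lebesgue)" for n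
    using bd[of "min (x n) a" "max (x n) a"] x a
    by (cases "x n \<le> a") (auto simp: F_def dist_real_def abs_minus_commute)
  have "(\<lambda>n. ennreal (dist (w (x n)) (w a))) \<longlonglongrightarrow> ennreal 0"
    by (rule tendsto_sandwich[OF _ _ tendsto_const]) (use le lim0 in auto)
  then have "(\<lambda>n. dist (w (x n)) (w a)) \<longlonglongrightarrow> 0"
    by (subst (asm) tendsto_ennreal_iff) auto
  then show "(\<lambda>n. w (x n)) \<longlonglongrightarrow> w a"
    by (subst tendsto_dist_iff)
qed

lemma controlled_uminus: "controlled w G l \<Longrightarrow> controlled (\<lambda>r. - w r) G l"
  by (simp add: controlled_def abs_minus_commute)

definition truncate :: "real \<Rightarrow> real \<Rightarrow> real \<Rightarrow> real" where
  "truncate a b x = max a (min b x)"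

text \<open>Between the last time at which \<open>w\<close> is at most \<open>truncate a b (w 0)\<close> and the first later
  time at which it reaches \<open>truncate a b (w l)\<close>, it stays strictly between \<open>a\<close> and \<open>b\<close>.\<close>
lemma controlled_truncate_increase:
  assumes "controlled w G l" "l \<ge> 0" "a < b"
  shows "ennreal (truncate a b (w l) - truncate a b (w 0)) \<le>
    (\<integral>\<^sup>+r. G r * indicator {r. a < w r \<and> w r < b} r * indicator {0..l} r \<partial>lebesgue)"
proof (cases "truncate a b (w 0) < truncate a b (w l)")
  case False
  then show ?thesis by (simp add: ennreal_neg)
next
  case True
  define \<alpha> \<beta> where "\<alpha> = truncate a b (w 0)" and "\<beta> = truncate a b (w l)"
  \<comment> \<open>The strict increase excludes \<open>w 0 \<ge> b\<close> and
    \<open>w l \<le> a\<close>, so truncation can only raise the initial value and lower the final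
    one.\<close>
  have ab: "a \<le> \<alpha>" "\<alpha> < \<beta>" "\<beta> \<le> b" "w 0 \<le> \<alpha>" "\<beta> \<le> w l"
    using True assms(3) by (auto simp: \<alpha>_def \<beta>_def truncate_def max_def min_def split: if_splits)
  note cont = controlled_continuous[OF assms(1)]
  define S where "S = {r\<in>{0..l}. w r \<le> \<alpha>}"
  have "closed S"
    unfolding S_def by (intro continuous_on_closed_Collect_le cont continuous_intros closed_atLeastAtMost)
  then have "compact ({0..l} \<inter> S)"
    by (intro compact_Int_closed compact_Icc)
  moreover have "{0..l} \<inter> S = S"
    by (auto simp: S_def)
  moreover have "S \<noteq> {}"
    using ab assms(2) by (auto simp: S_def)
  ultimately obtain s where s: "s \<in> S" "\<And>r. r \<in> S \<Longrightarrow> r \<le> s"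
    using compact_attains_sup by metis
  define T where "T = {r\<in>{s..l}. \<beta> \<le> w r}"
  have sl: "0 \<le> s" "s \<le> l" "w s \<le> \<alpha>" using s by (auto simp: S_def)
  have "closed T"
    unfolding T_def using sl
    by (intro continuous_on_closed_Collect_le continuous_on_subset[OF cont] continuous_intros closed_atLeastAtMost) auto
  then have "compact ({s..l} \<inter> T)"
    by (intro compact_Int_closed compact_Icc)
  moreover have "{s..l} \<inter> T = T"
    by (auto simp: T_def)
  moreover have "T \<noteq> {}"
    using ab sl by (auto simp: T_def)
  ultimately obtain t where t: "t \<in> T" "\<And>r. r \<in> T \<Longrightarrow> t \<le> r"
    using compact_attains_inf by metis
  have tl: "s \<le> t" "t \<le> l" "\<beta> \<le> w t" using t by (auto simp: T_def)
  have mid: "a < w r \<and> w r < b" if "s < r" "r < t" for r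
  proof -
    have "\<not> w r \<le> \<alpha>" using s(2)[of r] that sl tl by (auto simp: S_def)
    moreover have "\<not> \<beta> \<le> w r" using t(2)[of r] that sl tl by (auto simp: T_def)
    ultimately show ?thesis using ab by auto
  qed
  have "ennreal (\<beta> - \<alpha>) \<le> ennreal \<bar>w s - w t\<bar>"
    using tl sl ab by (intro ennreal_leI) auto
  also have "\<dots> \<le> (\<integral>\<^sup>+r. G r * indicator {s..t} r \<partial>lebesgue)"
    using assms(1) sl tl by (auto simp: controlled_def)
  \<comment> \<open>At \<open>s\<close> and \<open>t\<close> themselves the strict bounds on
    \<open>w\<close> may fail, so the comparison is made almost everywhere.\<close>
  also have "\<dots> \<le> (\<integral>\<^sup>+r. G r * indicator {r. a < w r \<and> w r < b} r * indicator {0..l} r \<partial>lebesgue)"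
  proof (rule nn_integral_mono_AE)
    show "AE r in lebesgue. G r * indicator {s..t} r
        \<le> G r * indicator {r. a < w r \<and> w r < b} r * indicator {0..l} r"
      using AE_lebesgue_neq[of s] AE_lebesgue_neq[of t]
    proof eventually_elim
      case (elim r)
      then show ?case using mid[of r] sl tl by (auto simp: indicator_def)
    qed
  qed
  finally show ?thesis by (simp add: \<alpha>_def \<beta>_def)
qed

lemma controlled_truncate:
  assumes "controlled w G l" "l \<ge> 0" "a < b"
  shows "ennreal \<bar>truncate a b (w 0) - truncate a b (w l)\<bar> \<le>
    (\<integral>\<^sup>+r. G r * indicator {r. a < w r \<and> w r < b} r * indicator {0..l} r \<partial>lebesgue)"
proof (cases "truncate a b (w 0) \<le> truncate a b (w l)")
  case True
  then show ?thesis using controlled_truncate_increase[OF assms] by (simp add: abs_if)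
next
  case False
  \<comment> \<open>The decreasing case is the increasing case for \<open>- w\<close> and the levels
    \<open>- b\<close> and \<open>- a\<close>.\<close>
  have "truncate (- b) (- a) (- x) = - truncate a b x" for x
    using assms(3) by (auto simp: truncate_def max_def min_def)
  moreover have "{r. - b < - w r \<and> - w r < - a} = {r. a < w r \<and> w r < b}"
    by auto
  ultimately show ?thesis
    using controlled_truncate_increase[OF controlled_uminus[OF assms(1)] assms(2), of "- b" "- a"] assms(3) False
    by (simp add: abs_if)
qed

text \<open>Cut \<open>{s..t}\<close> at the ends of the interval, use \<open>G\<close> on the
  middle piece and \<open>H\<close> on the outer ones, and add the three increments by the triangle
  inequality.\<close>

lemma controlled_splice:
  assumes "controlled w G l" "controlled w H l"
  shows "controlled w (\<lambda>r. if r \<in> {a<..<b} then G r else H r) l"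
proof (cases "a < b")
  case False
  then show ?thesis using assms by simp
next
  case True
  define K where "K r = (if r \<in> {a<..<b} then G r else H r)" for r
  have [measurable]: "G \<in> borel_measurable lebesgue" "H \<in> borel_measurable lebesgue"
    using assms by (auto simp: controlled_def)
  have [measurable]: "K \<in> borel_measurable lebesgue"
    unfolding K_def[abs_def] by (intro measurable_If_set) auto
  have "(\<integral>\<^sup>+r. K r \<partial>lebesgue) \<le> (\<integral>\<^sup>+r. G r + H r \<partial>lebesgue)"
    by (intro nn_integral_mono) (auto simp: K_def)
  also have "\<dots> < \<infinity>"
    using assms by (subst nn_integral_add) (auto simp: controlled_def)
  finally have fin: "(\<integral>\<^sup>+r. K r \<partial>lebesgue) < \<infinity>" .
  have meas: "(\<lambda>r. G r * indicator {x..y} r) \<in> borel_measurable lebesgue"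
    "(\<lambda>r. H r * indicator {x..y} r) \<in> borel_measurable lebesgue" for x y
    by (auto intro: borel_measurable_lebesgue_times_indicator)
  have "ennreal \<bar>w s - w t\<bar> \<le> (\<integral>\<^sup>+r. K r * indicator {s..t} r \<partial>lebesgue)"
    if st: "0 \<le> s" "s \<le> t" "t \<le> l" for s t
  proof -
    \<comment> \<open>Clamping to \<open>{s..t}\<close> treats all relative positions of the two
      intervals at once: a piece that would lie outside shrinks to a point.\<close>
    define a' b' where "a' = max s (min a t)" and "b' = max s (min b t)"
    have o: "s \<le> a'" "a' \<le> b'" "b' \<le> t"
      using st True by (auto simp: a'_def b'_def)
    have "ennreal \<bar>w s - w t\<bar> \<le> ennreal (\<bar>w s - w a'\<bar> + \<bar>w a' - w b'\<bar> + \<bar>w b' - w t\<bar>)"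
      by (intro ennreal_leI) auto
    also have "\<dots> = ennreal \<bar>w s - w a'\<bar> + ennreal \<bar>w a' - w b'\<bar> + ennreal \<bar>w b' - w t\<bar>"
      by simp
    also have "\<dots> \<le> (\<integral>\<^sup>+r. H r * indicator {s..a'} r \<partial>lebesgue) +
        (\<integral>\<^sup>+r. G r * indicator {a'..b'} r \<partial>lebesgue) + (\<integral>\<^sup>+r. H r * indicator {b'..t} r \<partial>lebesgue)"
      using assms o st by (intro add_mono) (auto simp: controlled_def)
    also have "\<dots> = (\<integral>\<^sup>+r. H r * indicator {s..a'} r + G r * indicator {a'..b'} r
        + H r * indicator {b'..t} r \<partial>lebesgue)"
      by (simp add: nn_integral_add meas borel_measurable_add)
    also have "\<dots> \<le> (\<integral>\<^sup>+r. K r * indicator {s..t} r \<partial>lebesgue)"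
    proof (rule nn_integral_mono_AE)
      show "AE r in lebesgue. H r * indicator {s..a'} r + G r * indicator {a'..b'} r
        + H r * indicator {b'..t} r \<le> K r * indicator {s..t} r"
        using AE_lebesgue_neq[of s] AE_lebesgue_neq[of t] AE_lebesgue_neq[of a'] AE_lebesgue_neq[of b']
      proof eventually_elim
        case (elim r)
        consider "r < s" | "t < r" | "s < r" "r < a'" | "a' < r" "r < b'" | "b' < r" "r < t"
          using elim o by linarith
        then show ?case
        proof cases
          case 3
          then have "r < a" "r < t" using o by (auto simp: a'_def)
          then show ?thesis using 3 o by (simp add: K_def indicator_def)
        next
          case 4
          then have "a < r" "r < b" "s < r" "r < t" using o by (auto simp: a'_def b'_def)
          then show ?thesis using 4 o by (simp add: K_def indicator_def)
        next
          case 5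
          then have "b < r" "s < r" using o by (auto simp: b'_def)
          then show ?thesis using 5 o by (simp add: K_def indicator_def)
        qed (use o in auto)
      qed
    qed
    finally show ?thesis .
  qed
  then show ?thesis
    using fin unfolding controlled_def K_def[symmetric] by simp
qed

lemma controlled_cong_AE:
  assumes "controlled w G l" "AE r in lebesgue. G r = H r" "H \<in> borel_measurable lebesgue"
  shows "controlled w H l"
proof -
  have "(\<integral>\<^sup>+r. G r \<partial>lebesgue) = (\<integral>\<^sup>+r. H r \<partial>lebesgue)"
    using assms(2) by (rule nn_integral_cong_AE)
  moreover have "(\<integral>\<^sup>+r. G r * indicator {s..t} r \<partial>lebesgue) = (\<integral>\<^sup>+r. H r * indicator {s..t} r \<partial>lebesgue)" for s t
    using assms(2) by (intro nn_integral_cong_AE) auto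
  ultimately show ?thesis using assms(1,3) by (simp add: controlled_def)
qed

text \<open>With \<open>A = {r. G r < H r}\<close>, squeeze a finite union \<open>V\<close> of
  intervals between a compact \<open>K\<close> inside \<open>A\<close> and an open \<open>U\<close>
  around \<open>A\<close>. Repeated splicing permits \<open>G\<close> on \<open>V\<close> and
  \<open>H\<close> off \<open>V\<close>. This is the minimum on \<open>K\<close> and off
  \<open>U\<close>, and on \<open>U - K\<close> it is at most \<open>G + H\<close>.\<close>

lemma controlled_min_borel:
  assumes "controlled w G l" "controlled w H l"
    and [measurable]: "G \<in> borel_measurable borel" "H \<in> borel_measurable borel"
  shows "controlled w (\<lambda>r. min (G r) (H r)) l"
proof -
  define A where "A = {r. G r < H r}"
  \<comment> \<open>The mass of \<open>U - K\<close> under this measure bounds the error. The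
    measure is finite and Borel, hence regular from inside and from outside.\<close>
  define \<nu> where "\<nu> = density lborel (\<lambda>r. G r + H r)"
  have A[measurable]: "A \<in> sets borel" unfolding A_def by measurable
  have \<nu>: "emeasure \<nu> B = (\<integral>\<^sup>+r. (G r + H r) * indicator B r \<partial>lebesgue)" if "B \<in> sets borel" for B
    using that unfolding \<nu>_def by (subst emeasure_density) (auto simp: nn_integral_completion)
  have meas: "(\<lambda>r. min (G r) (H r)) \<in> borel_measurable lebesgue"
    "(\<lambda>r. G r + H r) \<in> borel_measurable lebesgue"
    by (auto intro!: measurable_completion)
  have sets: "sets \<nu> = sets borel" by (simp add: \<nu>_def)
  have fin: "(\<integral>\<^sup>+r. G r + H r \<partial>lebesgue) < \<infinity>"
    using assms by (subst nn_integral_add) (auto simp: controlled_def)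
  have fin\<nu>: "emeasure \<nu> (space \<nu>) \<noteq> \<infinity>"
    using fin \<nu>[of UNIV] by (auto simp: \<nu>_def)
  then have finB: "emeasure \<nu> B < \<infinity>" for B
    by (metis emeasure_space infinity_ennreal_def order_le_less_trans top.not_eq_extremum)
  have "ennreal \<bar>w s - w t\<bar> \<le> (\<integral>\<^sup>+r. min (G r) (H r) * indicator {s..t} r \<partial>lebesgue)"
    if st: "0 \<le> s" "s \<le> t" "t \<le> l" for s t
  proof (rule ennreal_le_epsilon)
    fix e :: real assume e: "0 < e"
    have "\<exists>U\<in>{U. A \<subseteq> U \<and> open U}. emeasure \<nu> U < emeasure \<nu> A + ennreal (e/2)"
      using e finB[of A] by (intro INF_approx_ennreal outer_regular[OF sets fin\<nu> A]) auto
    then obtain U where U: "A \<subseteq> U" "open U" "emeasure \<nu> U < emeasure \<nu> A + ennreal (e/2)"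
      by auto
    have "\<exists>K\<in>{K. K \<subseteq> A \<and> compact K}. emeasure \<nu> A < emeasure \<nu> K + ennreal (e/2)"
      using e finB[of A] by (intro SUP_approx_ennreal inner_regular[OF sets fin\<nu> A]) auto
    then obtain K where K: "K \<subseteq> A" "compact K" "emeasure \<nu> A < emeasure \<nu> K + ennreal (e/2)"
      by auto
    have [measurable]: "U \<in> sets borel" "K \<in> sets borel"
      using U K by (auto simp: borel_compact)
    have "\<forall>x\<in>K. \<exists>d>0. ball x d \<subseteq> U"
      using U K open_contains_ball by (metis subset_iff)
    then obtain d where d: "\<And>x. x \<in> K \<Longrightarrow> d x > 0 \<and> ball x (d x) \<subseteq> U"
      by metis
    have "K \<subseteq> (\<Union>x\<in>K. ball x (d x))" using d by force
    then obtain T where T: "T \<subseteq> K" "finite T" "K \<subseteq> (\<Union>x\<in>T. ball x (d x))"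
      using compactE_image[OF K(2), of K "\<lambda>x. ball x (d x)"] by auto
    define V where "V = (\<Union>x\<in>T. ball x (d x))"
    \<comment> \<open>A ball in the reals is an open interval, so each ball costs one
      splice.\<close>
    have "controlled w (\<lambda>r. if r \<in> (\<Union>x\<in>T. ball x (d x)) then G r else H r) l"
      using T(2)
    proof (induction T)
      case (insert x T)
      have "(\<lambda>r. if r \<in> (\<Union>x\<in>insert x T. ball x (d x)) then G r else H r) =
        (\<lambda>r. if r \<in> {x - d x<..<x + d x} then G r else if r \<in> (\<Union>x\<in>T. ball x (d x)) then G r else H r)"
        by (auto simp: fun_eq_iff ball_eq_greaterThanLessThan)
      then show ?case using controlled_splice[OF assms(1) insert.IH] by simp
    qed (use assms in simp)
    then have "ennreal \<bar>w s - w t\<bar> \<le> (\<integral>\<^sup>+r. (if r \<in> V then G r else H r) * indicator {s..t} r \<partial>lebesgue)"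
      using st by (auto simp: V_def controlled_def)
    also have "\<dots> \<le> (\<integral>\<^sup>+r. min (G r) (H r) * indicator {s..t} r + (G r + H r) * indicator (U - K) r \<partial>lebesgue)"
    proof (rule nn_integral_mono)
      fix r
      have "K \<subseteq> V" "V \<subseteq> U" using T d by (auto simp: V_def)
      then show "(if r \<in> V then G r else H r) * indicator {s..t} r \<le>
          min (G r) (H r) * indicator {s..t} r + (G r + H r) * indicator (U - K) r"
        using K(1) U(1)
        by (cases "r \<in> K"; cases "r \<in> V"; cases "r \<in> U"; cases "r \<in> A")
          (auto simp: indicator_def A_def min_def add_increasing add_increasing2 not_less)
    qed
    also have "\<dots> = (\<integral>\<^sup>+r. min (G r) (H r) * indicator {s..t} r \<partial>lebesgue) + emeasure \<nu> (U - K)"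
      by (subst nn_integral_add) (auto simp: \<nu> intro!: meas borel_measurable_lebesgue_times_indicator)
    also have "emeasure \<nu> (U - K) \<le> ennreal e"
    proof -
      have "emeasure \<nu> (U - K) = emeasure \<nu> U - emeasure \<nu> K"
        using finB[of K] K U by (intro emeasure_Diff) (auto simp: sets)
      also have "\<dots> \<le> ennreal e"
      proof (rule ennreal_minus_le_iff[THEN iffD2], intro disjI2 conjI)
        have "emeasure \<nu> U \<le> emeasure \<nu> A + ennreal (e/2)" using U by simp
        also have "\<dots> \<le> (emeasure \<nu> K + ennreal (e/2)) + ennreal (e/2)"
          using K by (intro add_right_mono) simp
        also have "\<dots> = emeasure \<nu> K + ennreal e"
          using e by (simp add: add.assoc flip: ennreal_plus)
        finally show "emeasure \<nu> U \<le> emeasure \<nu> K + ennreal e" .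
      qed (use finB[of U] in auto)
      finally show ?thesis .
    qed
    finally show "ennreal \<bar>w s - w t\<bar> \<le> (\<integral>\<^sup>+r. min (G r) (H r) * indicator {s..t} r \<partial>lebesgue) + ennreal e"
      by (simp add: add_left_mono)
  qed
  moreover have "(\<integral>\<^sup>+r. min (G r) (H r) \<partial>lebesgue) \<le> (\<integral>\<^sup>+r. G r + H r \<partial>lebesgue)"
    by (intro nn_integral_mono) (simp add: min_def add_increasing add_increasing2)
  ultimately show ?thesis
    using fin meas(1) by (auto simp: controlled_def)
qed

text \<open>Regularity concerns Borel measures, so both bounds are first replaced by almost
  everywhere equal Borel functions, which changes none of the integrals.\<close>

lemma controlled_min:
  assumes "controlled w G l" "controlled w H l"
  shows "controlled w (\<lambda>r. min (G r) (H r)) l"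
proof -
  have m: "G \<in> borel_measurable lebesgue" "H \<in> borel_measurable lebesgue"
    using assms by (auto simp: controlled_def)
  obtain G' where G': "G' \<in> borel_measurable borel" "AE r in lebesgue. G r = G' r"
    using completion_ex_borel_measurable[OF m(1)] by (auto intro: AE_completion)
  obtain H' where H': "H' \<in> borel_measurable borel" "AE r in lebesgue. H r = H' r"
    using completion_ex_borel_measurable[OF m(2)] by (auto intro: AE_completion)
  have m': "G' \<in> borel_measurable lebesgue" "H' \<in> borel_measurable lebesgue"
    using G'(1) H'(1) by (auto intro: measurable_completion)
  have "controlled w (\<lambda>r. min (G' r) (H' r)) l"
    using controlled_cong_AE[OF assms(1) G'(2) m'(1)] controlled_cong_AE[OF assms(2) H'(2) m'(2)]
      G'(1) H'(1) by (intro controlled_min_borel)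
  moreover have "AE r in lebesgue. min (G' r) (H' r) = min (G r) (H r)"
    using G'(2) H'(2) by eventually_elim simp
  moreover have "(\<lambda>r. min (G r) (H r)) \<in> borel_measurable lebesgue"
    using m by measurable
  ultimately show ?thesis by (rule controlled_cong_AE)
qed

section \<open>Curves\<close>

lemma (in complete_measure) borel_measurable_cong_AE:
  assumes f: "f \<in> M \<rightarrow>\<^sub>M N" and eq: "AE x in M. f x = g x" and g: "g \<in> space M \<rightarrow> space N"
  shows "g \<in> M \<rightarrow>\<^sub>M N"
proof (rule measurableI)
  fix A assume A: "A \<in> sets N"
  show "g -` A \<inter> space M \<in> sets M"
  proof (rule in_sets_AE)
    show "f -` A \<inter> space M \<in> sets M" using f A by (rule measurable_sets)
    show "AE x in M. (x \<in> f -` A \<inter> space M) = (x \<in> g -` A \<inter> space M)"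
      using eq by eventually_elim auto
  qed auto
qed (use g in auto)

text \<open>Extension by 0 to the whole line lets every curve integral use the single measure
  \<open>lebesgue\<close>, in the form expected by \<open>controlled\<close>.\<close>

definition curve_trace :: "real \<times> (real \<Rightarrow> 'a) \<Rightarrow> ('a \<Rightarrow> ennreal) \<Rightarrow> real \<Rightarrow> ennreal" where
  "curve_trace c g t = g (snd c t) * indicator {0..fst c} t"

definition subcurve :: "real \<times> (real \<Rightarrow> 'a) \<Rightarrow> real \<Rightarrow> real \<Rightarrow> real \<times> (real \<Rightarrow> 'a)" where
  "subcurve c s t = (t - s, \<lambda>r. snd c (s + r))"

lemma curve_integral_trace: "curve_integral c g = (\<integral>\<^sup>+t. curve_trace c g t \<partial>lebesgue)"
  unfolding curve_integral_def curve_trace_def by (subst nn_integral_restrict_space) auto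

lemma trace_measurable_iff:
  "(\<lambda>t. g (snd c t)) \<in> borel_measurable (lebesgue_on {0..fst c}) \<longleftrightarrow>
    curve_trace c g \<in> borel_measurable lebesgue"
  unfolding curve_trace_def[abs_def] by (subst borel_measurable_restrict_space_iff_ennreal) auto

text \<open>The factor \<open>1 *\<close> keeps the shape of the affine substitution rule that
  \<open>curve_integral_subcurve\<close> applies.\<close>

lemma trace_subcurve:
  assumes "0 \<le> s" "s \<le> t" "t \<le> fst c"
  shows "curve_trace (subcurve c s t) g r = curve_trace c g (s + 1 * r) * indicator {s..t} (s + 1 * r)"
  using assms by (auto simp: curve_trace_def subcurve_def indicator_def)

lemma curve_integral_subcurve:
  assumes "0 \<le> s" "s \<le> t" "t \<le> fst c" "curve_trace c g \<in> borel_measurable lebesgue"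
  shows "curve_integral (subcurve c s t) g = (\<integral>\<^sup>+r. curve_trace c g r * indicator {s..t} r \<partial>lebesgue)"
  unfolding curve_integral_trace trace_subcurve[OF assms(1-3)]
  using nn_integral_real_affine_lebesgue[of "\<lambda>r. curve_trace c g r * indicator {s..t} r" 1 s]
    borel_measurable_lebesgue_times_indicator[OF assms(4), of "{s..t}"] by simp

lemma dist_le_curve_length:
  assumes "s \<le> t"
  shows "ennreal (dist (\<gamma> s) (\<gamma> t)) \<le> curve_length \<gamma> s t"
  unfolding curve_length_def using assms by (intro SUP_upper2[of "[s, t]"]) auto

lemma curve_length_shift_le: "curve_length (\<lambda>r. \<gamma> (s + r)) a b \<le> curve_length \<gamma> (s + a) (s + b)"
  unfolding curve_length_def
proof (rule SUP_least)
  fix ts :: "real list" assume ts: "ts \<in> {ts. sorted ts \<and> set ts \<subseteq> {a..b}}"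
  show "(\<Sum>i<length ts - 1. ennreal (dist (\<gamma> (s + ts ! i)) (\<gamma> (s + ts ! Suc i)))) \<le>
      (SUP ts \<in> {ts. sorted ts \<and> set ts \<subseteq> {s + a..s + b}}.
        \<Sum>i<length ts - 1. ennreal (dist (\<gamma> (ts ! i)) (\<gamma> (ts ! Suc i))))"
  proof (rule SUP_upper2)
    show "map ((+) s) ts \<in> {ts. sorted ts \<and> set ts \<subseteq> {s + a..s + b}}"
      using ts by (auto simp: sorted_map)
  qed (auto intro!: sum_mono)
qed

lemma curve_length_shift: "curve_length (\<lambda>r. \<gamma> (s + r)) a b = curve_length \<gamma> (s + a) (s + b)"
  \<comment> \<open>The reverse bound is the same one for the shifted curve and the shift
    \<open>- s\<close>.\<close>
  using curve_length_shift_le[of \<gamma> s a b]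
    curve_length_shift_le[of "\<lambda>r. \<gamma> (s + r)" "- s" "s + a" "s + b"] by (simp add: antisym)

lemma subcurve_in_curves:
  assumes "c \<in> curves M" "0 \<le> s" "s < t" "t \<le> fst c"
  shows "subcurve c s t \<in> curves M"
proof -
  obtain l \<gamma> where c: "c = (l, \<gamma>)" by (cases c)
  have "\<gamma> (s + r) \<in> space M" if "0 \<le> r" "r \<le> t - s" for r
    using assms that unfolding c curves_def by (auto simp: image_subset_iff)
  moreover have "curve_length (\<lambda>r. \<gamma> (s + r)) a b = ennreal (b - a)"
    if "0 \<le> a" "a \<le> b" "b \<le> t - s" for a b
    unfolding curve_length_shift using assms that unfolding c curves_def by auto
  ultimately show ?thesis
    using assms by (auto simp: subcurve_def c curves_def)
qed

lemma curve_continuous_on: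
  assumes "c \<in> curves M"
  shows "continuous_on {0..fst c} (snd c)"
proof -
  obtain l \<gamma> where c: "c = (l, \<gamma>)" by (cases c)
  have *: "dist (\<gamma> s) (\<gamma> t) \<le> dist s t" if "0 \<le> s" "s \<le> t" "t \<le> l" for s t
  proof -
    have "ennreal (dist (\<gamma> s) (\<gamma> t)) \<le> ennreal (t - s)"
      using dist_le_curve_length[of s t \<gamma>] assms that by (auto simp: c curves_def)
    then show ?thesis using that by (simp add: dist_real_def)
  qed
  have "dist (\<gamma> s) (\<gamma> t) \<le> dist s t" if "s \<in> {0..l}" "t \<in> {0..l}" for s t
    using *[of s t] *[of t s] that by (cases "s \<le> t") (auto simp: dist_commute)
  then have "1-lipschitz_on {0..l} \<gamma>"
    by (intro lipschitz_onI) auto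
  then show ?thesis by (simp add: c lipschitz_on_continuous_on)
qed

text \<open>Formulated with the Borel sets of \<open>space M\<close> so that it also covers
  \<open>restrict_space M E\<close>, where an upper gradient is Borel only relative to
  \<open>E\<close>.\<close>

lemma curve_trace_measurable:
  assumes "c \<in> curves M" "g \<in> borel_measurable (restrict_space borel (space M))"
  shows "curve_trace c g \<in> borel_measurable lebesgue"
proof -
  have "snd c \<in> restrict_space borel {0..fst c} \<rightarrow>\<^sub>M restrict_space borel (space M)"
    using assms(1) curve_continuous_on[OF assms(1)]
    by (intro measurable_restrict_space2 borel_measurable_continuous_on_restrict) (auto simp: curves_def)
  then have "(\<lambda>t. g (snd c t)) \<in> borel_measurable (restrict_space borel {0..fst c})"
    using assms(2) by (rule measurable_compose)
  then have "curve_trace c g \<in> borel_measurable borel"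
    unfolding curve_trace_def[abs_def] by (subst (asm) borel_measurable_restrict_space_iff_ennreal) auto
  then show ?thesis by (intro measurable_completion) simp
qed

lemma trace_measurable_borel:
  assumes "c \<in> curves M" "g \<in> borel_measurable borel"
  shows "curve_trace c g \<in> borel_measurable lebesgue"
  using assms by (intro curve_trace_measurable measurable_restrict_space1)

text \<open>One infinite value makes the difference infinite, and for two infinite values the
  convention does. Hence any finite bound on the gap yields finiteness of \<open>u\<close> at the
  endpoints.\<close>

lemma endpoint_gap_finite:
  assumes "endpoint_gap u c < \<infinity>"
  shows "\<bar>u (snd c 0)\<bar> \<noteq> \<infinity>" "\<bar>u (snd c (fst c))\<bar> \<noteq> \<infinity>"
proof -
  have "\<bar>u (snd c 0)\<bar> \<noteq> \<infinity> \<and> \<bar>u (snd c (fst c))\<bar> \<noteq> \<infinity>"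
    using assms unfolding endpoint_gap_def Let_def
    by (cases "u (snd c 0)"; cases "u (snd c (fst c))") auto
  then show "\<bar>u (snd c 0)\<bar> \<noteq> \<infinity>" "\<bar>u (snd c (fst c))\<bar> \<noteq> \<infinity>"
    by auto
qed

lemma endpoint_gap_real:
  assumes "\<bar>u (snd c 0)\<bar> \<noteq> \<infinity>" "\<bar>u (snd c (fst c))\<bar> \<noteq> \<infinity>"
  shows "endpoint_gap u c =
    ennreal \<bar>real_of_ereal (u (snd c 0)) - real_of_ereal (u (snd c (fst c)))\<bar>"
  using assms unfolding endpoint_gap_def Let_def
  by (cases "u (snd c 0)"; cases "u (snd c (fst c))") (auto simp: e2ennreal_ereal)

text \<open>A weak upper gradient compares only the two endpoints of a curve. Control on all
  subintervals survives truncation of \<open>u\<close>, pointwise minima of gradients and their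
  decreasing limits, each on one fixed curve.\<close>

definition regular_along :: "('a \<Rightarrow> ereal) \<Rightarrow> ('a \<Rightarrow> ennreal) \<Rightarrow> real \<times> (real \<Rightarrow> 'a) \<Rightarrow> bool" where
  "regular_along u g c \<longleftrightarrow>
     (\<forall>t\<in>{0..fst c}. \<bar>u (snd c t)\<bar> \<noteq> \<infinity>) \<and>
     controlled (\<lambda>t. real_of_ereal (u (snd c t))) (curve_trace c g) (fst c)"

lemma regular_alongD:
  assumes "regular_along u g c" "fst c \<ge> 0"
  shows "curve_trace c g \<in> borel_measurable lebesgue" "endpoint_gap u c \<le> curve_integral c g"
    "curve_integral c g < \<infinity>"
proof -
  have "(\<integral>\<^sup>+r. curve_trace c g r * indicator {0..fst c} r \<partial>lebesgue) = curve_integral c g"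
    unfolding curve_integral_trace by (intro nn_integral_cong) (auto simp: curve_trace_def indicator_def)
  moreover have "ennreal \<bar>real_of_ereal (u (snd c 0)) - real_of_ereal (u (snd c (fst c)))\<bar> \<le>
      (\<integral>\<^sup>+r. curve_trace c g r * indicator {0..fst c} r \<partial>lebesgue)"
    using assms unfolding regular_along_def controlled_def by blast
  ultimately show "curve_trace c g \<in> borel_measurable lebesgue" "endpoint_gap u c \<le> curve_integral c g"
    "curve_integral c g < \<infinity>"
    using assms by (auto simp: regular_along_def controlled_def endpoint_gap_real curve_integral_trace)
qed

lemma regular_alongI:
  assumes "fst c > 0" "curve_trace c g \<in> borel_measurable lebesgue" "curve_integral c g < \<infinity>"
    "\<And>s t. 0 \<le> s \<Longrightarrow> s < t \<Longrightarrow> t \<le> fst c \<Longrightarrow>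
      endpoint_gap u (subcurve c s t) \<le> curve_integral (subcurve c s t) g"
  shows "regular_along u g c"
proof -
  have le: "endpoint_gap u (subcurve c s t) \<le> (\<integral>\<^sup>+r. curve_trace c g r * indicator {s..t} r \<partial>lebesgue)"
    if "0 \<le> s" "s < t" "t \<le> fst c" for s t
    using assms(4)[OF that] curve_integral_subcurve[OF _ _ _ assms(2)] that by simp
  have "(\<integral>\<^sup>+r. curve_trace c g r * indicator {s..t} r \<partial>lebesgue) \<le> curve_integral c g" for s t
    unfolding curve_integral_trace by (intro nn_integral_mono) (auto simp: indicator_def)
  then have fin: "endpoint_gap u (subcurve c s t) < \<infinity>" if "0 \<le> s" "s < t" "t \<le> fst c" for s t
    using le[OF that] assms(3) by (metis order_le_less_trans order_trans)
  \<comment> \<open>Every later parameter is the final point of a subcurve from 0; the parameter 0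
    is the initial point of the whole curve.\<close>
  have real: "\<bar>u (snd c t)\<bar> \<noteq> \<infinity>" if "t \<in> {0..fst c}" for t
  proof (cases "t = 0")
    case True
    then show ?thesis
      using endpoint_gap_finite(1)[OF fin[of 0 "fst c"]] assms(1) by (simp add: subcurve_def)
  next
    case False
    then show ?thesis
      using endpoint_gap_finite(2)[OF fin[of 0 t]] that by (simp add: subcurve_def)
  qed
  have "ennreal \<bar>real_of_ereal (u (snd c s)) - real_of_ereal (u (snd c t))\<bar> \<le>
      (\<integral>\<^sup>+r. curve_trace c g r * indicator {s..t} r \<partial>lebesgue)" if "0 \<le> s" "s \<le> t" "t \<le> fst c" for s t
  proof (cases "s = t")
    case False
    have "endpoint_gap u (subcurve c s t) = ennreal \<bar>real_of_ereal (u (snd c s)) - real_of_ereal (u (snd c t))\<bar>"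
      using real[of s] real[of t] that by (subst endpoint_gap_real) (auto simp: subcurve_def)
    then show ?thesis using le[of s t] that False by simp
  qed simp
  then show ?thesis
    using assms(2,3) real by (auto simp: regular_along_def controlled_def curve_integral_trace)
qed

section \<open>Almost every curve\<close>

definition ae_curve ::
  "real \<Rightarrow> 'a::metric_space measure \<Rightarrow> (real \<times> (real \<Rightarrow> 'a) \<Rightarrow> bool) \<Rightarrow> bool" where
  "ae_curve p M P \<longleftrightarrow> zero_modulus p M {c \<in> curves M. \<not> P c}"

lemma ae_curve_mono:
  assumes "ae_curve p M P" "\<And>c. c \<in> curves M \<Longrightarrow> P c \<Longrightarrow> Q c"
  shows "ae_curve p M Q"
  using assms unfolding ae_curve_def zero_modulus_def by blast

locale newtonian_space =
  fixes M :: "'a::metric_space measure" and p :: real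
  assumes metric_measure: "metric_measure_space M" and p_pos: "p > 0"
begin

section \<open>Borel representatives for the completed measure\<close>

lemma borel_base: obtains N where "sets N = sets borel" "M = completion N"
  using metric_measure by (auto simp: metric_measure_space_def)

lemma space_M [simp]: "space M = UNIV"
  by (rule borel_base) (metis space_borel space_completion sets_eq_imp_space_eq)

lemma complete_M: "complete_measure M"
  by (rule borel_base) (simp add: completion.complete_measure_axioms)

lemma borel_measurable_M: "f \<in> borel \<rightarrow>\<^sub>M K \<Longrightarrow> f \<in> M \<rightarrow>\<^sub>M K"
  by (rule borel_base) (metis measurable_completion measurable_cong_sets)

lemma sets_borel_M: "A \<in> sets borel \<Longrightarrow> A \<in> sets M"
  by (rule borel_base) (metis sets_completionI_sets)

lemma emeasure_ball: "r > 0 \<Longrightarrow> 0 < emeasure M (ball x r)" "r > 0 \<Longrightarrow> emeasure M (ball x r) < \<infinity>"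
  using metric_measure by (auto simp: metric_measure_space_def)

lemma null_set_borel_cover:
  assumes "A \<in> null_sets M"
  obtains B where "A \<subseteq> B" "B \<in> sets borel" "B \<in> null_sets M"
proof -
  obtain N where N: "sets N = sets borel" "M = completion N" by (rule borel_base)
  then obtain B where "A \<subseteq> B" "B \<in> null_sets N"
    using assms by (auto simp: null_sets_completion_iff2)
  then show ?thesis
    using that[of B] N by (auto simp: null_sets_def)
qed

text \<open>Take a Borel representative and put the value infinity on a Borel null set containing
  all discrepancies. Domination everywhere, not only almost everywhere, makes curve integrals
  comparable on every curve.\<close>

lemma borel_majorant:
  fixes g :: "'a \<Rightarrow> ennreal"
  assumes "g \<in> borel_measurable M"
  obtains h where "h \<in> borel_measurable borel" "\<And>x. g x \<le> h x" "AE x in M. g x = h x"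
proof -
  obtain N where N: "sets N = sets borel" "M = completion N" by (rule borel_base)
  obtain g' where g': "g' \<in> borel_measurable N" "AE x in M. g x = g' x"
    using completion_ex_borel_measurable[of g N] assms unfolding N(2) by (blast intro: AE_completion)
  then obtain A where A: "A \<in> null_sets M" "\<And>x. x \<notin> A \<Longrightarrow> g x = g' x"
    by (auto elim!: AE_E3)
  obtain B where B: "A \<subseteq> B" "B \<in> sets borel" "B \<in> null_sets M"
    by (rule null_set_borel_cover[OF A(1)])
  have g'_borel: "g' \<in> borel_measurable borel"
    using g'(1) measurable_cong_sets[OF N(1) refl] by blast
  show ?thesis
  proof
    show "(\<lambda>x. if x \<in> B then \<infinity> else g' x) \<in> borel_measurable borel"
      using B(2) g'_borel by (intro measurable_If_set) auto
    show "g x \<le> (if x \<in> B then \<infinity> else g' x)" for x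
      using A(2)[of x] B(1) by (cases "x \<in> A") auto
    show "AE x in M. g x = (if x \<in> B then \<infinity> else g' x)"
      using g'(2) AE_not_in[OF B(3)] by eventually_elim simp
  qed
qed

lemma restrict_borel_UNIV [simp]: "restrict_space borel (space M) = (borel :: 'a measure)"
  by (rule measure_eqI) (simp_all add: sets_restrict_space emeasure_restrict_space)

section \<open>Calculus of properties of almost every curve\<close>

lemma ae_curveI:
  assumes "\<rho> \<in> borel_measurable borel" "Lp_integral p M \<rho> < \<infinity>"
    "\<And>c. c \<in> curves M \<Longrightarrow> curve_integral c \<rho> < \<infinity> \<Longrightarrow> P c"
  shows "ae_curve p M P"
  unfolding ae_curve_def zero_modulus_def restrict_borel_UNIV using assms
  by (intro bexI[of _ \<rho>] conjI ballI)
    (metis (mono_tags, lifting) infinity_ennreal_def mem_Collect_eq top.not_eq_extremum)+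

lemma ae_curveE:
  assumes "ae_curve p M P"
  obtains \<rho> where "\<rho> \<in> borel_measurable borel" "Lp_integral p M \<rho> < \<infinity>"
    "\<And>c. c \<in> curves M \<Longrightarrow> curve_integral c \<rho> < \<infinity> \<Longrightarrow> P c"
proof -
  obtain \<rho> where \<rho>: "\<rho> \<in> borel_measurable borel" "Lp_integral p M \<rho> < \<infinity>"
    "\<forall>c\<in>{c \<in> curves M. \<not> P c}. curve_integral c \<rho> = \<infinity>"
    using assms unfolding ae_curve_def zero_modulus_def restrict_borel_UNIV by blast
  show ?thesis
  proof (rule that[OF \<rho>(1,2)])
    show "P c" if "c \<in> curves M" "curve_integral c \<rho> < \<infinity>" for c
    proof (rule ccontr)
      assume "\<not> P c"
      then have "curve_integral c \<rho> = \<infinity>" using \<rho>(3) that(1) by blast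
      then show False using that(2) by simp
    qed
  qed
qed

text \<open>After scaling, the witnesses have an \<open>lp_sum\<close> in L^p. It dominates each
  \<open>c n * \<rho> n\<close> with \<open>c n > 0\<close>, so where its curve integral is finite,
  so is that of every \<open>\<rho> n\<close>.\<close>

lemma ae_curve_all:
  assumes "\<And>n::nat. ae_curve p M (P n)"
  shows "ae_curve p M (\<lambda>c. \<forall>n. P n c)"
proof -
  have "\<exists>\<rho>. \<rho> \<in> borel_measurable borel \<and> Lp_integral p M \<rho> < \<infinity> \<and>
    (\<forall>c. c \<in> curves M \<longrightarrow> curve_integral c \<rho> < \<infinity> \<longrightarrow> P n c)" for n
    using ae_curveE[OF assms[of n]] by metis
  then obtain \<rho> where \<rho>: "\<And>n. \<rho> n \<in> borel_measurable borel" "\<And>n. Lp_integral p M (\<rho> n) < \<infinity>"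
    "\<And>n c. c \<in> curves M \<Longrightarrow> curve_integral c (\<rho> n) < \<infinity> \<Longrightarrow> P n c"
    by metis
  obtain c :: "nat \<Rightarrow> real" where c: "\<And>n. c n > 0" "(\<Sum>n. epow (ennreal (c n)) p * Lp_integral p M (\<rho> n)) < \<infinity>"
    using scaling_factors[of p "\<lambda>n. Lp_integral p M (\<rho> n)"] p_pos \<rho>(2) by metis
  define h where "h n x = ennreal (c n) * \<rho> n x" for n x
  have meas: "h n \<in> borel_measurable borel" for n
    unfolding h_def[abs_def] using \<rho>(1) by measurable
  show ?thesis
  proof (rule ae_curveI)
    show "lp_sum p h \<in> borel_measurable borel"
      using meas by (rule borel_measurable_lp_sum)
    have "Lp_integral p M (h n) = epow (ennreal (c n)) p * Lp_integral p M (\<rho> n)" for n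
      unfolding h_def[abs_def] by (intro Lp_integral_cmult borel_measurable_M \<rho>(1))
    then have "Lp_integral p M (lp_sum p h) = (\<Sum>n. epow (ennreal (c n)) p * Lp_integral p M (\<rho> n))"
      using p_pos meas by (subst Lp_integral_lp_sum) (auto intro: borel_measurable_M)
    then show "Lp_integral p M (lp_sum p h) < \<infinity>" using c(2) by simp
    fix \<gamma> assume \<gamma>: "\<gamma> \<in> curves M" and fin: "curve_integral \<gamma> (lp_sum p h) < \<infinity>"
    show "\<forall>n. P n \<gamma>"
    proof
      fix n
      have "ennreal (c n) * curve_integral \<gamma> (\<rho> n) = (\<integral>\<^sup>+t. ennreal (c n) * curve_trace \<gamma> (\<rho> n) t \<partial>lebesgue)"
        unfolding curve_integral_trace
        using trace_measurable_borel[OF \<gamma> \<rho>(1)] by (simp add: nn_integral_cmult)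
      also have "\<dots> \<le> curve_integral \<gamma> (lp_sum p h)"
        unfolding curve_integral_trace curve_trace_def
        using lp_sum_ge[OF p_pos, of h n]
        by (intro nn_integral_mono) (auto simp: indicator_def h_def)
      finally have "ennreal (c n) * curve_integral \<gamma> (\<rho> n) < \<infinity>"
        using fin by simp
      then have "curve_integral \<gamma> (\<rho> n) < \<infinity>"
        using c(1)[of n] by (auto simp: ennreal_mult_less_top)
      then show "P n \<gamma>" using \<rho>(3) \<gamma> by blast
    qed
  qed
qed

lemma ae_curve_conj:
  assumes "ae_curve p M P" "ae_curve p M Q"
  shows "ae_curve p M (\<lambda>c. P c \<and> Q c)"
proof -
  have "ae_curve p M (if n = 0 then P else Q)" for n :: nat
    using assms by simp
  then have "ae_curve p M (\<lambda>c. \<forall>n::nat. (if n = 0 then P else Q) c)"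
    by (rule ae_curve_all)
  then show ?thesis
    by (rule ae_curve_mono) (metis zero_neq_one)
qed

lemma ae_curve_always: "(\<And>c. c \<in> curves M \<Longrightarrow> P c) \<Longrightarrow> ae_curve p M P"
  by (rule ae_curveI[of "\<lambda>_. 0"]) (auto simp: Lp_integral_def)

text \<open>The same witness works, since its integral along a subcurve is at most the integral
  along the whole curve.\<close>

lemma ae_curve_subcurves:
  assumes "ae_curve p M P"
  shows "ae_curve p M (\<lambda>c. \<forall>s t. 0 \<le> s \<longrightarrow> s < t \<longrightarrow> t \<le> fst c \<longrightarrow> P (subcurve c s t))"
proof -
  obtain \<rho> where \<rho>: "\<rho> \<in> borel_measurable borel" "Lp_integral p M \<rho> < \<infinity>"
    "\<And>c. c \<in> curves M \<Longrightarrow> curve_integral c \<rho> < \<infinity> \<Longrightarrow> P c"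
    using ae_curveE[OF assms] by metis
  show ?thesis
  proof (rule ae_curveI[OF \<rho>(1,2)], intro allI impI)
    fix c s t assume c: "c \<in> curves M" "curve_integral c \<rho> < \<infinity>" and st: "0 \<le> s" "s < t" "t \<le> fst c"
    have "curve_integral (subcurve c s t) \<rho> = (\<integral>\<^sup>+r. curve_trace c \<rho> r * indicator {s..t} r \<partial>lebesgue)"
      using st by (intro curve_integral_subcurve trace_measurable_borel[OF c(1) \<rho>(1)]) auto
    also have "\<dots> \<le> curve_integral c \<rho>"
      unfolding curve_integral_trace by (intro nn_integral_mono) (auto simp: indicator_def)
    finally show "P (subcurve c s t)"
      using \<rho>(3)[OF subcurve_in_curves[OF c(1) st]] c(2) by simp
  qed
qed

text \<open>A function that is infinite on a Borel null set and 0 elsewhere has L^p integral 0, and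
  a curve along which its integral is finite spends almost no time in that set.\<close>

lemma ae_curve_AE:
  assumes "AE x in M. P x"
  shows "ae_curve p M (\<lambda>c. AE t in lebesgue. t \<in> {0..fst c} \<longrightarrow> P (snd c t))"
proof -
  obtain A where A: "A \<in> null_sets M" "\<And>x. x \<notin> A \<Longrightarrow> P x"
    using assms by (auto elim!: AE_E3)
  obtain B where B: "A \<subseteq> B" "B \<in> sets borel" "B \<in> null_sets M"
    by (rule null_set_borel_cover[OF A(1)])
  define \<rho> :: "'a \<Rightarrow> ennreal" where "\<rho> x = \<infinity> * indicator B x" for x
  have \<rho>: "\<rho> \<in> borel_measurable borel"
    unfolding \<rho>_def[abs_def] using B(2) by measurable
  show ?thesis
  proof (rule ae_curveI[OF \<rho>])
    have "Lp_integral p M \<rho> \<le> Lp_integral p M (\<lambda>_. 0)"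
      using p_pos AE_not_in[OF B(3)] by (intro Lp_integral_mono_AE) (auto simp: \<rho>_def)
    then show "Lp_integral p M \<rho> < \<infinity>" by (simp add: Lp_integral_def)
    fix c assume c: "c \<in> curves M" "curve_integral c \<rho> < \<infinity>"
    have "AE t in lebesgue. curve_trace c \<rho> t \<noteq> \<infinity>"
      using c(2) trace_measurable_borel[OF c(1) \<rho>]
      by (intro nn_integral_PInf_AE) (auto simp: curve_integral_trace)
    then show "AE t in lebesgue. t \<in> {0..fst c} \<longrightarrow> P (snd c t)"
    proof eventually_elim
      case (elim t)
      then have "t \<in> {0..fst c} \<Longrightarrow> snd c t \<notin> B"
        by (auto simp: curve_trace_def \<rho>_def)
      then show ?case using A(2) B(1) by blast
    qed
  qed
qed

text \<open>Along almost every curve \<open>g\<close> agrees with a Borel function at almost every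
  parameter, and completeness of \<open>lebesgue\<close> transfers measurability.\<close>

lemma ae_curve_trace_measurable:
  assumes "g \<in> borel_measurable M"
  shows "ae_curve p M (\<lambda>c. curve_trace c g \<in> borel_measurable lebesgue)"
proof -
  obtain h where h: "h \<in> borel_measurable borel" "AE x in M. g x = h x"
    using borel_majorant[OF assms] by metis
  show ?thesis
  proof (rule ae_curve_mono[OF ae_curve_AE[OF h(2)]])
    fix c assume c: "c \<in> curves M" "AE t in lebesgue. t \<in> {0..fst c} \<longrightarrow> g (snd c t) = h (snd c t)"
    from c(2) have "AE t in lebesgue. curve_trace c h t = curve_trace c g t"
      by eventually_elim (auto simp: curve_trace_def indicator_def)
    then show "curve_trace c g \<in> borel_measurable lebesgue"
      by (rule completion.borel_measurable_cong_AE[OF trace_measurable_borel[OF c(1) h(1)]]) auto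
  qed
qed

lemma ae_curve_integrable:
  assumes "g \<in> borel_measurable M" "Lp_integral p M g < \<infinity>"
  shows "ae_curve p M (\<lambda>c. curve_integral c g < \<infinity>)"
proof -
  obtain h where h: "h \<in> borel_measurable borel" "\<And>x. g x \<le> h x" "AE x in M. g x = h x"
    using borel_majorant[OF assms(1)] by metis
  have "Lp_integral p M h = Lp_integral p M g"
    unfolding Lp_integral_def using h(3) by (intro nn_integral_cong_AE) auto
  show ?thesis
  proof (rule ae_curveI[OF h(1)])
    show "Lp_integral p M h < \<infinity>"
      using \<open>Lp_integral p M h = Lp_integral p M g\<close> assms(2) by simp
    fix c assume "curve_integral c h < \<infinity>"
    moreover have "curve_integral c g \<le> curve_integral c h"
      unfolding curve_integral_def using h(2) by (intro nn_integral_mono) auto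
    ultimately show "curve_integral c g < \<infinity>" by simp
  qed
qed

section \<open>Countable covers from balls of positive finite measure\<close>

text \<open>The centres of disjoint balls inside one ball of finite measure form a countable set: sending
  each point to the centre of its ball gives a measurable map into a discrete space, which has
  countably many atoms.\<close>
lemma countable_separated_bounded:
  fixes S :: "'a set"
  assumes "e > 0" "\<And>x y. x \<in> S \<Longrightarrow> y \<in> S \<Longrightarrow> x \<noteq> y \<Longrightarrow> dist x y \<ge> e" "S \<subseteq> ball a r"
  shows "countable S"
proof (cases "S = {}")
  case False
  then obtain s where "s \<in> S" by blast
  then have "dist a s < r" using assms(3) by auto
  then have "r > 0" using zero_le_dist[of a s] by linarith
  define B where "B = ball a (r + e)"
  define f :: "'a \<Rightarrow> 'a option" where "f x = (if \<exists>s\<in>S. x \<in> ball s (e/2) then Some (SOME s. s \<in> S \<and> x \<in> ball s (e/2)) else None)" for x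
  have uniq: "s = s'" if "s \<in> S" "s' \<in> S" "x \<in> ball s (e/2)" "x \<in> ball s' (e/2)" for s s' x
    using assms(2)[of s s'] that dist_triangle_half_r[of x s e s'] by (auto simp: dist_commute)
  have f_eq: "f x = Some s" if "s \<in> S" "x \<in> ball s (e/2)" for s x
  proof -
    have "(SOME s. s \<in> S \<and> x \<in> ball s (e/2)) = s"
      using that uniq[of _ s x] by (intro some_equality) blast+
    then show ?thesis using that unfolding f_def by auto
  qed
  have f_Some: "s \<in> S \<and> x \<in> ball s (e/2)" if "f x = Some s" for s x
  proof -
    have "\<exists>s. s \<in> S \<and> x \<in> ball s (e/2)" and "s = (SOME s. s \<in> S \<and> x \<in> ball s (e/2))"
      using that unfolding f_def by (auto split: if_splits)
    then show ?thesis using someI_ex[of "\<lambda>s. s \<in> S \<and> x \<in> ball s (e/2)"] by blast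
  qed
  have f_None: "f x = None \<longleftrightarrow> x \<notin> (\<Union>s\<in>S. ball s (e/2))" for x
    unfolding f_def by auto
  \<comment> \<open>All subsets of the target count as measurable. This is harmless because a union
    of balls is open however many balls there are.\<close>
  have "f \<in> borel \<rightarrow>\<^sub>M count_space UNIV"
  proof (rule measurableI)
    fix A :: "'a option set"
    have f_vimage: "f -` A = (\<Union>s\<in>{s\<in>S. Some s \<in> A}. ball s (e/2)) \<union>
        (if None \<in> A then - (\<Union>s\<in>S. ball s (e/2)) else {})"
    proof (rule set_eqI)
      fix x
      show "x \<in> f -` A \<longleftrightarrow> x \<in> (\<Union>s\<in>{s\<in>S. Some s \<in> A}. ball s (e/2)) \<union>
        (if None \<in> A then - (\<Union>s\<in>S. ball s (e/2)) else {})"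
      proof (cases "f x")
        case None
        then show ?thesis using f_None[of x] by auto
      next
        case (Some s)
        then have x: "s \<in> S" "x \<in> ball s (e/2)" using f_Some by blast+
        have "Some s \<in> A" if s': "s' \<in> S" "Some s' \<in> A" "x \<in> ball s' (e/2)" for s'
          using f_eq[OF s'(1,3)] s'(2) Some by simp
        then have "x \<in> (\<Union>s\<in>{s\<in>S. Some s \<in> A}. ball s (e/2)) \<longleftrightarrow> Some s \<in> A"
          using x by blast
        moreover have "x \<notin> (if None \<in> A then - (\<Union>s\<in>S. ball s (e/2)) else {})"
          using x by (cases "None \<in> A") auto
        ultimately show ?thesis using Some by simp
      qed
    qed
    have U: "(\<Union>s\<in>S'. ball s (e/2)) \<in> sets borel" for S'
      by (intro borel_open open_UN) auto
    have "(if None \<in> A then - (\<Union>s\<in>S. ball s (e/2)) else {}) \<in> sets borel"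
      by (cases "None \<in> A") (simp_all only: if_True if_False sets.empty_sets borel_comp[OF U])
    then show "f -` A \<inter> space borel \<in> sets borel"
      unfolding space_borel Int_UNIV_right f_vimage by (rule sets.Un[OF U])
  qed auto
  from borel_measurable_M[OF this]
  have f: "f \<in> density M (indicator B) \<rightarrow>\<^sub>M count_space UNIV"
    by simp
  define D where "D = distr (density M (indicator B)) (count_space UNIV) f"
  have B: "B \<in> sets M" unfolding B_def by (intro sets_borel_M) auto
  have "emeasure M B < \<infinity>"
    using emeasure_ball(2)[of "r + e" a] \<open>r > 0\<close> assms(1) by (simp add: B_def)
  then have "emeasure (density M (indicator B)) UNIV < \<infinity>"
    using B sets.top[of M] by (simp add: emeasure_restricted)
  moreover have "emeasure D (space D) = emeasure (density M (indicator B)) UNIV"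
    unfolding D_def by (subst emeasure_distr[OF f]) simp_all
  ultimately interpret finite_measure D
    by (intro finite_measureI) simp
  have "Some ` S \<subseteq> {x. measure D {x} \<noteq> 0}"
  proof safe
    fix s assume s: "s \<in> S" "measure D {Some s} = 0"
    have "f -` {Some s} = ball s (e/2)"
      using f_eq[OF s(1)] f_Some by blast
    then have "emeasure D {Some s} = emeasure (density M (indicator B)) (ball s (e/2))"
      unfolding D_def using f by (simp add: emeasure_distr)
    also have "\<dots> = emeasure M (ball s (e/2))"
    proof -
      have "ball s (e/2) \<subseteq> B"
      proof
        fix x assume "x \<in> ball s (e/2)"
        moreover have "dist a s < r" using s(1) assms(3) by auto
        ultimately show "x \<in> B"
          using dist_triangle[of a x s] assms(1) by (auto simp: B_def)
      qed
      then show ?thesis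
        using B sets_borel_M[of "ball s (e/2)"] by (simp add: emeasure_restricted Int_absorb1)
    qed
    also have "\<dots> > 0" using emeasure_ball(1)[of "e/2" s] assms(1) by simp
    finally show False using s(2) by (simp add: emeasure_eq_measure)
  qed
  moreover have "countable {x. measure D {x} \<noteq> 0}"
    by (rule countable_support)
  ultimately show ?thesis
    by (intro countable_image_inj_on[of Some S]) (blast intro: countable_subset, simp)
qed simp

text \<open>A maximal separated set, obtained from Zorn's lemma, is a net, since a point far from it
  could be added. Its intersections with the balls around one point are countable by
  \<open>countable_separated_bounded\<close>.\<close>

lemma countable_net:
  assumes "e > 0"
  obtains S :: "'a set" where "countable S" "\<And>x. \<exists>s\<in>S. dist x s < e"
proof -
  define \<S> where "\<S> = {S::'a set. \<forall>x\<in>S. \<forall>y\<in>S. x \<noteq> y \<longrightarrow> dist x y \<ge> e}"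
  have "\<exists>S\<in>\<S>. \<forall>X\<in>\<S>. S \<subseteq> X \<longrightarrow> X = S"
  proof (rule subset_Zorn')
    fix C assume C: "subset.chain \<S> C"
    show "\<Union>C \<in> \<S>"
      unfolding \<S>_def mem_Collect_eq
    proof (intro ballI impI)
      fix x y assume "x \<in> \<Union>C" "y \<in> \<Union>C" and ne: "x \<noteq> y"
      then obtain X Y where XY: "x \<in> X" "X \<in> C" "y \<in> Y" "Y \<in> C" by blast
      then have "X \<subseteq> Y \<or> Y \<subseteq> X" "X \<in> \<S>" "Y \<in> \<S>"
        using C by (auto simp: subset_chain_def)
      then have "\<exists>Z\<in>\<S>. x \<in> Z \<and> y \<in> Z" using XY by blast
      then show "e \<le> dist x y" using ne unfolding \<S>_def by blast
    qed
  qed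
  then obtain S where S: "S \<in> \<S>" and max: "\<And>X. X \<in> \<S> \<Longrightarrow> S \<subseteq> X \<Longrightarrow> X = S"
    by blast
  show ?thesis
  proof
    \<comment> \<open>Here \<open>undefined\<close> is merely some fixed centre of an exhaustion by
      balls.\<close>
    have S_eq: "S = (\<Union>n::nat. S \<inter> ball undefined (real n))"
    proof (intro equalityI subsetI)
      fix x assume "x \<in> S"
      moreover obtain n where "dist undefined x < real n" using reals_Archimedean2 by blast
      ultimately show "x \<in> (\<Union>n::nat. S \<inter> ball undefined (real n))" by auto
    qed auto
    have "countable (S \<inter> ball undefined (real n))" for n
      using S assms by (intro countable_separated_bounded[of e _ undefined "real n"]) (auto simp: \<S>_def)
    then have "countable (\<Union>n::nat. S \<inter> ball undefined (real n))"
      by (intro countable_UN countableI_type)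
    then show "countable S"
      unfolding S_eq[symmetric] .
    show "\<exists>s\<in>S. dist x s < e" for x
    proof (rule ccontr)
      assume *: "\<not> (\<exists>s\<in>S. dist x s < e)"
      then have "insert x S \<in> \<S>"
        using S unfolding \<S>_def by (auto simp: not_less dist_commute)
      then have "x \<in> S" using max by blast
      then show False using * assms by force
    qed
  qed
qed

text \<open>A Lindelof argument: the balls of radius \<open>1 / Suc n\<close> around the points of
  countable nets are countably many, and those with property \<open>Q\<close> already cover the
  space.\<close>

lemma countable_open_cover:
  assumes "\<And>x::'a. \<exists>r>0. Q (ball x r)" "\<And>A B. Q B \<Longrightarrow> A \<subseteq> B \<Longrightarrow> open A \<Longrightarrow> Q A"
  obtains B :: "nat \<Rightarrow> 'a set" where "\<And>n. open (B n)" "\<And>n. Q (B n)" "(\<Union>n. B n) = UNIV"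
proof -
  have "\<exists>S::'a set. countable S \<and> (\<forall>x. \<exists>s\<in>S. dist x s < 1 / Suc n)" for n
  proof -
    have "0 < 1 / real (Suc n)" by simp
    then obtain T :: "'a set" where "countable T" "\<And>x. \<exists>s\<in>T. dist x s < 1 / real (Suc n)"
      using countable_net by metis
    then show ?thesis by (intro exI[of _ T] conjI allI)
  qed
  then obtain S :: "nat \<Rightarrow> 'a set" where S: "\<And>n. countable (S n)" "\<And>n x. \<exists>s\<in>S n. dist x s < 1 / Suc n"
    by metis
  define \<B> where "\<B> = {U \<in> (\<Union>n. (\<lambda>s. ball s (1 / Suc n)) ` S n). Q U}"
  have "countable \<B>"
    unfolding \<B>_def using S(1) by (intro countable_Collect countable_UN countable_image) auto
  have cover: "\<exists>U\<in>\<B>. x \<in> U" for x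
  proof -
    obtain r where r: "r > 0" "Q (ball x r)" using assms(1) by blast
    \<comment> \<open>A net ball of radius below \<open>r / 2\<close> that contains \<open>x\<close>
      stays inside \<open>ball x r\<close>.\<close>
    obtain n where n: "1 / Suc n < r / 2" using r(1) by (metis half_gt_zero nat_approx_posE)
    obtain s where s: "s \<in> S n" "dist x s < 1 / Suc n" using S(2) by blast
    have "ball s (1 / Suc n) \<subseteq> ball x r"
    proof
      fix y assume "y \<in> ball s (1 / Suc n)"
      then show "y \<in> ball x r" using s(2) n dist_triangle[of x y s] by auto
    qed
    then have "Q (ball s (1 / Suc n))" using assms(2) r(2) by auto
    then have "ball s (1 / Suc n) \<in> \<B>" using s(1) by (auto simp: \<B>_def)
    then show ?thesis using s(2) by (intro bexI) (auto simp: dist_commute)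
  qed
  then have "\<B> \<noteq> {}" by blast
  show ?thesis
  proof
    have in_B: "from_nat_into \<B> n \<in> \<B>" for n using \<open>\<B> \<noteq> {}\<close> by (rule from_nat_into)
    show "open (from_nat_into \<B> n)" "Q (from_nat_into \<B> n)" for n
      using in_B[of n] by (auto simp: \<B>_def)
    show "(\<Union>n. from_nat_into \<B> n) = UNIV"
      unfolding range_from_nat_into[OF \<open>\<B> \<noteq> {}\<close> \<open>countable \<B>\<close>] using cover by blast
  qed
qed

end

section \<open>Minimal weak upper gradients\<close>

text \<open>The reciprocal is bounded by 1 and strictly decreasing up to its value 0 at infinity.
  Its weighted integrals therefore stay finite and still detect any decrease of a gradient.\<close>

lemma inverse_one_add_le_iff: "inverse (1 + a) \<le> inverse (1 + b) \<longleftrightarrow> b \<le> (a :: ennreal)"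
proof -
  have *: "1 + ennreal x = ennreal (1 + x)" if "0 \<le> x" for x
    using that by simp
  show ?thesis
    by (cases a; cases b)
      (simp_all add: * inverse_ennreal ennreal_le_iff add_pos_nonneg top_unique del: ennreal_plus)
qed

context newtonian_space
begin

lemma sigma_finite_M: "sigma_finite_measure M"
proof
  have "(\<Union>n::nat. ball undefined (real n)) = (UNIV :: 'a set)"
  proof (intro equalityI subsetI UNIV_I)
    fix x :: 'a
    obtain n where "dist undefined x < real n" using reals_Archimedean2 by blast
    then show "x \<in> (\<Union>n::nat. ball undefined (real n))" by auto
  qed
  moreover have "emeasure M (ball undefined (real n)) < \<infinity>" for n
    using emeasure_ball(2)[of "real n" undefined] by (cases "n = 0") auto
  ultimately show "\<exists>A. countable A \<and> A \<subseteq> sets M \<and> \<Union> A = space M \<and> (\<forall>a\<in>A. emeasure M a \<noteq> \<infinity>)"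
    by (intro exI[of _ "range (\<lambda>n::nat. ball undefined (real n))"])
      (auto intro!: sets_borel_M simp: less_top)
qed

lemma in_Lp_loc_mono:
  assumes "in_Lp_loc p M g" "\<And>x. h x \<le> g x"
  shows "in_Lp_loc p M h"
  unfolding in_Lp_loc_def
proof
  fix x assume "x \<in> space M"
  then obtain r where r: "r > 0" "(\<integral>\<^sup>+y. epow (g y) p * indicator (ball x r) y \<partial>M) < \<infinity>"
    using assms(1) by (auto simp: in_Lp_loc_def)
  have "(\<integral>\<^sup>+y. epow (h y) p * indicator (ball x r) y \<partial>M) \<le> (\<integral>\<^sup>+y. epow (g y) p * indicator (ball x r) y \<partial>M)"
    using assms(2) p_pos by (intro nn_integral_mono mult_right_mono epow_mono) auto
  then show "\<exists>r>0. (\<integral>\<^sup>+y. epow (h y) p * indicator (ball x r) y \<partial>M) < \<infinity>"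
    using r by (intro exI[of _ r]) auto
qed

lemma Lp_imp_Lp_loc:
  assumes "Lp_integral p M g < \<infinity>"
  shows "in_Lp_loc p M g"
  unfolding in_Lp_loc_def
proof
  fix x assume "x \<in> space M"
  have "(\<integral>\<^sup>+y. epow (g y) p * indicator (ball x 1) y \<partial>M) \<le> Lp_integral p M g"
    unfolding Lp_integral_def by (intro nn_integral_mono) (auto simp: indicator_def)
  then show "\<exists>r>0. (\<integral>\<^sup>+y. epow (g y) p * indicator (ball x r) y \<partial>M) < \<infinity>"
    using assms by (intro exI[of _ 1]) auto
qed

text \<open>Cut \<open>g\<close> off to the members of a countable open cover on which it is
  p-integrable. Each cut-off is integrable along almost every curve, and the compact image of a
  curve needs only finitely many members.\<close>

lemma ae_curve_integrable_loc:
  assumes g: "g \<in> borel_measurable M" and loc: "in_Lp_loc p M g"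
  shows "ae_curve p M (\<lambda>c. curve_integral c g < \<infinity>)"
proof -
  define Q where "Q B \<longleftrightarrow> (\<integral>\<^sup>+y. epow (g y) p * indicator B y \<partial>M) < \<infinity>" for B
  have "\<exists>r>0. Q (ball x r)" for x
    using loc by (auto simp: Q_def in_Lp_loc_def)
  moreover have "Q A" if "Q B" "A \<subseteq> B" for A B
  proof -
    have "(\<integral>\<^sup>+y. epow (g y) p * indicator A y \<partial>M) \<le> (\<integral>\<^sup>+y. epow (g y) p * indicator B y \<partial>M)"
      using that(2) by (intro nn_integral_mono) (auto simp: indicator_def)
    then show ?thesis using that(1) by (simp add: Q_def)
  qed
  ultimately obtain B :: "nat \<Rightarrow> 'a set" where B: "\<And>n. open (B n)" "\<And>n. Q (B n)" "(\<Union>n. B n) = UNIV"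
    using countable_open_cover[of Q] by metis
  define h where "h n x = g x * indicator (B n) x" for n x
  have h: "h n \<in> borel_measurable M" for n
    unfolding h_def[abs_def] using g B(1)[of n]
    by (intro borel_measurable_times_ennreal borel_measurable_indicator sets_borel_M) auto
  have "Lp_integral p M (h n) = (\<integral>\<^sup>+y. epow (g y) p * indicator (B n) y \<partial>M)" for n
    unfolding Lp_integral_def h_def epow_mult
    by (intro nn_integral_cong) (auto simp: indicator_def)
  then have fin: "Lp_integral p M (h n) < \<infinity>" for n
    using B(2)[of n] by (simp add: Q_def)
  have "ae_curve p M (\<lambda>c. \<forall>n. curve_integral c (h n) < \<infinity> \<and> curve_trace c (h n) \<in> borel_measurable lebesgue)"
    using h fin by (intro ae_curve_all ae_curve_conj ae_curve_integrable ae_curve_trace_measurable)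
  then show ?thesis
  proof (rule ae_curve_mono)
    fix c assume c: "c \<in> curves M" and
      *: "\<forall>n. curve_integral c (h n) < \<infinity> \<and> curve_trace c (h n) \<in> borel_measurable lebesgue"
    have "compact (snd c ` {0..fst c})"
      by (intro compact_continuous_image curve_continuous_on[OF c] compact_Icc)
    moreover have "snd c ` {0..fst c} \<subseteq> (\<Union>n\<in>UNIV. B n)" using B(3) by simp
    ultimately obtain K where K: "finite K" "snd c ` {0..fst c} \<subseteq> (\<Union>n\<in>K. B n)"
      using compactE_image[of "snd c ` {0..fst c}" UNIV B] B(1) by metis
    have "curve_integral c g \<le> (\<integral>\<^sup>+t. (\<Sum>n\<in>K. curve_trace c (h n) t) \<partial>lebesgue)"
      unfolding curve_integral_trace
    proof (rule nn_integral_mono)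
      fix t
      show "curve_trace c g t \<le> (\<Sum>n\<in>K. curve_trace c (h n) t)"
      proof (cases "t \<in> {0..fst c}")
        case True
        then have "snd c t \<in> (\<Union>n\<in>K. B n)" using K(2) by blast
        then obtain n where n: "n \<in> K" "snd c t \<in> B n" by blast
        then have "curve_trace c g t = curve_trace c (h n) t"
          by (simp add: curve_trace_def h_def)
        also have "\<dots> \<le> (\<Sum>n\<in>K. curve_trace c (h n) t)"
          using K(1) n(1) by (intro member_le_sum) auto
        finally show ?thesis .
      qed (simp add: curve_trace_def)
    qed
    also have "\<dots> = (\<Sum>n\<in>K. curve_integral c (h n))"
      unfolding curve_integral_trace using * by (intro nn_integral_sum) auto
    also have "\<dots> < \<infinity>"
      using * K(1) by simp
    finally show "curve_integral c g < \<infinity>" .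
  qed
qed

section \<open>Weak upper gradients as control along almost every curve\<close>

lemma weak_upper_gradient_iff:
  "weak_upper_gradient p M u g \<longleftrightarrow> g \<in> borel_measurable M \<and>
     ae_curve p M (\<lambda>c. curve_trace c g \<in> borel_measurable lebesgue \<and> endpoint_gap u c \<le> curve_integral c g)"
  unfolding weak_upper_gradient_def ae_curve_def trace_measurable_iff by simp

lemma upper_gradient_imp_weak:
  assumes "upper_gradient M u g"
  shows "weak_upper_gradient p M u g" "g \<in> borel_measurable borel"
proof -
  show g: "g \<in> borel_measurable borel"
    using assms unfolding upper_gradient_def restrict_borel_UNIV by simp
  show "weak_upper_gradient p M u g"
    unfolding weak_upper_gradient_iff using assms g trace_measurable_borel[OF _ g]
    by (auto intro!: ae_curve_always borel_measurable_M simp: upper_gradient_def)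
qed

text \<open>The exceptional family is enlarged by all curves with an exceptional subcurve, which
  keeps it null by \<open>ae_curve_subcurves\<close>. On the other curves the endpoint inequality
  holds for every subinterval.\<close>

lemma weak_upper_gradient_regular:
  assumes "weak_upper_gradient p M u g" "ae_curve p M (\<lambda>c. curve_integral c g < \<infinity>)"
  shows "ae_curve p M (regular_along u g)"
proof -
  have g: "ae_curve p M (\<lambda>c. curve_trace c g \<in> borel_measurable lebesgue \<and> endpoint_gap u c \<le> curve_integral c g)"
    using assms(1) by (simp add: weak_upper_gradient_iff)
  show ?thesis
  proof (rule ae_curve_mono[OF ae_curve_conj[OF ae_curve_conj[OF g assms(2)] ae_curve_subcurves[OF g]]])
    fix c assume "c \<in> curves M" "((curve_trace c g \<in> borel_measurable lebesgue \<and> endpoint_gap u c \<le> curve_integral c g) \<and>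
        curve_integral c g < \<infinity>) \<and> (\<forall>s t. 0 \<le> s \<longrightarrow> s < t \<longrightarrow> t \<le> fst c \<longrightarrow>
          curve_trace (subcurve c s t) g \<in> borel_measurable lebesgue \<and>
          endpoint_gap u (subcurve c s t) \<le> curve_integral (subcurve c s t) g)"
    then show "regular_along u g c"
      by (intro regular_alongI) (auto simp: curves_def)
  qed
qed

lemma weak_upper_gradient_regular_loc:
  assumes "weak_upper_gradient p M u g" "in_Lp_loc p M g"
  shows "ae_curve p M (regular_along u g)"
  using assms by (intro weak_upper_gradient_regular ae_curve_integrable_loc)
    (auto simp: weak_upper_gradient_def)

lemma weak_upper_gradientI:
  assumes "g \<in> borel_measurable M" "ae_curve p M (regular_along u g)"
  shows "weak_upper_gradient p M u g"
  unfolding weak_upper_gradient_iff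
proof (intro conjI assms(1) ae_curve_mono[OF assms(2)])
  fix c assume "c \<in> curves M" "regular_along u g c"
  moreover from this have "0 \<le> fst c" by (auto simp: curves_def)
  ultimately show "curve_trace c g \<in> borel_measurable lebesgue" "endpoint_gap u c \<le> curve_integral c g"
    using regular_alongD by blast+
qed

lemma curve_trace_min: "curve_trace c (\<lambda>x. min (g x) (h x)) = (\<lambda>t. min (curve_trace c g t) (curve_trace c h t))"
  by (auto simp: curve_trace_def indicator_def fun_eq_iff)

lemma curve_trace_INF:
  "curve_trace c (\<lambda>x. INF n::nat. g n x) = (\<lambda>t. INF n. curve_trace c (g n) t)"
proof
  fix t show "curve_trace c (\<lambda>x. INF n. g n x) t = (INF n. curve_trace c (g n) t)"
    by (cases "t \<in> {0..fst c}") (simp_all add: curve_trace_def)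
qed

lemma regular_along_min:
  "regular_along u g c \<Longrightarrow> regular_along u h c \<Longrightarrow> regular_along u (\<lambda>x. min (g x) (h x)) c"
  unfolding regular_along_def curve_trace_min by (auto intro: controlled_min)

text \<open>Monotone convergence for decreasing integrands, legitimate because the first integral is
  finite.\<close>

lemma regular_along_INF:
  assumes reg: "\<And>n::nat. regular_along u (g n) c" and dec: "\<And>n x. g (Suc n) x \<le> g n x"
  shows "regular_along u (\<lambda>x. INF n. g n x) c"
proof -
  let ?G = "\<lambda>n. curve_trace c (g n)"
  have ctrl: "controlled (\<lambda>t. real_of_ereal (u (snd c t))) (?G n) (fst c)" for n
    using reg by (simp add: regular_along_def)
  have m: "?G n \<in> borel_measurable lebesgue" for n
    using ctrl by (simp add: controlled_def)
  have fin: "(\<integral>\<^sup>+r. ?G n r \<partial>lebesgue) < \<infinity>" for n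
    using ctrl[of n] by (simp add: controlled_def)
  have decG: "?G (Suc n) r \<le> ?G n r" for n r
    unfolding curve_trace_def using dec by (intro mult_right_mono) auto
  have "controlled (\<lambda>t. real_of_ereal (u (snd c t))) (\<lambda>t. INF n. ?G n t) (fst c)"
    unfolding controlled_def
  proof (intro conjI allI impI)
    show "(\<lambda>t. INF n. ?G n t) \<in> borel_measurable lebesgue"
      using m by (intro borel_measurable_INF) auto
    have "(\<integral>\<^sup>+r. (INF n. ?G n r) \<partial>lebesgue) \<le> (\<integral>\<^sup>+r. ?G 0 r \<partial>lebesgue)"
      by (intro nn_integral_mono INF_lower) simp
    then show "(\<integral>\<^sup>+r. (INF n. ?G n r) \<partial>lebesgue) < \<infinity>" using fin[of 0] by simp
    fix s t assume st: "0 \<le> s \<and> s \<le> t \<and> t \<le> fst c"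
    have "(\<integral>\<^sup>+r. (INF n. ?G n r) * indicator {s..t} r \<partial>lebesgue) =
        (\<integral>\<^sup>+r. (INF n. ?G n r * indicator {s..t} r) \<partial>lebesgue)"
      by (intro nn_integral_cong) (auto simp: indicator_def)
    also have "\<dots> = (INF n. \<integral>\<^sup>+r. ?G n r * indicator {s..t} r \<partial>lebesgue)"
    proof (rule nn_integral_monotone_convergence_INF_AE')
      show "AE r in lebesgue. ?G (Suc n) r * indicator {s..t} r \<le> ?G n r * indicator {s..t} r" for n
        using decG by (intro AE_I2 mult_right_mono) auto
      show "(\<lambda>r. ?G n r * indicator {s..t} r) \<in> borel_measurable lebesgue" for n
        by (intro borel_measurable_lebesgue_times_indicator m) simp
      have "(\<integral>\<^sup>+r. ?G 0 r * indicator {s..t} r \<partial>lebesgue) \<le> (\<integral>\<^sup>+r. ?G 0 r \<partial>lebesgue)"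
        by (intro nn_integral_mono) (auto simp: indicator_def)
      then show "(\<integral>\<^sup>+r. ?G 0 r * indicator {s..t} r \<partial>lebesgue) < \<infinity>" using fin[of 0] by simp
    qed
    also have "ennreal \<bar>real_of_ereal (u (snd c s)) - real_of_ereal (u (snd c t))\<bar> \<le> \<dots>"
      using ctrl st by (intro INF_greatest) (simp add: controlled_def)
    finally show "ennreal \<bar>real_of_ereal (u (snd c s)) - real_of_ereal (u (snd c t))\<bar> \<le>
        (\<integral>\<^sup>+r. (INF n. ?G n r) * indicator {s..t} r \<partial>lebesgue)" .
  qed
  then show ?thesis
    using reg unfolding regular_along_def curve_trace_INF by auto
qed

text \<open>Maximizing the integral of \<open>inverse (1 + g)\<close> against a positive weight of finite total mass
  requires no integrability of the weak upper gradients \<open>g\<close> themselves.\<close>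
lemma minimal_weak_upper_gradient_exists:
  assumes g0: "weak_upper_gradient p M u g0" "in_Lp_loc p M g0"
  shows "\<exists>g. minimal_weak_upper_gradient p M u g"
proof -
  define \<G> where "\<G> = {g. weak_upper_gradient p M u g \<and> in_Lp_loc p M g}"
  have meas: "g \<in> borel_measurable M" and reg: "ae_curve p M (regular_along u g)" if "g \<in> \<G>" for g
    using that weak_upper_gradient_regular_loc by (auto simp: \<G>_def weak_upper_gradient_def)
  have min_in: "(\<lambda>x. min (g x) (h x)) \<in> \<G>" if "g \<in> \<G>" "h \<in> \<G>" for g h
  proof -
    have "ae_curve p M (regular_along u (\<lambda>x. min (g x) (h x)))"
      by (rule ae_curve_mono[OF ae_curve_conj[OF reg[OF that(1)] reg[OF that(2)]]])
        (auto intro: regular_along_min)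
    moreover have "(\<lambda>x. min (g x) (h x)) \<in> borel_measurable M"
      using meas that by (intro borel_measurable_min) auto
    moreover have "in_Lp_loc p M (\<lambda>x. min (g x) (h x))"
      by (rule in_Lp_loc_mono[of g]) (use that in \<open>auto simp: \<G>_def\<close>)
    ultimately show ?thesis unfolding \<G>_def by (auto intro: weak_upper_gradientI)
  qed
  obtain h where h: "h \<in> borel_measurable M" "integral\<^sup>N M h \<noteq> \<infinity>" "\<And>x. 0 < h x \<and> h x < \<infinity>"
    using sigma_finite_measure.Ex_finite_integrable_function[OF sigma_finite_M] by auto
  define J where "J g = (\<integral>\<^sup>+x. inverse (1 + g x) * h x \<partial>M)" for g
  have J_mono: "J g \<le> J g'" if "\<And>x. g' x \<le> g x" for g g'
    unfolding J_def using that by (intro nn_integral_mono mult_right_mono) (auto simp: inverse_one_add_le_iff)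
  have J_fin: "J g < \<infinity>" for g
  proof -
    have "inverse (1 + g x) * h x \<le> 1 * h x" for x
      using inverse_one_add_le_iff[of "g x" 0] by (intro mult_right_mono) auto
    then have "J g \<le> integral\<^sup>N M h"
      unfolding J_def by (intro nn_integral_mono) auto
    then show ?thesis using h(2) by (simp add: less_top order_le_less_trans)
  qed
  have "\<G> \<noteq> {}" using g0 by (auto simp: \<G>_def)
  then obtain f :: "nat \<Rightarrow> ennreal" where f: "range f \<subseteq> J ` \<G>" "(SUP g\<in>\<G>. J g) = (SUP n. f n)"
    using ennreal_SUP_countable_SUP by metis
  then have "\<forall>n. \<exists>g\<in>\<G>. f n = J g" by blast
  then obtain g where g: "\<And>n. g n \<in> \<G>" "\<And>n. f n = J (g n)" by metis
  \<comment> \<open>Running minima turn a maximizing sequence into a decreasing one without lowering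
    \<open>J\<close>.\<close>
  define G where "G = rec_nat (g 0) (\<lambda>n G' x. min (G' x) (g (Suc n) x))"
  have G_Suc: "G (Suc n) = (\<lambda>x. min (G n x) (g (Suc n) x))" and G_0: "G 0 = g 0" for n
    by (simp_all add: G_def)
  have G_in: "G n \<in> \<G>" for n
    by (induction n) (auto simp: G_0 G_Suc intro: g(1) min_in)
  have G_le: "G n x \<le> g n x" for n x
    by (cases n) (auto simp: G_0 G_Suc)
  define g\<^sub>m where "g\<^sub>m x = (INF n. G n x)" for x
  have gm_le: "g\<^sub>m x \<le> G n x" for n x
    unfolding g\<^sub>m_def by (rule INF_lower) simp
  have gm_in: "g\<^sub>m \<in> \<G>"
  proof -
    have "ae_curve p M (\<lambda>c. \<forall>n. regular_along u (G n) c)"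
      using G_in reg by (intro ae_curve_all) auto
    then have "ae_curve p M (regular_along u g\<^sub>m)"
      by (rule ae_curve_mono) (auto simp: g\<^sub>m_def[abs_def] G_Suc intro: regular_along_INF)
    moreover have "g\<^sub>m \<in> borel_measurable M"
      unfolding g\<^sub>m_def[abs_def] using G_in meas by (intro borel_measurable_INF) auto
    moreover have "in_Lp_loc p M g\<^sub>m"
      by (rule in_Lp_loc_mono[of "G 0"]) (use G_in gm_le in \<open>auto simp: \<G>_def\<close>)
    ultimately show ?thesis unfolding \<G>_def by (auto intro: weak_upper_gradientI)
  qed
  have J_max: "J g' \<le> J g\<^sub>m" if "g' \<in> \<G>" for g'
  proof -
    have "J g' \<le> (SUP n. f n)"
      unfolding f(2)[symmetric] using that by (rule SUP_upper)
    also have "\<dots> \<le> J g\<^sub>m"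
      unfolding g(2) using gm_le G_le by (intro SUP_least J_mono) (meson order_trans)
    finally show ?thesis .
  qed
  have "AE x in M. g\<^sub>m x \<le> g' x" if g': "g' \<in> \<G>" for g'
  proof -
    \<comment> \<open>The competitor \<open>m\<close> lies below \<open>g\<^sub>m\<close>, so its
      integrand is nowhere smaller, while maximality bounds its integral by
      \<open>J g\<^sub>m\<close>. Both integrals are finite, so the integrands agree almost
      everywhere and the positive finite weight cancels.\<close>
    define m where "m x = min (g\<^sub>m x) (g' x)" for x
    have m_in: "m \<in> \<G>" unfolding m_def[abs_def] by (rule min_in[OF gm_in g'])
    have le: "inverse (1 + g\<^sub>m x) * h x \<le> inverse (1 + m x) * h x" for x
      by (intro mult_right_mono) (auto simp: inverse_one_add_le_iff m_def)
    have mm: "(\<lambda>x. inverse (1 + m x) * h x) \<in> borel_measurable M" "(\<lambda>x. inverse (1 + g\<^sub>m x) * h x) \<in> borel_measurable M"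
      using meas[OF m_in] meas[OF gm_in] h(1) by measurable
    have "(\<integral>\<^sup>+x. inverse (1 + m x) * h x - inverse (1 + g\<^sub>m x) * h x \<partial>M) = J m - J g\<^sub>m"
      unfolding J_def using J_fin[of g\<^sub>m] le mm by (intro nn_integral_diff) (auto simp: J_def)
    also have "\<dots> = 0"
      using J_max[OF m_in] J_fin[of m] by (intro diff_eq_0_ennreal) auto
    finally have "AE x in M. inverse (1 + m x) * h x - inverse (1 + g\<^sub>m x) * h x = 0"
      using mm by (subst (asm) nn_integral_0_iff_AE) auto
    then show ?thesis
    proof eventually_elim
      case (elim x)
      have "inverse (1 + m x) * h x \<le> inverse (1 + g\<^sub>m x) * h x"
        using elim by (metis diff_gt_0_iff_gt_ennreal not_le less_irrefl)
      then have "h x * inverse (1 + m x) \<le> h x * inverse (1 + g\<^sub>m x)"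
        by (simp add: mult.commute)
      then have "g\<^sub>m x \<le> m x"
        using h(3)[of x] by (subst (asm) ennreal_mult_le_mult_iff) (auto simp: inverse_one_add_le_iff)
      then show ?case by (simp add: m_def)
    qed
  qed
  then show ?thesis
    using gm_in unfolding minimal_weak_upper_gradient_def \<G>_def by blast
qed

end

section \<open>Newtonian functions and capacity zero\<close>

text \<open>The additive form with extended values can be multiplied by constants and passed to
  suprema over sequences.\<close>

lemma regular_along_osc:
  assumes "regular_along u g c" "s \<in> {0..fst c}" "t \<in> {0..fst c}"
  shows "e2ennreal \<bar>u (snd c t)\<bar> \<le> e2ennreal \<bar>u (snd c s)\<bar> + curve_integral c g"
proof -
  have fin: "\<bar>u (snd c t)\<bar> \<noteq> \<infinity>" "\<bar>u (snd c s)\<bar> \<noteq> \<infinity>"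
    using assms by (auto simp: regular_along_def)
  obtain x y where xy: "u (snd c t) = ereal x" "u (snd c s) = ereal y"
    using fin by (cases "u (snd c t)"; cases "u (snd c s)") auto
  have le: "ennreal \<bar>real_of_ereal (u (snd c a)) - real_of_ereal (u (snd c b))\<bar> \<le> curve_integral c g"
    if "0 \<le> a" "a \<le> b" "b \<le> fst c" for a b
  proof -
    have "ennreal \<bar>real_of_ereal (u (snd c a)) - real_of_ereal (u (snd c b))\<bar> \<le>
        (\<integral>\<^sup>+r. curve_trace c g r * indicator {a..b} r \<partial>lebesgue)"
      using assms(1) that by (auto simp: regular_along_def controlled_def)
    also have "\<dots> \<le> curve_integral c g"
      unfolding curve_integral_trace by (intro nn_integral_mono) (auto simp: indicator_def)
    finally show ?thesis .
  qed
  have "ennreal \<bar>x - y\<bar> \<le> curve_integral c g"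
    using le[of s t] le[of t s] assms(2,3) xy by (cases "s \<le> t") (auto simp: abs_minus_commute)
  moreover have "ennreal \<bar>x\<bar> \<le> ennreal (\<bar>y\<bar> + \<bar>x - y\<bar>)"
    by (intro ennreal_leI) auto
  ultimately show ?thesis
    by (simp add: xy e2ennreal_ereal) (metis add_left_mono order_trans)
qed

lemma e2ennreal_1 [simp]: "e2ennreal 1 = 1"
  using e2ennreal_ereal[of 1] by (simp flip: one_ereal_def)

lemma ennreal_unbounded:
  assumes "\<And>n::nat. ennreal (2^n) \<le> x"
  shows "x = \<infinity>"
proof (rule ccontr)
  assume "x \<noteq> \<infinity>"
  then obtain r where r: "x = ennreal r" "0 \<le> r" by (cases x) auto
  obtain n where "r < 2^n" using real_arch_pow[of 2 r] by auto
  then show False using assms[of n] r by simp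
qed

text \<open>Otherwise the integral is infinite, because a curve has positive length. The point found
  is the start from which \<open>regular_along_osc\<close> bounds functions along the whole
  curve.\<close>

lemma curve_integral_finite_point:
  assumes "c \<in> curves M" "curve_integral c W < \<infinity>"
  shows "\<exists>s\<in>{0..fst c}. W (snd c s) < \<infinity>"
proof (rule ccontr)
  assume "\<not> (\<exists>s\<in>{0..fst c}. W (snd c s) < \<infinity>)"
  then have "curve_integral c W = (\<integral>\<^sup>+t. \<infinity> * indicator {0..fst c} t \<partial>lebesgue)"
    unfolding curve_integral_trace curve_trace_def
    by (intro nn_integral_cong) (auto simp: indicator_def less_top[symmetric])
  also have "\<dots> = \<infinity> * emeasure lebesgue {0..fst c}"
    by (intro nn_integral_cmult_indicator) simp
  also have "\<dots> = \<infinity>"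
    using assms(1) by (auto simp: curves_def ennreal_top_mult)
  finally show False using assms(2) by simp
qed

context newtonian_space
begin

section \<open>Energy estimates and membership in the Newtonian space\<close>

lemma min_grad_minimal:
  assumes "weak_upper_gradient p M u g" "in_Lp_loc p M g"
  shows "minimal_weak_upper_gradient p M u (min_grad p M u)"
  unfolding min_grad_def using minimal_weak_upper_gradient_exists[OF assms] by (rule someI_ex)

lemma grad_energy_le:
  assumes "weak_upper_gradient p M u g" "in_Lp_loc p M g"
  shows "grad_energy p M u \<le> Lp_integral p M g"
  unfolding grad_energy_def using min_grad_minimal[OF assms] assms p_pos
  by (intro Lp_integral_mono_AE) (auto simp: minimal_weak_upper_gradient_def)

text \<open>Add the modulus witness to a Borel majorant: along exceptional curves the witness has
  infinite integral, so the inequality holds for every curve. Membership in \<open>newtonian\<close>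
  and \<open>dirichlet\<close> asks for upper gradients in this strict sense.\<close>

lemma upper_gradient_from_weak:
  assumes "weak_upper_gradient p M u g" "Lp_integral p M g < \<infinity>"
  obtains g' where "upper_gradient M u g'" "Lp_integral p M g' < \<infinity>" "\<And>x. g x \<le> g' x"
proof -
  have g: "g \<in> borel_measurable M" "ae_curve p M (\<lambda>c. endpoint_gap u c \<le> curve_integral c g)"
    using assms(1) unfolding weak_upper_gradient_iff by (auto elim: ae_curve_mono)
  obtain h where h: "h \<in> borel_measurable borel" "\<And>x. g x \<le> h x" "AE x in M. g x = h x"
    using borel_majorant[OF g(1)] by metis
  obtain \<rho> where \<rho>: "\<rho> \<in> borel_measurable borel" "Lp_integral p M \<rho> < \<infinity>"
    "\<And>c. c \<in> curves M \<Longrightarrow> curve_integral c \<rho> < \<infinity> \<Longrightarrow> endpoint_gap u c \<le> curve_integral c g"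
    using ae_curveE[OF g(2)] by metis
  show ?thesis
  proof
    have "Lp_integral p M h = Lp_integral p M g"
      unfolding Lp_integral_def using h(3) by (intro nn_integral_cong_AE) auto
    then show "Lp_integral p M (\<lambda>x. h x + \<rho> x) < \<infinity>"
      using p_pos h(1) \<rho>(1,2) assms(2) by (intro Lp_integral_add_finite borel_measurable_M) auto
    show "g x \<le> h x + \<rho> x" for x
      using h(2)[of x] by (simp add: add_increasing2)
    show "upper_gradient M u (\<lambda>x. h x + \<rho> x)"
      unfolding upper_gradient_def restrict_borel_UNIV
    proof (intro conjI ballI)
      show "(\<lambda>x. h x + \<rho> x) \<in> borel_measurable borel"
        using h(1) \<rho>(1) by measurable
      fix c assume c: "c \<in> curves M"
      have le: "curve_integral c \<rho> \<le> curve_integral c (\<lambda>x. h x + \<rho> x)"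
        "curve_integral c g \<le> curve_integral c (\<lambda>x. h x + \<rho> x)"
        unfolding curve_integral_def using h(2)
        by (auto intro!: nn_integral_mono simp: add_increasing add_increasing2)
      show "endpoint_gap u c \<le> curve_integral c (\<lambda>x. h x + \<rho> x)"
      proof (cases "curve_integral c \<rho> < \<infinity>")
        case True
        then show ?thesis using \<rho>(3)[OF c] le(2) by (meson order_trans)
      next
        case False
        then show ?thesis using le(1) by (simp add: less_top[symmetric] top_unique)
      qed
    qed
  qed
qed

lemma newtonian_norm_powr:
  "epow (newtonian_norm p M u) p = Lp_integral p M (\<lambda>x. e2ennreal \<bar>u x\<bar>) + grad_energy p M u"
  unfolding newtonian_norm_def using p_pos by (simp add: epow_epow)

lemma newtonianI:
  assumes "u \<in> borel_measurable M" "weak_upper_gradient p M u g" "Lp_integral p M g < \<infinity>"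
    "Lp_integral p M (\<lambda>x. e2ennreal \<bar>u x\<bar>) < \<infinity>"
  shows "u \<in> newtonian p M"
proof -
  obtain g' where "upper_gradient M u g'" "Lp_integral p M g' < \<infinity>"
    using upper_gradient_from_weak[OF assms(2,3)] by metis
  moreover have "grad_energy p M u < \<infinity>"
    using grad_energy_le[OF assms(2) Lp_imp_Lp_loc[OF assms(3)]] assms(3) by simp
  ultimately show ?thesis
    using assms(1,4) Lp_imp_Lp_loc[of g'] unfolding newtonian_def newtonian_norm_def epow_less_top_iff
    by auto
qed

lemma newtonianD:
  assumes "u \<in> newtonian p M"
  shows "u \<in> borel_measurable M" "weak_upper_gradient p M u (min_grad p M u)"
    "min_grad p M u \<in> borel_measurable M"
    "Lp_integral p M (min_grad p M u) < \<infinity>" "Lp_integral p M (\<lambda>x. e2ennreal \<bar>u x\<bar>) < \<infinity>"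
    "ae_curve p M (regular_along u (min_grad p M u))"
proof -
  obtain g where g: "upper_gradient M u g" "in_Lp_loc p M g"
    using assms by (auto simp: newtonian_def)
  have m: "minimal_weak_upper_gradient p M u (min_grad p M u)"
    using min_grad_minimal[OF upper_gradient_imp_weak(1)[OF g(1)] g(2)] .
  then show w: "weak_upper_gradient p M u (min_grad p M u)"
    by (simp add: minimal_weak_upper_gradient_def)
  then show "min_grad p M u \<in> borel_measurable M"
    by (simp add: weak_upper_gradient_def)
  show "u \<in> borel_measurable M" using assms by (simp add: newtonian_def)
  have "newtonian_norm p M u < \<infinity>" using assms by (simp add: newtonian_def)
  then show "Lp_integral p M (min_grad p M u) < \<infinity>" "Lp_integral p M (\<lambda>x. e2ennreal \<bar>u x\<bar>) < \<infinity>"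
    unfolding newtonian_norm_def epow_less_top_iff grad_energy_def by auto
  show "ae_curve p M (regular_along u (min_grad p M u))"
    using m w by (intro weak_upper_gradient_regular_loc) (auto simp: minimal_weak_upper_gradient_def)
qed

lemma abs_measurable:
  assumes "u \<in> borel_measurable M"
  shows "(\<lambda>x. e2ennreal \<bar>u x\<bar>) \<in> borel_measurable M"
  using assms by measurable

text \<open>Functions equal to 1 on the set but with norms decaying fast enough cannot be almost 0 at
  one point of a curve that meets the set.\<close>
lemma sobolev_capacity_zero:
  assumes "sobolev_capacity p M Z = 0"
  shows "Z \<in> null_sets M" "ae_curve p M (\<lambda>c. \<forall>t\<in>{0..fst c}. snd c t \<notin> Z)"
proof -
  \<comment> \<open>Chosen so that multiplication by the p-th power of the weight \<open>2^n\<close>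
    below leaves the summable \<open>(1/2)^n\<close>.\<close>
  define \<delta> where "\<delta> n = (1/2)^n / (2^n) powr p" for n :: nat
  have "\<exists>u\<in>newtonian p M. (\<forall>x\<in>Z. u x = 1) \<and> epow (newtonian_norm p M u) p < ennreal (\<delta> n)" for n
  proof -
    have "(INF u \<in> {u \<in> newtonian p M. \<forall>x\<in>Z. u x = 1}. epow (newtonian_norm p M u) p) < ennreal (\<delta> n)"
      using assms unfolding sobolev_capacity_def by (simp add: \<delta>_def)
    then show ?thesis unfolding INF_less_iff by auto
  qed
  then obtain u where u: "\<And>n. u n \<in> newtonian p M" "\<And>n x. x \<in> Z \<Longrightarrow> u n x = 1"
    "\<And>n. epow (newtonian_norm p M (u n)) p < ennreal (\<delta> n)"
    by metis
  define a where "a n x = ennreal (2^n) * e2ennreal \<bar>u n x\<bar>" for n x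
  define g where "g n x = ennreal (2^n) * min_grad p M (u n) x" for n x
  have meas: "a n \<in> borel_measurable M" "g n \<in> borel_measurable M" for n
    unfolding a_def[abs_def] g_def[abs_def]
    using newtonianD(1,3)[OF u(1)] by (auto intro!: borel_measurable_times_ennreal abs_measurable)
  have le: "Lp_integral p M (a n) \<le> ennreal ((1/2)^n)" "Lp_integral p M (g n) \<le> ennreal ((1/2)^n)" for n
  proof -
    have *: "epow (ennreal (2^n)) p * ennreal (\<delta> n) = ennreal ((1/2)^n)"
      by (simp add: epow_ennreal \<delta>_def flip: ennreal_mult)
    have "Lp_integral p M (\<lambda>x. e2ennreal \<bar>u n x\<bar>) \<le> ennreal (\<delta> n)"
      "Lp_integral p M (min_grad p M (u n)) \<le> ennreal (\<delta> n)"
      using u(3)[of n] unfolding newtonian_norm_powr grad_energy_def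
      by (auto dest!: less_imp_le elim: order_trans[rotated] simp: add_increasing add_increasing2)
    then show "Lp_integral p M (a n) \<le> ennreal ((1/2)^n)" "Lp_integral p M (g n) \<le> ennreal ((1/2)^n)"
      unfolding a_def[abs_def] g_def[abs_def] *[symmetric]
      using newtonianD(1,3)[OF u(1)]
      by (auto simp: Lp_integral_cmult abs_measurable intro!: mult_left_mono)
  qed
  have geo: "(\<Sum>n. ennreal ((1/2)^n)) < \<infinity>"
    by (subst suminf_ennreal2) (auto intro: summable_geometric)
  have fin: "Lp_integral p M (lp_sum p a) < \<infinity>" "Lp_integral p M (lp_sum p g) < \<infinity>"
  proof -
    have "Lp_integral p M (lp_sum p a) \<le> (\<Sum>n. ennreal ((1/2)^n))"
      "Lp_integral p M (lp_sum p g) \<le> (\<Sum>n. ennreal ((1/2)^n))"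
      using meas p_pos le by (auto simp: Lp_integral_lp_sum intro!: suminf_le)
    then show "Lp_integral p M (lp_sum p a) < \<infinity>" "Lp_integral p M (lp_sum p g) < \<infinity>"
      using geo by (blast intro: le_less_trans)+
  qed
  show "Z \<in> null_sets M"
  proof (rule complete_measure.complete2[OF complete_M])
    \<comment> \<open>On \<open>Z\<close> every \<open>a n\<close> equals \<open>2^n\<close>, so the
      pointwise l^p norm is infinite there.\<close>
    define W where "W = {x. lp_sum p a x = \<infinity>}"
    have "W = {x\<in>space M. lp_sum p a x = \<infinity>}" by (simp add: W_def)
    also have "\<dots> \<in> sets M" using borel_measurable_lp_sum[of a M p, OF meas(1)] by measurable
    finally have W: "W \<in> sets M" .
    have "(\<lambda>x. epow (lp_sum p a x) p) \<in> borel_measurable M"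
      using borel_measurable_lp_sum[of a M p, OF meas(1)] by measurable
    then have "AE x in M. epow (lp_sum p a x) p \<noteq> \<infinity>"
      using fin(1) unfolding Lp_integral_def by (intro nn_integral_PInf_AE) auto
    then have "AE x in M. x \<notin> W"
      by eventually_elim (auto simp: W_def)
    then show "W \<in> null_sets M" using W by (simp add: AE_iff_null_sets)
    show "Z \<subseteq> W"
    proof
      fix x assume x: "x \<in> Z"
      have "ennreal (2^n) \<le> lp_sum p a x" for n
        using lp_sum_ge[OF p_pos, of a n x] u(2)[OF x, of n] by (simp add: a_def)
      then have "lp_sum p a x = \<infinity>"
        by (rule ennreal_unbounded)
      then show "x \<in> W" by (simp add: W_def)
    qed
  qed
  have "ae_curve p M (\<lambda>c. (\<forall>n. regular_along (u n) (min_grad p M (u n)) c) \<and>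
      curve_integral c (lp_sum p a) < \<infinity> \<and> curve_integral c (lp_sum p g) < \<infinity>)"
    using newtonianD(6)[OF u(1)] fin meas
    by (intro ae_curve_conj ae_curve_all ae_curve_integrable borel_measurable_lp_sum)
  then show "ae_curve p M (\<lambda>c. \<forall>t\<in>{0..fst c}. snd c t \<notin> Z)"
  proof (rule ae_curve_mono, intro ballI notI)
    fix c t assume c: "c \<in> curves M" and reg: "(\<forall>n. regular_along (u n) (min_grad p M (u n)) c) \<and>
      curve_integral c (lp_sum p a) < \<infinity> \<and> curve_integral c (lp_sum p g) < \<infinity>"
      and t: "t \<in> {0..fst c}" "snd c t \<in> Z"
    \<comment> \<open>If the curve meets \<open>Z\<close>, the oscillation bound from a point
      \<open>s\<close> with finite \<open>lp_sum p a\<close> puts one finite number above all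
      \<open>2^n\<close>.\<close>
    obtain s where s: "s \<in> {0..fst c}" "lp_sum p a (snd c s) < \<infinity>"
      using curve_integral_finite_point[OF c, of "lp_sum p a"] reg by blast
    have "ennreal (2^n) \<le> lp_sum p a (snd c s) + curve_integral c (lp_sum p g)" for n
    proof -
      have len: "0 \<le> fst c" using c by (auto simp: curves_def)
      have "1 \<le> e2ennreal \<bar>u n (snd c s)\<bar> + curve_integral c (min_grad p M (u n))"
        using regular_along_osc[of "u n" "min_grad p M (u n)" c s t] reg s t u(2) by simp
      then have "ennreal (2^n) * 1 \<le> ennreal (2^n) * (e2ennreal \<bar>u n (snd c s)\<bar> + curve_integral c (min_grad p M (u n)))"
        by (intro mult_left_mono) auto
      also have "\<dots> = a n (snd c s) + (\<integral>\<^sup>+t. ennreal (2^n) * curve_trace c (min_grad p M (u n)) t \<partial>lebesgue)"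
        using regular_alongD(1)[of "u n" "min_grad p M (u n)" c] reg len
        by (simp add: a_def distrib_left curve_integral_trace nn_integral_cmult)
      also have "\<dots> \<le> lp_sum p a (snd c s) + curve_integral c (lp_sum p g)"
        unfolding curve_integral_trace curve_trace_def
        using lp_sum_ge[OF p_pos, of a n] lp_sum_ge[OF p_pos, of g n]
        by (intro add_mono nn_integral_mono) (auto simp: indicator_def g_def)
      finally show ?thesis by simp
    qed
    then have "lp_sum p a (snd c s) + curve_integral c (lp_sum p g) = \<infinity>"
      by (rule ennreal_unbounded)
    then show False using s(2) reg by auto
  qed
qed

end

section \<open>Truncations and the variational capacity\<close>

definition etruncate :: "real \<Rightarrow> real \<Rightarrow> ereal \<Rightarrow> real" where
  "etruncate a b y = real_of_ereal (max (ereal a) (min (ereal b) y))"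

lemma etruncate_ereal: "etruncate a b (ereal y) = truncate a b y"
  by (simp add: etruncate_def truncate_def max_def min_def)

lemma etruncate_eq:
  assumes "a < b"
  shows "y \<le> ereal a \<Longrightarrow> etruncate a b y = a" "ereal b \<le> y \<Longrightarrow> etruncate a b y = b"
  using assms by (cases y; auto simp: etruncate_def max_def min_def)+

context newtonian_space
begin

lemma variational_capacity_le:
  assumes "zero_extension E u \<in> newtonian p M" "\<And>x. x \<in> A \<Longrightarrow> u x \<ge> 1"
  shows "variational_capacity p M A E \<le> grad_energy p M (zero_extension E u)"
  unfolding variational_capacity_def
proof (rule INF_lower)
  have "u \<in> newtonian_zero p M E"
    unfolding newtonian_zero_def using assms(1)
    by (auto intro!: bexI[of _ "zero_extension E u"] simp: zero_extension_def)
  then show "u \<in> {u \<in> newtonian_zero p M E. \<forall>x\<in>A. 1 \<le> u x}"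
    using assms(2) by simp
qed

lemma newtonian_zero_iff: "u \<in> newtonian_zero p M E \<longleftrightarrow> zero_extension E u \<in> newtonian p M"
proof
  assume "u \<in> newtonian_zero p M E"
  then obtain h where h: "h \<in> newtonian p M" "\<forall>x\<in>space M - E. h x = 0" "\<forall>x\<in>E. u x = h x"
    by (auto simp: newtonian_zero_def)
  then have "zero_extension E u = h"
    by (auto simp: zero_extension_def fun_eq_iff)
  then show "zero_extension E u \<in> newtonian p M" using h(1) by simp
next
  assume "zero_extension E u \<in> newtonian p M"
  then show "u \<in> newtonian_zero p M E"
    unfolding newtonian_zero_def
    by (auto intro!: bexI[of _ "zero_extension E u"] simp: zero_extension_def)
qed

text \<open>The test function is 1 on the exceptional set \<open>Z\<close> and a normalized truncation
  of \<open>h\<close> elsewhere; almost every curve avoids \<open>Z\<close>.\<close>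
lemma variational_capacity_superlevel:
  assumes h: "h \<in> newtonian p M" "\<And>x. x \<notin> E \<Longrightarrow> h x = 0"
    and Z: "sobolev_capacity p M Z = 0" "Z \<subseteq> E"
    and ab: "0 < a" "a < b"
    and A: "\<And>x. x \<in> A \<Longrightarrow> x \<in> Z \<or> ereal b \<le> h x"
  shows "variational_capacity p M A E \<le> epow (ennreal (1 / (b - a))) p *
    (\<integral>\<^sup>+x. epow (min_grad p M h x) p * indicator {x. ereal a < h x \<and> h x < ereal b} x \<partial>M)"
proof -
  \<comment> \<open>The capacity asks for \<open>u \<ge> 1\<close> at every point of
    \<open>A\<close>, so the value on \<open>Z\<close> must be prescribed although neither the norm
    nor the energy sees it.\<close>
  define u :: "'a \<Rightarrow> ereal" where "u x = (if x \<in> Z then 1 else ereal ((etruncate a b (h x) - a) / (b - a)))" for x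
  define S where "S = {x. ereal a < h x \<and> h x < ereal b}"
  define g0 where "g0 x = min_grad p M h x * indicator S x" for x
  define g where "g x = ennreal (1 / (b - a)) * g0 x" for x
  have hm [measurable]: "h \<in> borel_measurable M" by (rule newtonianD(1)[OF h(1)])
  have Zn: "Z \<in> null_sets M" by (rule sobolev_capacity_zero(1)[OF Z(1)])
  then have [measurable]: "Z \<in> sets M" by auto
  have "S = {x\<in>space M. ereal a < h x \<and> h x < ereal b}" by (simp add: S_def)
  also have "\<dots> \<in> sets M" by measurable
  finally have S: "S \<in> sets M" .
  have g0m: "g0 \<in> borel_measurable M"
    unfolding g0_def[abs_def] using newtonianD(3)[OF h(1)] S by simp
  then have gm: "g \<in> borel_measurable M"
    unfolding g_def[abs_def] by simp
  have um: "u \<in> borel_measurable M"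
    unfolding u_def[abs_def] etruncate_def by measurable
  have Lp_g: "Lp_integral p M g = epow (ennreal (1 / (b - a))) p *
    (\<integral>\<^sup>+x. epow (min_grad p M h x) p * indicator S x \<partial>M)"
  proof -
    have "Lp_integral p M g = epow (ennreal (1 / (b - a))) p * Lp_integral p M g0"
      unfolding g_def[abs_def] by (rule Lp_integral_cmult[OF g0m])
    also have "Lp_integral p M g0 = (\<integral>\<^sup>+x. epow (min_grad p M h x) p * indicator S x \<partial>M)"
      unfolding Lp_integral_def g0_def epow_mult
      by (intro nn_integral_cong) (auto simp: indicator_def)
    finally show ?thesis .
  qed
  have "(\<integral>\<^sup>+x. epow (min_grad p M h x) p * indicator S x \<partial>M) \<le> Lp_integral p M (min_grad p M h)"
    unfolding Lp_integral_def by (intro nn_integral_mono) (auto simp: indicator_def)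
  then have g_fin: "Lp_integral p M g < \<infinity>"
    unfolding Lp_g using newtonianD(4)[OF h(1)] epow_less_top_iff[of "ennreal (1 / (b - a))" p]
    by (auto simp: ennreal_mult_less_top)
  have weak: "weak_upper_gradient p M u g"
    unfolding weak_upper_gradient_iff
  proof (intro conjI gm)
    show "ae_curve p M (\<lambda>c. curve_trace c g \<in> borel_measurable lebesgue \<and> endpoint_gap u c \<le> curve_integral c g)"
      using ae_curve_conj[OF ae_curve_conj[OF ae_curve_trace_measurable[OF g0m] ae_curve_trace_measurable[OF gm]]
          ae_curve_conj[OF newtonianD(6)[OF h(1)] sobolev_capacity_zero(2)[OF Z(1)]]]
    proof (rule ae_curve_mono, intro conjI)
      fix c assume c: "c \<in> curves M" and
        *: "(curve_trace c g0 \<in> borel_measurable lebesgue \<and> curve_trace c g \<in> borel_measurable lebesgue) \<and>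
          regular_along h (min_grad p M h) c \<and> (\<forall>t\<in>{0..fst c}. snd c t \<notin> Z)"
      then show "curve_trace c g \<in> borel_measurable lebesgue" by blast
      define w where "w t = real_of_ereal (h (snd c t))" for t
      have len: "0 \<le> fst c" using c by (auto simp: curves_def)
      have hw: "h (snd c t) = ereal (w t)" if "t \<in> {0..fst c}" for t
        using * that unfolding w_def regular_along_def by (auto simp: ereal_real)
      have uw: "u (snd c t) = ereal ((truncate a b (w t) - a) / (b - a))" if "t \<in> {0..fst c}" for t
        using * that by (simp add: u_def hw etruncate_ereal)
      have "endpoint_gap u c = ennreal \<bar>(truncate a b (w 0) - a) / (b - a) - (truncate a b (w (fst c)) - a) / (b - a)\<bar>"
        using len by (subst endpoint_gap_real) (auto simp: uw)
      also have "\<dots> = ennreal (1 / (b - a)) * ennreal \<bar>truncate a b (w 0) - truncate a b (w (fst c))\<bar>"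
        using ab by (subst ennreal_mult[symmetric]) (auto simp: abs_divide simp flip: diff_divide_distrib)
      also have "\<dots> \<le> ennreal (1 / (b - a)) *
          (\<integral>\<^sup>+t. curve_trace c (min_grad p M h) t * indicator {t. a < w t \<and> w t < b} t * indicator {0..fst c} t \<partial>lebesgue)"
        using * len ab unfolding w_def regular_along_def by (intro mult_left_mono controlled_truncate) auto
      also have "(\<integral>\<^sup>+t. curve_trace c (min_grad p M h) t * indicator {t. a < w t \<and> w t < b} t * indicator {0..fst c} t \<partial>lebesgue)
          = (\<integral>\<^sup>+t. curve_trace c g0 t \<partial>lebesgue)"
        by (intro nn_integral_cong) (auto simp: curve_trace_def g0_def S_def hw indicator_def)
      also have "ennreal (1 / (b - a)) * \<dots> = (\<integral>\<^sup>+t. ennreal (1 / (b - a)) * curve_trace c g0 t \<partial>lebesgue)"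
        using * by (simp add: nn_integral_cmult)
      also have "\<dots> = curve_integral c g"
        unfolding curve_integral_trace by (intro nn_integral_cong) (simp add: curve_trace_def g_def mult.assoc)
      finally show "endpoint_gap u c \<le> curve_integral c g" .
    qed
  qed
  \<comment> \<open>Off \<open>Z\<close>, \<open>u\<close> vanishes where \<open>h \<le> a\<close>
    and is at most 1 elsewhere. As \<open>a > 0\<close>, comparison with \<open>h / a\<close> puts
    it in L^p.\<close>
  have "AE x in M. e2ennreal \<bar>u x\<bar> \<le> ennreal (1 / a) * e2ennreal \<bar>h x\<bar>"
    using AE_not_in[OF Zn]
  proof eventually_elim
    case (elim x)
    show ?case
    proof (cases "h x")
      case (real y)
      have "\<bar>(truncate a b y - a) / (b - a)\<bar> \<le> (1 / a) * \<bar>y\<bar>"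
      proof (cases "y \<le> a")
        case True
        then show ?thesis using ab by (simp add: truncate_def)
      next
        case False
        have "a \<le> truncate a b y" "truncate a b y \<le> b" using ab by (auto simp: truncate_def)
        then have "\<bar>(truncate a b y - a) / (b - a)\<bar> \<le> 1" using ab by (simp add: abs_le_iff divide_simps)
        also have "1 \<le> (1 / a) * \<bar>y\<bar>" using False ab by (simp add: field_simps)
        finally show ?thesis .
      qed
      then show ?thesis
        using elim ab by (simp add: u_def real etruncate_ereal e2ennreal_ereal flip: ennreal_mult)
    next
      case PInf
      then show ?thesis using ab by (simp add: ennreal_mult_top)
    next
      case MInf
      then show ?thesis using ab by (simp add: ennreal_mult_top)
    qed
  qed
  then have "Lp_integral p M (\<lambda>x. e2ennreal \<bar>u x\<bar>) \<le> Lp_integral p M (\<lambda>x. ennreal (1 / a) * e2ennreal \<bar>h x\<bar>)"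
    by (rule Lp_integral_mono_AE[OF p_pos])
  also have "\<dots> = epow (ennreal (1 / a)) p * Lp_integral p M (\<lambda>x. e2ennreal \<bar>h x\<bar>)"
    by (intro Lp_integral_cmult abs_measurable hm)
  also have "\<dots> < \<infinity>"
    using newtonianD(5)[OF h(1)] epow_less_top_iff[of "ennreal (1 / a)" p]
    by (simp add: ennreal_mult_less_top)
  finally have "u \<in> newtonian p M"
    by (intro newtonianI[OF um weak g_fin])
  \<comment> \<open>Outside \<open>E\<close> the value of \<open>h\<close> is 0, below the level
    \<open>a\<close>, so the normalized truncation vanishes there.\<close>
  moreover have ext: "zero_extension E u = u"
    using h(2) Z(2) etruncate_eq(1)[OF ab(2), of 0] ab
    by (auto simp: zero_extension_def u_def fun_eq_iff zero_ereal_def)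
  moreover have "u x \<ge> 1" if "x \<in> A" for x
    using A[OF that] etruncate_eq(2)[OF ab(2), of "h x"] ab by (auto simp: u_def one_ereal_def)
  ultimately have "variational_capacity p M A E \<le> grad_energy p M u"
    using variational_capacity_le[of E u A] by simp
  also have "\<dots> \<le> Lp_integral p M g"
    using weak g_fin by (intro grad_energy_le Lp_imp_Lp_loc)
  finally show ?thesis unfolding Lp_g S_def .
qed

end

section \<open>The capacitary integral\<close>

text \<open>\<^const>\<open>int_decode\<close> enumerates the integers, so sums over all dyadic scales
  become series over the natural numbers.\<close>
definition dyad :: "nat \<Rightarrow> real" where
  "dyad n = 2 powr real_of_int (int_decode n)"

lemma dyad_pos [simp]: "dyad n > 0"
  by (simp add: dyad_def)

lemma dyad_neq_0 [simp]: "dyad n \<noteq> 0"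
  by (rule less_imp_neq[OF dyad_pos, symmetric])

lemma dyad_interval_iff: "0 < t \<Longrightarrow> dyad n \<le> t \<and> t < 2 * dyad n \<longleftrightarrow> int_decode n = \<lfloor>log 2 t\<rfloor>"
proof -
  assume t: "0 < t"
  have "dyad n \<le> t \<longleftrightarrow> real_of_int (int_decode n) \<le> log 2 t"
    using t by (simp add: dyad_def le_log_iff)
  moreover have "2 * dyad n = 2 powr (real_of_int (int_decode n) + 1)"
    by (simp add: dyad_def powr_add)
  then have "t < 2 * dyad n \<longleftrightarrow> log 2 t < real_of_int (int_decode n) + 1"
    using t by (simp add: log_less_iff)
  ultimately show ?thesis by (metis floor_eq_iff)
qed

lemma dyad_exists:
  assumes "0 < t"
  obtains n where "dyad n \<le> t" "t < 2 * dyad n"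
  using dyad_interval_iff[OF assms, of "int_encode \<lfloor>log 2 t\<rfloor>"] by auto

lemma dyad_unique:
  assumes "dyad m \<le> t" "t < 2 * dyad m" "dyad n \<le> t" "t < 2 * dyad n"
  shows "m = n"
proof -
  have "0 < t" using assms(1) dyad_pos[of m] by linarith
  then have "int_decode m = int_decode n" using dyad_interval_iff assms by metis
  then show ?thesis using inj_int_decode by (simp add: inj_eq)
qed

section \<open>Comparison of the integral with a dyadic series\<close>

lemma suminf_disjoint:
  fixes c :: "nat \<Rightarrow> ennreal"
  assumes "x \<in> S n" "\<And>m. x \<in> S m \<Longrightarrow> m = n"
  shows "(\<Sum>m. c m * indicator (S m) x) = c n"
proof -
  have "(\<Sum>m. c m * indicator (S m) x) = (\<Sum>m\<in>{n}. c m * indicator (S m) x)"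
    using assms(2) by (intro suminf_finite) (auto simp: indicator_def)
  then show ?thesis using assms(1) by simp
qed

text \<open>On a dyadic interval the decreasing \<open>\<Phi>\<close> is at most its value at the
  left end and, since \<open>p \<ge> 1\<close>, the power is at most its value at the right end. The
  resulting step function is integrated term by term.\<close>

lemma dyadic_upper:
  fixes \<Phi> :: "real \<Rightarrow> ennreal"
  assumes "p \<ge> 1" "\<And>s t. 0 < s \<Longrightarrow> s \<le> t \<Longrightarrow> \<Phi> t \<le> \<Phi> s"
  shows "(\<integral>\<^sup>+t. ennreal (t powr (p - 1)) * \<Phi> t * indicator {0<..} t \<partial>lborel) \<le>
    (\<Sum>n. ennreal ((2 * dyad n) powr p) * \<Phi> (dyad n))"
proof -
  define c where "c n = ennreal ((2 * dyad n) powr (p - 1)) * \<Phi> (dyad n)" for n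
  have "(\<integral>\<^sup>+t. ennreal (t powr (p - 1)) * \<Phi> t * indicator {0<..} t \<partial>lborel) \<le>
      (\<integral>\<^sup>+t. (\<Sum>n. c n * indicator {dyad n..<2 * dyad n} t) \<partial>lborel)"
  proof (rule nn_integral_mono)
    fix t :: real
    show "ennreal (t powr (p - 1)) * \<Phi> t * indicator {0<..} t \<le> (\<Sum>n. c n * indicator {dyad n..<2 * dyad n} t)"
    proof (cases "t > 0")
      case True
      then obtain n where n: "dyad n \<le> t" "t < 2 * dyad n" by (rule dyad_exists)
      have "ennreal (t powr (p - 1)) * \<Phi> t \<le> c n"
        unfolding c_def using n True assms by (intro mult_mono ennreal_leI powr_mono2) auto
      also have "c n = (\<Sum>n. c n * indicator {dyad n..<2 * dyad n} t)"
        using n dyad_unique by (intro suminf_disjoint[symmetric]) auto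
      finally show ?thesis using True by simp
    qed simp
  qed
  also have "\<dots> = (\<Sum>n. c n * ennreal (dyad n))"
    by (subst nn_integral_suminf) (auto simp: nn_integral_cmult_indicator less_imp_le)
  also have "\<dots> \<le> (\<Sum>n. ennreal ((2 * dyad n) powr p) * \<Phi> (dyad n))"
  proof (rule suminf_le)
    fix n
    have "(2 * dyad n) powr (p - 1) * dyad n \<le> (2 * dyad n) powr (p - 1) * (2 * dyad n) powr 1"
      using dyad_pos[of n] by (intro mult_left_mono) (auto simp: less_imp_le)
    also have "\<dots> = (2 * dyad n) powr p"
      using powr_add[of "2 * dyad n" "p - 1" 1] by (simp only: diff_add_cancel)
    finally have "ennreal ((2 * dyad n) powr (p - 1)) * ennreal (dyad n) \<le> ennreal ((2 * dyad n) powr p)"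
      by (simp add: less_imp_le flip: ennreal_mult)
    then have "ennreal ((2 * dyad n) powr (p - 1)) * ennreal (dyad n) * \<Phi> (dyad n) \<le> ennreal ((2 * dyad n) powr p) * \<Phi> (dyad n)"
      by (rule mult_right_mono) simp
    then show "c n * ennreal (dyad n) \<le> ennreal ((2 * dyad n) powr p) * \<Phi> (dyad n)"
      by (simp add: c_def mult.commute mult.left_commute)
  qed auto
  finally show ?thesis .
qed

text \<open>The ends of the interval change roles: the power is estimated at the left end and
  \<open>\<Phi>\<close> at the right end, one scale higher.\<close>

lemma dyadic_lower:
  fixes \<Phi> :: "real \<Rightarrow> ennreal"
  assumes "p \<ge> 1" "\<And>s t. 0 < s \<Longrightarrow> s \<le> t \<Longrightarrow> \<Phi> t \<le> \<Phi> s"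
  shows "(\<Sum>n. ennreal (dyad n powr p) * \<Phi> (2 * dyad n)) \<le>
    (\<integral>\<^sup>+t. ennreal (t powr (p - 1)) * \<Phi> t * indicator {0<..} t \<partial>lborel)"
proof -
  define c where "c n = ennreal (dyad n powr (p - 1)) * \<Phi> (2 * dyad n)" for n
  have "c n * ennreal (dyad n) = ennreal (dyad n powr p) * \<Phi> (2 * dyad n)" for n
  proof -
    have "dyad n powr p = dyad n powr (p - 1) * dyad n powr 1"
      using powr_add[of "dyad n" "p - 1" 1] by (simp only: diff_add_cancel)
    then have "ennreal (dyad n powr p) = ennreal (dyad n powr (p - 1)) * ennreal (dyad n)"
      by (simp add: less_imp_le ennreal_mult)
    then show ?thesis by (simp add: c_def mult.commute mult.left_commute)
  qed
  then have "(\<Sum>n. ennreal (dyad n powr p) * \<Phi> (2 * dyad n)) = (\<Sum>n. c n * ennreal (dyad n))"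
    by simp
  also have "\<dots> = (\<integral>\<^sup>+t. (\<Sum>n. c n * indicator {dyad n..<2 * dyad n} t) \<partial>lborel)"
    by (subst nn_integral_suminf) (auto simp: nn_integral_cmult_indicator less_imp_le)
  also have "\<dots> \<le> (\<integral>\<^sup>+t. ennreal (t powr (p - 1)) * \<Phi> t * indicator {0<..} t \<partial>lborel)"
  proof (rule nn_integral_mono)
    fix t :: real
    show "(\<Sum>n. c n * indicator {dyad n..<2 * dyad n} t) \<le> ennreal (t powr (p - 1)) * \<Phi> t * indicator {0<..} t"
    proof (cases "t > 0")
      case True
      then obtain n where n: "dyad n \<le> t" "t < 2 * dyad n" by (rule dyad_exists)
      have "(\<Sum>n. c n * indicator {dyad n..<2 * dyad n} t) = c n"
        using n dyad_unique by (intro suminf_disjoint) auto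
      also have "c n \<le> ennreal (t powr (p - 1)) * \<Phi> t"
        unfolding c_def using n True assms by (intro mult_mono ennreal_leI powr_mono2) (auto simp: less_imp_le)
      finally show ?thesis using True by simp
    next
      case False
      then have "t \<notin> {dyad n..<2 * dyad n}" for n using dyad_pos[of n] by auto
      then show ?thesis by simp
    qed
  qed
  finally show ?thesis .
qed

lemma variational_capacity_mono:
  "A \<subseteq> B \<Longrightarrow> variational_capacity p M A E \<le> variational_capacity p M B E"
  unfolding variational_capacity_def by (intro INF_superset_mono) auto

section \<open>Necessity: a nonempty class makes the integral finite\<close>

context newtonian_space
begin

lemma obstacle_capacity_integral_finite:
  assumes "p \<ge> 1" "v \<in> obstacle_class p M E \<psi> f"
  shows "(\<integral>\<^sup>+t. ennreal (t powr (p - 1)) *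
        variational_capacity p M {x \<in> E. ediff (\<psi> x) (f x) > ereal t} E *
        indicator {0<..} t \<partial>lborel) < \<infinity>"
proof -
  define A where "A t = {x \<in> E. ediff (\<psi> x) (f x) > ereal t}" for t
  define h where "h = zero_extension E (\<lambda>x. ediff (v x) (f x))"
  define Z where "Z = {x \<in> E. \<not> v x \<ge> \<psi> x}"
  define g where "g = min_grad p M h"
  define S where "S n = {x. ereal (dyad n / 2) < h x \<and> h x < ereal (dyad n)}" for n
  have h: "h \<in> newtonian p M"
    using assms(2) unfolding obstacle_class_def h_def by (simp add: newtonian_zero_iff)
  have Z: "sobolev_capacity p M Z = 0"
    using assms(2) by (simp add: obstacle_class_def Z_def)
  have g: "g \<in> borel_measurable M" "Lp_integral p M g < \<infinity>"
    unfolding g_def using newtonianD(3,4)[OF h] by auto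
  have S: "S n \<in> sets M" for n
  proof -
    have "S n = {x\<in>space M. ereal (dyad n / 2) < h x \<and> h x < ereal (dyad n)}" by (simp add: S_def)
    also have "\<dots> \<in> sets M" using newtonianD(1)[OF h] by measurable
    finally show ?thesis .
  qed
  \<comment> \<open>The positive level \<open>b\<close> excludes the conventional value 0 of
    \<open>ediff\<close> at equal arguments, so off \<open>Z\<close> the order
    \<open>\<psi> x \<le> v x\<close> passes to the differences with \<open>f x\<close>.\<close>
  have level: "x \<in> Z \<or> ereal b \<le> h x" if "x \<in> A b" "0 < b" for x b
  proof (cases "v x \<ge> \<psi> x")
    case True
    have "ereal b < ediff (\<psi> x) (f x)" "x \<in> E" using that by (auto simp: A_def)
    then have "ereal b \<le> ediff (v x) (f x)"
      using True \<open>0 < b\<close> unfolding ediff_def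
      by (cases "v x"; cases "\<psi> x"; cases "f x") (auto split: if_splits)
    then show ?thesis using \<open>x \<in> E\<close> by (simp add: h_def zero_extension_def)
  next
    case False
    then show ?thesis using that by (auto simp: Z_def A_def)
  qed
  have term_le: "ennreal ((2 * dyad n) powr p) * variational_capacity p M (A (dyad n)) E \<le>
      ennreal (4 powr p) * (\<integral>\<^sup>+x. epow (g x) p * indicator (S n) x \<partial>M)" for n
  proof -
    have "variational_capacity p M (A (dyad n)) E \<le> epow (ennreal (1 / (dyad n - dyad n / 2))) p *
      (\<integral>\<^sup>+x. epow (min_grad p M h x) p * indicator {x. ereal (dyad n / 2) < h x \<and> h x < ereal (dyad n)} x \<partial>M)"
      using h Z level[of _ "dyad n"]
      by (intro variational_capacity_superlevel[where Z = Z]) (auto simp: h_def zero_extension_def Z_def)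
    then have "ennreal ((2 * dyad n) powr p) * variational_capacity p M (A (dyad n)) E \<le>
        ennreal ((2 * dyad n) powr p) * (epow (ennreal (2 / dyad n)) p *
          (\<integral>\<^sup>+x. epow (g x) p * indicator (S n) x \<partial>M))"
      unfolding S_def g_def by (intro mult_left_mono) auto
    also have "\<dots> = ennreal ((2 * dyad n) powr p) * epow (ennreal (2 / dyad n)) p *
          (\<integral>\<^sup>+x. epow (g x) p * indicator (S n) x \<partial>M)"
      by (simp add: mult.assoc)
    \<comment> \<open>The factor \<open>2 * dyad n\<close> comes from the right ends in
      \<open>dyadic_upper\<close>, and \<open>2 / dyad n\<close> from the width of the
      truncation.\<close>
    also have "ennreal ((2 * dyad n) powr p) * epow (ennreal (2 / dyad n)) p = ennreal (4 powr p)"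
    proof -
      have "(2 * dyad n) powr p * (2 / dyad n) powr p = (2 * dyad n * (2 / dyad n)) powr p"
        using dyad_pos[of n] by (intro powr_mult[symmetric])
      also have "2 * dyad n * (2 / dyad n) = 4" using dyad_pos[of n] by (simp add: less_imp_neq[symmetric])
      finally show ?thesis
        using dyad_pos[of n] by (simp add: epow_ennreal less_imp_le flip: ennreal_mult)
    qed
    finally show ?thesis .
  qed
  have meas: "(\<lambda>x. epow (g x) p * indicator (S n) x) \<in> borel_measurable M" for n
    using g(1) S by (intro borel_measurable_times_ennreal borel_measurable_epow borel_measurable_indicator) auto
  have "(\<integral>\<^sup>+t. ennreal (t powr (p - 1)) * variational_capacity p M (A t) E * indicator {0<..} t \<partial>lborel)
      \<le> (\<Sum>n. ennreal ((2 * dyad n) powr p) * variational_capacity p M (A (dyad n)) E)"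
  proof (intro dyadic_upper assms(1) variational_capacity_mono)
    fix s t :: real assume "s \<le> t"
    then show "A t \<subseteq> A s" unfolding A_def by (auto intro: le_less_trans[of "ereal s" "ereal t"])
  qed
  also have "\<dots> \<le> (\<Sum>n. ennreal (4 powr p) * (\<integral>\<^sup>+x. epow (g x) p * indicator (S n) x \<partial>M))"
    by (intro suminf_le term_le) auto
  also have "\<dots> = ennreal (4 powr p) * (\<integral>\<^sup>+x. (\<Sum>n. epow (g x) p * indicator (S n) x) \<partial>M)"
    by (subst nn_integral_suminf[OF meas]) (rule ennreal_suminf_cmult)
  also have "\<dots> \<le> ennreal (4 powr p) * Lp_integral p M g"
    unfolding Lp_integral_def
  proof (intro mult_left_mono nn_integral_mono)
    fix x
    have uniq: "m = n" if "x \<in> S m" "x \<in> S n" for m n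
    proof (cases "h x")
      case (real y)
      \<comment> \<open>Doubling moves the strip between \<open>dyad n / 2\<close> and
        \<open>dyad n\<close> into the dyadic interval that determines \<open>n\<close>.\<close>
      then show ?thesis using that by (intro dyad_unique[of m "2 * y"]) (auto simp: S_def)
    qed (use that in \<open>auto simp: S_def\<close>)
    show "(\<Sum>n. epow (g x) p * indicator (S n) x) \<le> epow (g x) p"
    proof (cases "\<exists>n. x \<in> S n")
      case True
      then obtain n where n: "x \<in> S n" by blast
      have "(\<Sum>n. epow (g x) p * indicator (S n) x) = epow (g x) p"
        by (rule suminf_disjoint[of x S n, OF n]) (rule uniq[OF _ n])
      then show ?thesis by (rule eq_refl)
    qed simp
  qed simp
  also have "\<dots> < \<infinity>"
    using g(2) by (simp add: ennreal_mult_less_top)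
  finally show ?thesis unfolding A_def .
qed

end

section \<open>Obstacles\<close>

lemma regular_along_cong:
  assumes "regular_along u g c" "\<And>t. t \<in> {0..fst c} \<Longrightarrow> w (snd c t) = u (snd c t)"
  shows "regular_along w g c"
  using assms unfolding regular_along_def controlled_def by auto

text \<open>For infinite \<open>f\<close> the sum is again \<open>f\<close> and the difference
  collapses to 0, except for \<open>f\<close> minus infinity and \<open>u\<close> infinite: then the
  sum is infinity and the difference is \<open>u\<close>.\<close>

lemma ediff_add_cases:
  assumes "0 \<le> u"
  shows "ediff (f + u) f = u \<or> ediff (f + u) f = 0"
    "\<bar>f\<bar> \<noteq> \<infinity> \<or> u = 0 \<Longrightarrow> ediff (f + u) f = u"
  using assms by (cases f; cases u; simp add: ediff_def zero_ereal_def)+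

text \<open>Only points with \<open>\<psi> > f\<close> impose a condition, and there
  \<open>ediff\<close> is the ordinary difference.\<close>

lemma ediff_le_imp_le_add:
  assumes "0 \<le> u" "0 < ediff \<psi> f \<Longrightarrow> ediff \<psi> f \<le> u"
  shows "\<psi> \<le> f + u"
proof (cases "\<psi> \<le> f")
  case True
  then show ?thesis
    using assms(1) by (cases f; cases u; cases \<psi>) auto
next
  case False
  then have "0 < \<psi> - f" "ediff \<psi> f = \<psi> - f"
    by (cases f; cases \<psi>; simp add: ediff_def)+
  then have "\<psi> - f \<le> u" using assms(2) by simp
  then show ?thesis
    using False assms(1) by (cases f; cases u; cases \<psi>) auto
qed

lemma e2ennreal_0 [simp]: "e2ennreal 0 = 0"
  using e2ennreal_ereal[of 0] by (simp flip: zero_ereal_def)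

context newtonian_space
begin

lemma curves_restrict_space:
  assumes "E \<in> sets M"
  shows "c \<in> curves (restrict_space M E) \<longleftrightarrow> c \<in> curves M \<and> snd c ` {0..fst c} \<subseteq> E"
  using assms by (cases c) (auto simp: curves_def space_restrict_space)

lemma borel_measurable_restrict_M:
  assumes "g \<in> restrict_space borel E \<rightarrow>\<^sub>M K"
  shows "g \<in> restrict_space M E \<rightarrow>\<^sub>M K"
proof (rule measurableI)
  fix A assume "A \<in> sets K"
  then have "g -` A \<inter> space (restrict_space borel E) \<in> sets (restrict_space borel E)"
    using assms by (rule measurable_sets[rotated])
  then obtain B where "B \<in> sets borel" "g -` A \<inter> E = E \<inter> B"
    by (auto simp: sets_restrict_space space_restrict_space)
  then show "g -` A \<inter> space (restrict_space M E) \<in> sets (restrict_space M E)"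
    unfolding sets_restrict_space using sets_borel_M by (auto simp: space_restrict_space)
next
  show "g x \<in> space K" if "x \<in> space (restrict_space M E)" for x
    using measurable_space[OF assms, of x] that by (simp add: space_restrict_space)
qed

text \<open>A curve of the ambient space on which \<open>u\<close> is continuous and nonzero at some parameter has a
  subcurve around that parameter inside \<open>E\<close>; almost all such subcurves avoid the
  infinities of \<open>f\<close>.\<close>
lemma ae_curve_finite_on_support:
  assumes E: "E \<in> sets M" and f: "f \<in> dirichlet p (restrict_space M E)"
    and u: "\<And>x. x \<notin> E \<Longrightarrow> u x = 0" and reg: "ae_curve p M (regular_along u g)"
  shows "ae_curve p M (\<lambda>c. \<forall>t\<in>{0..fst c}. u (snd c t) \<noteq> 0 \<longrightarrow> \<bar>f (snd c t)\<bar> \<noteq> \<infinity>)"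
proof -
  have space_E: "space (restrict_space M E) = E"
    by (simp add: space_restrict_space)
  obtain k where k: "upper_gradient (restrict_space M E) f k" "Lp_integral p (restrict_space M E) k < \<infinity>"
    using f by (auto simp: dirichlet_def)
  have k_borel: "k \<in> borel_measurable (restrict_space borel E)"
    using k(1) unfolding upper_gradient_def space_E by simp
  have "k \<in> borel_measurable (restrict_space M E)"
    using k_borel by (rule borel_measurable_restrict_M)
  \<comment> \<open>Extended by 0, the upper gradient of \<open>f\<close> on \<open>E\<close> is
    p-integrable on the whole space, hence integrable along almost every ambient curve.\<close>
  define F where "F x = k x * indicator E x" for x
  have F: "F \<in> borel_measurable M"
    unfolding F_def[abs_def]
    using \<open>k \<in> borel_measurable (restrict_space M E)\<close> E
    by (subst (asm) borel_measurable_restrict_space_iff_ennreal) auto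
  have "Lp_integral p M F = Lp_integral p (restrict_space M E) k"
    unfolding Lp_integral_def F_def epow_mult using E
    by (subst nn_integral_restrict_space) (auto intro!: nn_integral_cong simp: indicator_def)
  then have F_fin: "Lp_integral p M F < \<infinity>" using k(2) by simp
  show ?thesis
  proof (rule ae_curve_mono[OF ae_curve_conj[OF reg ae_curve_conj[OF ae_curve_integrable[OF F F_fin] ae_curve_trace_measurable[OF F]]]],
      intro ballI impI)
    fix c t assume c: "c \<in> curves M" and
      *: "regular_along u g c \<and> curve_integral c F < \<infinity> \<and> curve_trace c F \<in> borel_measurable lebesgue"
      and t: "t \<in> {0..fst c}" and nz: "u (snd c t) \<noteq> 0"
    have len: "fst c > 0" using c by (auto simp: curves_def)
    define w where "w r = real_of_ereal (u (snd c r))" for r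
    have uw: "u (snd c r) = ereal (w r)" if "r \<in> {0..fst c}" for r
      using * that unfolding w_def regular_along_def by (auto simp: ereal_real)
    have cont: "continuous_on {0..fst c} w"
      using * controlled_continuous unfolding w_def regular_along_def by blast
    have "w t \<noteq> 0" using nz uw[OF t] by (auto simp: zero_ereal_def)
    \<comment> \<open>An oscillation below \<open>\<bar>w t\<bar>\<close> keeps \<open>w\<close>
      nonzero, hence the curve inside \<open>E\<close>.\<close>
    then have "\<exists>d>0. \<forall>r\<in>{0..fst c}. dist r t < d \<longrightarrow> dist (w r) (w t) < \<bar>w t\<bar>"
      using cont t unfolding continuous_on_iff by (metis zero_less_abs_iff)
    then obtain d where d: "d > 0" "\<And>r. r \<in> {0..fst c} \<Longrightarrow> dist r t < d \<Longrightarrow> dist (w r) (w t) < \<bar>w t\<bar>"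
      by blast
    have in_E: "snd c r \<in> E" if "r \<in> {0..fst c}" "dist r t < d" for r
    proof (rule ccontr)
      assume "snd c r \<notin> E"
      then have "w r = 0" using u by (simp add: w_def)
      then show False using d(2)[OF that] by (simp add: dist_real_def)
    qed
    have gap: "endpoint_gap f (subcurve c a b) < \<infinity>"
      if ab: "0 \<le> a" "a < b" "b \<le> fst c" "\<And>r. a \<le> r \<Longrightarrow> r \<le> b \<Longrightarrow> dist r t < d" for a b
    proof -
      have sub: "subcurve c a b \<in> curves (restrict_space M E)"
        unfolding curves_restrict_space[OF E]
      proof
        show "subcurve c a b \<in> curves M" using ab by (intro subcurve_in_curves[OF c])
        show "snd (subcurve c a b) ` {0..fst (subcurve c a b)} \<subseteq> E"
        proof (rule image_subsetI)
          fix r assume "r \<in> {0..fst (subcurve c a b)}"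
          then have "a \<le> a + r" "a + r \<le> b" by (auto simp: subcurve_def)
          then show "snd (subcurve c a b) r \<in> E"
            unfolding subcurve_def snd_conv using ab by (intro in_E) auto
        qed
      qed
      have "endpoint_gap f (subcurve c a b) \<le> curve_integral (subcurve c a b) k"
        using k(1) sub by (auto simp: upper_gradient_def)
      also have "\<dots> = curve_integral (subcurve c a b) F"
        unfolding curve_integral_trace
      proof (rule nn_integral_cong)
        fix r
        have "r \<in> {0..fst (subcurve c a b)} \<Longrightarrow> snd (subcurve c a b) r \<in> E"
          using sub unfolding curves_restrict_space[OF E] by blast
        then show "curve_trace (subcurve c a b) k r = curve_trace (subcurve c a b) F r"
          by (auto simp: curve_trace_def F_def indicator_def)
      qed
      also have "\<dots> = (\<integral>\<^sup>+r. curve_trace c F r * indicator {a..b} r \<partial>lebesgue)"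
        using ab * by (intro curve_integral_subcurve) auto
      also have "\<dots> \<le> curve_integral c F"
        unfolding curve_integral_trace by (intro nn_integral_mono) (auto simp: indicator_def)
      also have "\<dots> < \<infinity>" using * by simp
      finally show ?thesis .
    qed
    show "\<bar>f (snd c t)\<bar> \<noteq> \<infinity>"
    \<comment> \<open>A subcurve needs positive length: it starts at \<open>t\<close>, unless
      \<open>t\<close> is the final parameter, where it ends at \<open>t\<close>.\<close>
    proof (cases "t < fst c")
      case True
      have "endpoint_gap f (subcurve c t (min (fst c) (t + d/2))) < \<infinity>"
        using True t d(1) by (intro gap) (auto simp: dist_real_def)
      then show ?thesis using endpoint_gap_finite(1) by (force simp: subcurve_def)
    next
      case False
      then have "t = fst c" using t by auto
      have "endpoint_gap f (subcurve c (max 0 (t - d/2)) t) < \<infinity>"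
        using \<open>t = fst c\<close> len d(1) by (intro gap) (auto simp: dist_real_def)
      then show ?thesis using endpoint_gap_finite(2) by (force simp: subcurve_def)
    qed
  qed
qed

lemma sobolev_capacity_empty: "sobolev_capacity p M {} = 0"
proof -
  have weak: "weak_upper_gradient p M (\<lambda>_. 0) (\<lambda>_. 0)"
    unfolding weak_upper_gradient_iff
    by (intro conjI ae_curve_always) (auto simp: endpoint_gap_def curve_trace_def[abs_def])
  have Lp0: "Lp_integral p M (\<lambda>_. 0) = 0" by (simp add: Lp_integral_def)
  have "(\<lambda>_. 0) \<in> newtonian p M"
    using weak Lp0 by (intro newtonianI[of _ "\<lambda>_. 0"]) auto
  moreover have "grad_energy p M (\<lambda>_. 0) = 0"
    using grad_energy_le[OF weak Lp_imp_Lp_loc] Lp0 by simp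
  then have "epow (newtonian_norm p M (\<lambda>_. 0)) p = 0"
    unfolding newtonian_norm_powr using Lp0 by simp
  ultimately have "sobolev_capacity p M {} \<le> 0"
    unfolding sobolev_capacity_def by (intro INF_lower2[of "\<lambda>_. 0"]) auto
  then show ?thesis by simp
qed

lemma Lp_integral_restrict_le:
  assumes "E \<in> sets M"
  shows "Lp_integral p (restrict_space M E) g \<le> Lp_integral p M g"
  unfolding Lp_integral_def using assms
  by (subst nn_integral_restrict_space) (auto intro!: nn_integral_mono simp: indicator_def)

text \<open>Where \<open>f\<close> is infinite, the difference of \<open>f + s\<close> and \<open>f\<close> need not be \<open>s\<close>, even on a set of
  positive measure, but almost no curve notices.\<close>
lemma obstacle_class_add:
  assumes E: "E \<in> sets M" and f: "f \<in> dirichlet p (restrict_space M E)"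
    and s: "s \<in> borel_measurable M" "Lp_integral p M s < \<infinity>" "\<And>x. x \<notin> E \<Longrightarrow> s x = 0"
    and G: "G \<in> borel_measurable M" "Lp_integral p M G < \<infinity>"
      "ae_curve p M (regular_along (\<lambda>x. enn2ereal (s x)) G)"
    and \<psi>: "\<And>x. x \<in> E \<Longrightarrow> 0 < ediff (\<psi> x) (f x) \<Longrightarrow> ediff (\<psi> x) (f x) \<le> enn2ereal (s x)"
  shows "(\<lambda>x. f x + enn2ereal (s x)) \<in> obstacle_class p M E \<psi> f"
proof -
  define u where "u x = enn2ereal (s x)" for x
  define w where "w = zero_extension E (\<lambda>x. ediff (f x + u x) (f x))"
  have u0: "u x = 0" if "x \<notin> E" for x using s(3) that by (simp add: u_def zero_ennreal.rep_eq)
  have u_nonneg: "0 \<le> u x" for x by (simp add: u_def)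
  have um: "u \<in> borel_measurable M"
    unfolding u_def[abs_def] using s(1) by measurable
  have reg: "ae_curve p M (regular_along u G)"
    using G(3) by (simp add: u_def[abs_def])
  have fm: "f \<in> borel_measurable (restrict_space M E)"
    using f by (simp add: dirichlet_def)
  then have f0m: "(\<lambda>x. if x \<in> E then f x else 0) \<in> borel_measurable M"
    using E by (subst (asm) measurable_restrict_space_iff[of _ _ 0]) auto
  have w_in: "w \<in> newtonian p M"
  proof (rule newtonianI)
    \<comment> \<open>\<open>f\<close> is measurable only on \<open>E\<close>. As \<open>u\<close>
      vanishes off \<open>E\<close>, giving \<open>f\<close> the value 0 there leaves
      \<open>w\<close> unchanged.\<close>
    define f0 where "f0 x = (if x \<in> E then f x else 0)" for x
    have [measurable]: "f0 \<in> borel_measurable M" "u \<in> borel_measurable M"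
      using f0m um by (simp_all add: f0_def[abs_def])
    have "w x = ediff (f0 x + u x) (f0 x)" for x
      using u0[of x] by (simp add: w_def zero_extension_def f0_def ediff_def)
    then have "w = (\<lambda>x. if f0 x + u x = f0 x then 0 else f0 x + u x - f0 x)"
      by (simp add: ediff_def fun_eq_iff)
    also have "\<dots> \<in> borel_measurable M"
      by measurable
    finally show "w \<in> borel_measurable M" .
    have eq: "w (snd c t) = u (snd c t)"
      if "u (snd c t) \<noteq> 0 \<longrightarrow> \<bar>f (snd c t)\<bar> \<noteq> \<infinity>" for c :: "real \<times> (real \<Rightarrow> 'a)" and t
    proof (cases "snd c t \<in> E")
      case True
      then have "w (snd c t) = ediff (f (snd c t) + u (snd c t)) (f (snd c t))"
        by (simp add: w_def zero_extension_def)
      also have "\<dots> = u (snd c t)"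
        by (rule ediff_add_cases(2)[OF u_nonneg]) (use that in argo)
      finally show ?thesis .
    qed (simp add: w_def zero_extension_def u0)
    have support: "ae_curve p M (\<lambda>c. \<forall>t\<in>{0..fst c}. u (snd c t) \<noteq> 0 \<longrightarrow> \<bar>f (snd c t)\<bar> \<noteq> \<infinity>)"
      by (rule ae_curve_finite_on_support[OF E f _ reg]) (rule u0)
    have "ae_curve p M (regular_along w G)"
    proof (rule ae_curve_mono[OF ae_curve_conj[OF reg support]])
      fix c assume "regular_along u G c \<and> (\<forall>t\<in>{0..fst c}. u (snd c t) \<noteq> 0 \<longrightarrow> \<bar>f (snd c t)\<bar> \<noteq> \<infinity>)"
      then have reg_c: "regular_along u G c"
        and fin: "\<And>t. t \<in> {0..fst c} \<Longrightarrow> u (snd c t) \<noteq> 0 \<longrightarrow> \<bar>f (snd c t)\<bar> \<noteq> \<infinity>"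
        by (rule conjunct1, rule bspec[OF conjunct2])
      show "regular_along w G c"
        by (rule regular_along_cong[OF reg_c]) (rule eq[OF fin])
    qed
    then show "weak_upper_gradient p M w G"
      by (rule weak_upper_gradientI[OF G(1)])
    show "Lp_integral p M G < \<infinity>" by (rule G(2))
    have "e2ennreal \<bar>w x\<bar> \<le> s x" for x
    proof -
      have "w x = u x \<or> w x = 0"
        using ediff_add_cases(1)[OF u_nonneg[of x], of "f x"] by (auto simp: w_def zero_extension_def)
      then show ?thesis by (elim disjE) (simp_all add: u_def)
    qed
    then have "Lp_integral p M (\<lambda>x. e2ennreal \<bar>w x\<bar>) \<le> Lp_integral p M s"
      using p_pos by (intro Lp_integral_mono) auto
    then show "Lp_integral p M (\<lambda>x. e2ennreal \<bar>w x\<bar>) < \<infinity>" using s(2) by simp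
  qed
  have weak_u: "weak_upper_gradient p M u G"
    by (rule weak_upper_gradientI[OF G(1) reg])
  obtain k where k: "upper_gradient (restrict_space M E) f k" "Lp_integral p (restrict_space M E) k < \<infinity>"
    using f by (auto simp: dirichlet_def)
  obtain G' where G': "upper_gradient M u G'" "Lp_integral p M G' < \<infinity>"
    using upper_gradient_from_weak[OF weak_u G(2)] by metis
  have space_E: "space (restrict_space M E) = E"
    by (simp add: space_restrict_space)
  have k_borel: "k \<in> borel_measurable (restrict_space borel E)"
    using k(1) unfolding upper_gradient_def space_E by simp
  have G'_borel: "G' \<in> borel_measurable (restrict_space borel E)"
    using upper_gradient_imp_weak(2)[OF G'(1)] by (rule measurable_restrict_space1)
  have v_in: "(\<lambda>x. f x + u x) \<in> dirichlet p (restrict_space M E)"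
    unfolding dirichlet_def mem_Collect_eq
  proof (intro conjI exI)
    show "(\<lambda>x. f x + u x) \<in> borel_measurable (restrict_space M E)"
      using fm measurable_restrict_space1[OF um] by measurable
    show "Lp_integral p (restrict_space M E) (\<lambda>x. k x + G' x) < \<infinity>"
      using k_borel G'_borel k(2) G'(2) p_pos Lp_integral_restrict_le[OF E, of G']
      by (intro Lp_integral_add_finite borel_measurable_restrict_M) (auto elim: le_less_trans)
    show "upper_gradient (restrict_space M E) (\<lambda>x. f x + u x) (\<lambda>x. k x + G' x)"
      unfolding upper_gradient_def space_E
    proof (intro conjI ballI)
      show "(\<lambda>x. k x + G' x) \<in> borel_measurable (restrict_space borel E)"
        using k_borel G'_borel by measurable
      fix c assume c: "c \<in> curves (restrict_space M E)"
      then have cM: "c \<in> curves M" by (simp add: curves_restrict_space[OF E])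
      have "curve_trace c k \<in> borel_measurable lebesgue" "curve_trace c G' \<in> borel_measurable lebesgue"
        using k_borel G'_borel by (auto intro!: curve_trace_measurable[OF c] simp: space_E)
      moreover have "curve_trace c (\<lambda>x. k x + G' x) = (\<lambda>t. curve_trace c k t + curve_trace c G' t)"
        by (simp add: curve_trace_def distrib_right fun_eq_iff)
      ultimately have sum: "curve_integral c (\<lambda>x. k x + G' x) = curve_integral c k + curve_integral c G'"
        unfolding curve_integral_trace by (simp add: nn_integral_add)
      have le: "endpoint_gap f c \<le> curve_integral c k" "endpoint_gap u c \<le> curve_integral c G'"
        using k(1) G'(1) c cM by (auto simp: upper_gradient_def)
      show "endpoint_gap (\<lambda>x. f x + u x) c \<le> curve_integral c (\<lambda>x. k x + G' x)"
      \<comment> \<open>Finite gaps give finite endpoint values, to which the real triangle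
        inequality applies; an infinite gap makes the right-hand side infinite.\<close>
      proof (cases "endpoint_gap f c < \<infinity> \<and> endpoint_gap u c < \<infinity>")
        case True
        then have fin: "\<bar>f (snd c 0)\<bar> \<noteq> \<infinity>" "\<bar>f (snd c (fst c))\<bar> \<noteq> \<infinity>"
          "\<bar>u (snd c 0)\<bar> \<noteq> \<infinity>" "\<bar>u (snd c (fst c))\<bar> \<noteq> \<infinity>"
          using endpoint_gap_finite[of f c] endpoint_gap_finite[of u c] by simp_all
        then obtain a b a' b' where r: "f (snd c 0) = ereal a" "f (snd c (fst c)) = ereal b"
          "u (snd c 0) = ereal a'" "u (snd c (fst c)) = ereal b'"
          by (metis ereal_real')
        have "endpoint_gap (\<lambda>x. f x + u x) c = ennreal \<bar>(a + a') - (b + b')\<bar>"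
          by (subst endpoint_gap_real) (auto simp: r)
        also have "\<dots> \<le> ennreal (\<bar>a - b\<bar> + \<bar>a' - b'\<bar>)"
          by (intro ennreal_leI) auto
        also have "\<dots> = endpoint_gap f c + endpoint_gap u c"
          using fin by (simp add: endpoint_gap_real r)
        also have "\<dots> \<le> curve_integral c (\<lambda>x. k x + G' x)"
          unfolding sum using le by (rule add_mono)
        finally show ?thesis .
      next
        case False
        then have "curve_integral c k = \<infinity> \<or> curve_integral c G' = \<infinity>"
          using le by (auto simp: less_top[symmetric] top_unique)
        then show ?thesis unfolding sum by auto
      qed
    qed
  qed
  have "{x \<in> E. \<not> \<psi> x \<le> f x + u x} = {}"
    using \<psi> ediff_le_imp_le_add[OF u_nonneg] by (auto simp: u_def)
  then have "sobolev_capacity p M {x \<in> E. \<not> \<psi> x \<le> f x + u x} = 0"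
    by (simp only: sobolev_capacity_empty)
  then show ?thesis
    using v_in w_in unfolding obstacle_class_def newtonian_zero_iff w_def u_def by simp
qed


section \<open>Sufficiency: an admissible function from almost optimal test functions\<close>

lemma obstacle_class_nonempty:
  assumes p: "p \<ge> 1" and poincare: "poincare_zero p M" and E: "E \<in> sets M" "bounded E"
    "sobolev_capacity p M (space M - E) > 0" and f: "f \<in> dirichlet p (restrict_space M E)"
    and fin: "(\<integral>\<^sup>+t. ennreal (t powr (p - 1)) *
        variational_capacity p M {x \<in> E. ediff (\<psi> x) (f x) > ereal t} E *
        indicator {0<..} t \<partial>lborel) < \<infinity>"
  shows "obstacle_class p M E \<psi> f \<noteq> {}"
proof -
  define A where "A t = {x \<in> E. ediff (\<psi> x) (f x) > ereal t}" for t
  define \<Phi> where "\<Phi> t = variational_capacity p M (A t) E" for t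
  have "(\<Sum>n. ennreal (dyad n powr p) * \<Phi> (2 * dyad n)) \<le>
      (\<integral>\<^sup>+t. ennreal (t powr (p - 1)) * \<Phi> t * indicator {0<..} t \<partial>lborel)"
  proof (intro dyadic_lower p)
    fix s t :: real assume "s \<le> t"
    then have "A t \<subseteq> A s" unfolding A_def by (auto intro: le_less_trans[of "ereal s" "ereal t"])
    then show "\<Phi> t \<le> \<Phi> s" unfolding \<Phi>_def by (rule variational_capacity_mono)
  qed
  also have "\<dots> < \<infinity>" using fin by (simp add: A_def \<Phi>_def)
  finally have sum_fin: "(\<Sum>n. ennreal (dyad n powr p) * \<Phi> (2 * dyad n)) < \<infinity>" .
  have \<Phi>_fin: "\<Phi> (2 * dyad n) < \<infinity>" for n
    using ennreal_suminf_lessD[OF sum_fin, of n] dyad_pos[of n]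
    by (auto simp: ennreal_mult_less_top ennreal_eq_0_iff not_le)
  \<comment> \<open>Multiplied by the p-th power of the weight \<open>8 * dyad n\<close>, this error
    becomes \<open>(1/2)^n\<close>.\<close>
  define \<epsilon> where "\<epsilon> n = (1/2)^n / (8 * dyad n) powr p" for n :: nat
  have "\<exists>u\<in>newtonian_zero p M E. (\<forall>x\<in>A (2 * dyad n). u x \<ge> 1) \<and>
      grad_energy p M (zero_extension E u) < \<Phi> (2 * dyad n) + ennreal (\<epsilon> n)" for n
  proof -
    have "0 < \<epsilon> n" unfolding \<epsilon>_def using dyad_pos[of n] by (intro divide_pos_pos) auto
    then have "\<Phi> (2 * dyad n) < \<Phi> (2 * dyad n) + ennreal (\<epsilon> n)"
      using \<Phi>_fin[of n] by (cases "\<Phi> (2 * dyad n)") (auto simp: ennreal_less_iff simp flip: ennreal_plus)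
    then show ?thesis
      by (subst (asm) (1) \<Phi>_def) (auto simp: variational_capacity_def INF_less_iff)
  qed
  then obtain u where u: "\<And>n. u n \<in> newtonian_zero p M E" "\<And>n x. x \<in> A (2 * dyad n) \<Longrightarrow> u n x \<ge> 1"
    "\<And>n. grad_energy p M (zero_extension E (u n)) < \<Phi> (2 * dyad n) + ennreal (\<epsilon> n)"
    by metis
  define h where "h n = zero_extension E (u n)" for n
  have h: "h n \<in> newtonian p M" for n
    using u(1) by (simp add: h_def newtonian_zero_iff)
  \<comment> \<open>One constant serves all scales because \<open>E\<close> is fixed.\<close>
  obtain C where C: "C > 0" "\<And>n. Lp_integral p M (\<lambda>x. e2ennreal \<bar>h n x\<bar>) \<le> ennreal C * grad_energy p M (h n)"
    using poincare E u(1) unfolding poincare_zero_def h_def by (metis space_M subset_UNIV)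
  define a where "a n x = ennreal (8 * dyad n) * e2ennreal \<bar>h n x\<bar>" for n x
  define g where "g n x = ennreal (8 * dyad n) * min_grad p M (h n) x" for n x
  define s where "s x = (SUP n. a n x)" for x
  define G where "G = lp_sum p g"
  have meas: "a n \<in> borel_measurable M" "g n \<in> borel_measurable M" for n
    unfolding a_def[abs_def] g_def[abs_def]
    using newtonianD(1,3)[OF h] by (auto intro!: borel_measurable_times_ennreal abs_measurable)
  have sm: "s \<in> borel_measurable M"
    unfolding s_def[abs_def] using meas(1) by measurable
  have Gm: "G \<in> borel_measurable M"
    unfolding G_def using meas(2) by (rule borel_measurable_lp_sum)
  have s_le: "s x \<le> lp_sum p a x" for x
    unfolding s_def by (intro SUP_least lp_sum_ge p_pos)
  have Lp_g: "Lp_integral p M (g n) \<le> ennreal (8 powr p) * (ennreal (dyad n powr p) * \<Phi> (2 * dyad n)) + ennreal ((1/2)^n)" for n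
  proof -
    have "Lp_integral p M (g n) = ennreal ((8 * dyad n) powr p) * grad_energy p M (h n)"
      unfolding g_def[abs_def] grad_energy_def using newtonianD(3)[OF h[of n]] dyad_pos[of n]
      by (subst Lp_integral_cmult) (simp_all add: epow_ennreal less_imp_le)
    also have "\<dots> \<le> ennreal ((8 * dyad n) powr p) * (\<Phi> (2 * dyad n) + ennreal (\<epsilon> n))"
      using u(3)[of n] unfolding h_def by (intro mult_left_mono) auto
    also have "\<dots> = ennreal ((8 * dyad n) powr p) * \<Phi> (2 * dyad n) + ennreal ((8 * dyad n) powr p) * ennreal (\<epsilon> n)"
      by (rule distrib_left)
    also have "ennreal ((8 * dyad n) powr p) * ennreal (\<epsilon> n) = ennreal ((1/2)^n)"
      using dyad_pos[of n] by (simp add: \<epsilon>_def less_imp_neq[symmetric] flip: ennreal_mult)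
    also have "ennreal ((8 * dyad n) powr p) = ennreal (8 powr p) * ennreal (dyad n powr p)"
      using dyad_pos[of n] by (simp add: powr_mult less_imp_le ennreal_mult)
    finally show ?thesis by (simp add: mult.assoc)
  qed
  have Lp_a: "Lp_integral p M (a n) \<le> ennreal C * Lp_integral p M (g n)" for n
  proof -
    have "Lp_integral p M (a n) = epow (ennreal (8 * dyad n)) p * Lp_integral p M (\<lambda>x. e2ennreal \<bar>h n x\<bar>)"
      unfolding a_def[abs_def] by (intro Lp_integral_cmult abs_measurable newtonianD(1) h)
    also have "\<dots> \<le> epow (ennreal (8 * dyad n)) p * (ennreal C * grad_energy p M (h n))"
      by (intro mult_left_mono C) simp
    also have "\<dots> = ennreal C * (epow (ennreal (8 * dyad n)) p * grad_energy p M (h n))"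
      by (simp add: mult.left_commute)
    also have "epow (ennreal (8 * dyad n)) p * grad_energy p M (h n) = Lp_integral p M (g n)"
      unfolding g_def[abs_def] grad_energy_def by (intro Lp_integral_cmult[symmetric] newtonianD(3) h)
    finally show ?thesis .
  qed
  have g_sum: "(\<Sum>n. Lp_integral p M (g n)) < \<infinity>"
  proof -
    have "(\<Sum>n. Lp_integral p M (g n)) \<le>
        (\<Sum>n. ennreal (8 powr p) * (ennreal (dyad n powr p) * \<Phi> (2 * dyad n)) + ennreal ((1/2)^n))"
      by (intro suminf_le Lp_g) auto
    also have "\<dots> = ennreal (8 powr p) * (\<Sum>n. ennreal (dyad n powr p) * \<Phi> (2 * dyad n)) + (\<Sum>n. ennreal ((1/2)^n))"
      by (subst suminf_add[symmetric]) (simp_all add: ennreal_suminf_cmult)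
    also have "\<dots> < \<infinity>"
    proof -
      have "(\<Sum>n. ennreal ((1/2)^n)) < \<infinity>"
        by (subst suminf_ennreal2) (auto intro: summable_geometric)
      then show ?thesis using sum_fin by (simp add: ennreal_mult_less_top)
    qed
    finally show ?thesis .
  qed
  then have G_fin: "Lp_integral p M G < \<infinity>"
    unfolding G_def by (subst Lp_integral_lp_sum[OF p_pos meas(2)])
  have "Lp_integral p M (lp_sum p a) = (\<Sum>n. Lp_integral p M (a n))"
    by (rule Lp_integral_lp_sum[OF p_pos meas(1)])
  also have "\<dots> \<le> (\<Sum>n. ennreal C * Lp_integral p M (g n))"
    by (intro suminf_le Lp_a) auto
  also have "\<dots> = ennreal C * (\<Sum>n. Lp_integral p M (g n))"
    by (rule ennreal_suminf_cmult)
  also have "\<dots> < \<infinity>" using g_sum by (simp add: ennreal_mult_less_top)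
  finally have a_fin: "Lp_integral p M (lp_sum p a) < \<infinity>" .
  have s_fin: "Lp_integral p M s < \<infinity>"
    using Lp_integral_mono[of p M s "lp_sum p a"] s_le p_pos a_fin by (meson le_less_trans)
  have weak: "weak_upper_gradient p M (\<lambda>x. enn2ereal (s x)) G"
    unfolding weak_upper_gradient_iff
  proof (intro conjI Gm)
    have "ae_curve p M (\<lambda>c. (\<forall>n. regular_along (h n) (min_grad p M (h n)) c) \<and>
        curve_integral c (lp_sum p a) < \<infinity> \<and> curve_integral c G < \<infinity> \<and> curve_trace c G \<in> borel_measurable lebesgue)"
      using newtonianD(6)[OF h] a_fin meas G_fin Gm
      by (intro ae_curve_conj ae_curve_all ae_curve_integrable ae_curve_trace_measurable borel_measurable_lp_sum)
    then show "ae_curve p M (\<lambda>c. curve_trace c G \<in> borel_measurable lebesgue \<and>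
        endpoint_gap (\<lambda>x. enn2ereal (s x)) c \<le> curve_integral c G)"
    proof (rule ae_curve_mono, intro conjI)
      fix c assume c: "c \<in> curves M" and *: "(\<forall>n. regular_along (h n) (min_grad p M (h n)) c) \<and>
        curve_integral c (lp_sum p a) < \<infinity> \<and> curve_integral c G < \<infinity> \<and> curve_trace c G \<in> borel_measurable lebesgue"
      then show "curve_trace c G \<in> borel_measurable lebesgue" by blast
      have len: "0 \<le> fst c" using c by (auto simp: curves_def)
      \<comment> \<open>Each \<open>a n\<close> grows by at most the integral of \<open>g n\<close>,
        hence of \<open>G\<close>. This bound is free of \<open>n\<close> and so survives the
        supremum.\<close>
      have osc: "s (snd c t) \<le> s (snd c r) + curve_integral c G" if "r \<in> {0..fst c}" "t \<in> {0..fst c}" for r t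
        unfolding s_def
      proof (rule SUP_least)
        fix n
        have "a n (snd c t) \<le> ennreal (8 * dyad n) * (e2ennreal \<bar>h n (snd c r)\<bar> + curve_integral c (min_grad p M (h n)))"
          unfolding a_def using * that by (intro mult_left_mono regular_along_osc) auto
        also have "\<dots> = a n (snd c r) + (\<integral>\<^sup>+t. ennreal (8 * dyad n) * curve_trace c (min_grad p M (h n)) t \<partial>lebesgue)"
          using regular_alongD(1)[of "h n" "min_grad p M (h n)" c] * len
          by (simp add: a_def distrib_left curve_integral_trace nn_integral_cmult)
        also have "\<dots> \<le> (SUP n. a n (snd c r)) + curve_integral c G"
          unfolding curve_integral_trace curve_trace_def G_def
          using lp_sum_ge[OF p_pos, of g n]
          by (intro add_mono SUP_upper nn_integral_mono) (auto simp: indicator_def g_def)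
        finally show "a n (snd c t) \<le> (SUP n. a n (snd c r)) + curve_integral c G" .
      qed
      obtain r where r: "r \<in> {0..fst c}" "lp_sum p a (snd c r) < \<infinity>"
        using curve_integral_finite_point[OF c, of "lp_sum p a"] * by blast
      \<comment> \<open>Finiteness at one point spreads along the curve, so the endpoint gap is a
        difference of real numbers.\<close>
      then have "s (snd c r) < \<infinity>" using s_le by (meson le_less_trans)
      then have fin: "s (snd c t) < \<infinity>" if "t \<in> {0..fst c}" for t
        using osc[OF r(1) that] * by (auto elim!: le_less_trans)
      have ends: "0 \<in> {0..fst c}" "fst c \<in> {0..fst c}" using len by auto
      obtain x where x: "s (snd c 0) = ennreal x" "0 \<le> x" using fin[OF ends(1)] by (cases "s (snd c 0)") auto
      obtain y where y: "s (snd c (fst c)) = ennreal y" "0 \<le> y" using fin[OF ends(2)] by (cases "s (snd c (fst c))") auto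
      obtain I where I: "curve_integral c G = ennreal I" "0 \<le> I" using * by (cases "curve_integral c G") auto
      have "x \<le> y + I" "y \<le> x + I"
        using osc[OF ends(2,1)] osc[OF ends] x y I by (auto simp flip: ennreal_plus)
      then have "\<bar>x - y\<bar> \<le> I" by linarith
      then show "endpoint_gap (\<lambda>x. enn2ereal (s x)) c \<le> curve_integral c G"
        using x y I by (subst endpoint_gap_real) (auto simp: enn2ereal_ennreal intro: ennreal_leI)
    qed
  qed
  have reg: "ae_curve p M (regular_along (\<lambda>x. enn2ereal (s x)) G)"
    by (rule weak_upper_gradient_regular[OF weak ae_curve_integrable[OF Gm G_fin]])
  have s0: "s x = 0" if "x \<notin> E" for x
    using that by (simp add: s_def a_def h_def zero_extension_def)
  have s_ge: "ennreal y \<le> s x" if x: "x \<in> E" and y: "0 < y" "ereal y \<le> ediff (\<psi> x) (f x)" for x y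
  proof -
    \<comment> \<open>This gives \<open>2 * dyad n < y < 8 * dyad n\<close>: the first inequality
      puts \<open>x\<close> in the set where \<open>u n\<close> is at least 1, the second makes the
      weight exceed \<open>y\<close>. It is the origin of the factor 8.\<close>
    obtain n where n: "dyad n \<le> y / 4" "y / 4 < 2 * dyad n"
      using dyad_exists[of "y / 4"] y(1) by auto
    have "ereal (2 * dyad n) < ereal y" using n y(1) by simp
    also note y(2)
    finally have "1 \<le> u n x" using x by (intro u(2)) (simp add: A_def)
    then have "1 \<le> h n x" using x by (simp add: h_def zero_extension_def)
    then have "e2ennreal 1 \<le> e2ennreal \<bar>h n x\<bar>"
      by (intro e2ennreal_mono) (cases "h n x", auto simp: one_ereal_def)
    then have "ennreal (8 * dyad n) * 1 \<le> a n x"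
      unfolding a_def by (intro mult_left_mono) simp_all
    moreover have "ennreal y \<le> ennreal (8 * dyad n)" using n by (intro ennreal_leI) simp
    moreover have "a n x \<le> s x" unfolding s_def by (rule SUP_upper) simp
    ultimately show ?thesis by (metis mult.right_neutral order_trans)
  qed
  have \<psi>_le: "ediff (\<psi> x) (f x) \<le> enn2ereal (s x)" if "x \<in> E" "0 < ediff (\<psi> x) (f x)" for x
  proof (cases "ediff (\<psi> x) (f x)")
    case (real y)
    then have "ennreal y \<le> s x" using that by (intro s_ge) auto
    then show ?thesis using real that(2) by (simp add: less_eq_ennreal.rep_eq enn2ereal_ennreal)
  next
    case PInf
    have "ennreal (2^n) \<le> s x" for n :: nat using that(1) PInf by (intro s_ge) auto
    then have "s x = \<infinity>" by (rule ennreal_unbounded)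
    then show ?thesis by simp
  next
    case MInf
    then show ?thesis using that(2) by simp
  qed
  show ?thesis
    using obstacle_class_add[OF E(1) f sm s_fin s0 Gm G_fin reg \<psi>_le] by blast
qed

end

theorem theorem6p1:
  fixes M :: "'a::metric_space measure"
    and p :: real
    and E :: "'a set"
    and f \<psi> :: "'a \<Rightarrow> ereal"
  assumes "metric_measure_space M"
    and "p > 1"
    and "poincare_zero p M"
    and "E \<in> sets M"
    and "bounded E"
    and "sobolev_capacity p M (space M - E) > 0"
    and "f \<in> dirichlet p (restrict_space M E)"
  shows "obstacle_class p M E \<psi> f \<noteq> {} \<longleftrightarrow>
    (\<integral>\<^sup>+t. ennreal (t powr (p - 1)) *
        variational_capacity p M {x \<in> E. ediff (\<psi> x) (f x) > ereal t} E *
        indicator {0<..} t \<partial>lborel) < \<infinity>"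
proof -
  interpret newtonian_space M p
    using assms(1,2) by unfold_locales auto
  have "p \<ge> 1" using assms(2) by simp
  then show ?thesis
    using obstacle_capacity_integral_finite[of _ E \<psi> f] obstacle_class_nonempty[of E f \<psi>] assms(3-7)
    by blast
qed

end
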